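(* There exists an absolute constant $\varepsilon>0$ such that if the initial data $(u_0,\theta_0)$, with $u_0:\mathbb{R}^3\to\mathbb{R}^3$ divergence free, satisfy $$\sup_{x\in\mathbb{R}^3}|x||u_0(x)|<\varepsilon$$ and $$\|te^{t\Delta}\mathbb{P}(\theta_0e_3)\|_{\mathcal{X}}<\varepsilon,\qquad \|e^{t\Delta}\theta_0\|_{\mathcal{Y}}<\varepsilon,$$ then there exists a unique mild solution $(u,\theta)\in\mathcal{X}\times\mathcal{Y}$ of the Boussinesq system with initial data $(u_0,\theta_0)$ such that $$\|u\|_{\mathcal{X}}\le C\varepsilon\quad\text{and}\quad\|\theta\|_{\mathcal{Y}}\le C\varepsilon,$$ where $C$ is a universal constant.
   Context: The Boussinesq system on $(0,\infty)\times\mathbb{R}^3$ is $$\partial_t u+u\cdot\nabla u+\nabla P=\Delta u+\theta e_3,\quad \operatorname{div}u=0,\quad \partial_t\theta+u\cdot\nabla\theta=\Delta\theta,\quad u(0,\cdot)=u_0,\ \theta(0,\cdot)=\theta_0,$$ with $u$ vector valued in $\mathbb{R}^3$, $P,\theta$ scalar, $e_3=(0,0,1)^T$. $e^{t\Delta}$ is the heat semigroup on $\mathbb{R}^3$ and $\mathbb{P}$ the Leray projector onto divergence-free fields (Fourier symbol $\delta_{jk}-\xi_j\xi_k/|\xi|^2$). $\mathcal{X}$ is the space of vector functions $u(t,x)$ with $\|u\|_{\mathcal{X}}=\sup_{x\in\mathbb{R}^3,t>0}(\sqrt t+|x|)|u(t,x)|<\infty$, and $\mathcal{Y}$ is the space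 of scalar functions $\theta(t,x)$ with $\|\theta\|_{\mathcal{Y}}=\sup_{x\in\mathbb{R}^3,t>0}(\sqrt t+|x|)^3|\theta(t,x)|<\infty$. A mild solution is a pair $(u,\theta)$ satisfying the integral equations $$u(t)=e^{t\Delta}u_0+te^{t\Delta}\mathbb{P}(\theta_0e_3)-\int_0^te^{(t-s)\Delta}\mathbb{P}\nabla\cdot(u\otimes u)(s)\,ds-\int_0^t(t-s)e^{(t-s)\Delta}\mathbb{P}\big(\nabla\cdot(\theta u)(s)\,e_3\big)\,ds,$$ $$\theta(t)=e^{t\Delta}\theta_0-\int_0^te^{(t-s)\Delta}\nabla\cdot(\theta u)(s)\,ds,$$ where the spatial derivatives are understood as falling on the convolution kernels. *)

theory Defs
  imports "HOL-Analysis.Analysis"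
begin

type_synonym R3 = "real ^ 3"

definition e3 :: R3
  where "e3 = axis 3 1"

definition outer :: "R3 \<Rightarrow> R3 \<Rightarrow> real ^ 3 ^ 3"
  where "outer a b = (\<chi> k l. a $ k * b $ l)"


subsection \<open>Test functions and tempered distributions\<close>

definition partial :: "3 \<Rightarrow> (R3 \<Rightarrow> real) \<Rightarrow> R3 \<Rightarrow> real"
  where "partial i f x = frechet_derivative f (at x) (axis i 1)"

fun partials :: "3 list \<Rightarrow> (R3 \<Rightarrow> real) \<Rightarrow> R3 \<Rightarrow> real"
  where
    "partials [] f = f"
  | "partials (i # is) f = partial i (partials is f)"

definition smooth :: "(R3 \<Rightarrow> real) \<Rightarrow> bool"
  where "smooth f \<longleftrightarrow> (\<forall>is x. partials is f differentiable (at x))"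

definition schwartz :: "(R3 \<Rightarrow> real) set"
  where "schwartz = {\<phi>. smooth \<phi> \<and>
    (\<forall>N is. bounded (range (\<lambda>x. (1 + norm x) ^ N * partials is \<phi> x)))}"

definition schwartz_norm :: "nat \<Rightarrow> (R3 \<Rightarrow> real) \<Rightarrow> real"
  where "schwartz_norm N \<phi> =
    (SUP (is, x) \<in> {is. length is \<le> N} \<times> UNIV. (1 + norm x) ^ N * \<bar>partials is \<phi> x\<bar>)"

text \<open>
  The norms \<^const>\<open>schwartz_norm\<close> increase with the index and generate the topology of the
  Schwartz space, so that continuity of a linear functional is a bound by one of them.
\<close>

definition tempered_distribution :: "((R3 \<Rightarrow> real) \<Rightarrow> real) \<Rightarrow> bool"
  where "tempered_distribution T \<longleftrightarrow>
    (\<forall>\<phi>\<in>schwartz. \<forall>\<psi>\<in>schwartz. T (\<lambda>x. \<phi> x + \<psi> x) = T \<phi> + T \<psi>) \<and>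
    (\<forall>c. \<forall>\<phi>\<in>schwartz. T (\<lambda>x. c * \<phi> x) = c * T \<phi>) \<and>
    (\<exists>C N. \<forall>\<phi>\<in>schwartz. \<bar>T \<phi>\<bar> \<le> C * schwartz_norm N \<phi>)"

text \<open>Divergence free in the sense of distributions.\<close>

definition divergence_free :: "(R3 \<Rightarrow> R3) \<Rightarrow> bool"
  where "divergence_free f \<longleftrightarrow>
    (\<forall>\<phi>. smooth \<phi> \<longrightarrow> bounded {x. \<phi> x \<noteq> 0} \<longrightarrow>
      (LINT x|lebesgue. (\<Sum>i\<in>UNIV. f x $ i * partial i \<phi> x)) = 0)"


subsection \<open>Heat semigroup and Leray projector\<close>

definition heat_kernel :: "real \<Rightarrow> R3 \<Rightarrow> real"
  where "heat_kernel t x = (4 * pi * t) powr (- 3 / 2) * exp (- (norm x)\<^sup>2 / (4 * t))"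

definition leray_symbol :: "R3 \<Rightarrow> real ^ 3 ^ 3"
  where "leray_symbol \<xi> = (\<chi> j k. (if j = k then 1 else 0) - \<xi> $ j * \<xi> $ k / (norm \<xi>)\<^sup>2)"

text \<open>
  The convolution kernel of \<open>e\<^sup>t\<^sup>\<Delta> P\<close>: the inverse Fourier transform of
  \<open>exp (- t |\<xi>|\<^sup>2)\<close> times the symbol of \<open>P\<close>.  The integral is real because the symbol is even.
\<close>

definition heat_leray_kernel :: "real \<Rightarrow> R3 \<Rightarrow> real ^ 3 ^ 3"
  where "heat_leray_kernel t x = (\<chi> j k.
    Re (LINT \<xi>|lebesgue. cis (x \<bullet> \<xi>) *
          complex_of_real (exp (- t * (norm \<xi>)\<^sup>2) * leray_symbol \<xi> $ j $ k)) / (2 * pi) ^ 3)"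

definition heat :: "real \<Rightarrow> (R3 \<Rightarrow> R3) \<Rightarrow> R3 \<Rightarrow> R3"
  where "heat t f x = (LINT y|lebesgue. heat_kernel t (x - y) *\<^sub>R f y)"

definition heat_leray :: "real \<Rightarrow> (R3 \<Rightarrow> R3) \<Rightarrow> R3 \<Rightarrow> R3"
  where "heat_leray t f x = (LINT y|lebesgue. heat_leray_kernel t (x - y) *v f y)"

text \<open>
  \<open>e\<^sup>t\<^sup>\<Delta> \<nabla>\<cdot>f\<close> for a vector field \<open>f\<close> and \<open>e\<^sup>t\<^sup>\<Delta> P \<nabla>\<cdot>F\<close> for a matrix field \<open>F\<close>, where
  \<open>(\<nabla>\<cdot>F)\<^sub>k = \<Sum>\<^sub>l \<partial>\<^sub>l F\<^sub>k\<^sub>l\<close>; the derivatives fall on the convolution kernels.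
\<close>

definition heat_div :: "real \<Rightarrow> (R3 \<Rightarrow> R3) \<Rightarrow> R3 \<Rightarrow> real"
  where "heat_div t f x =
    (LINT y|lebesgue. (\<Sum>l\<in>UNIV. partial l (heat_kernel t) (x - y) * f y $ l))"

definition heat_leray_div :: "real \<Rightarrow> (R3 \<Rightarrow> real ^ 3 ^ 3) \<Rightarrow> R3 \<Rightarrow> R3"
  where "heat_leray_div t F x =
    (LINT y|lebesgue. (\<chi> j. \<Sum>k\<in>UNIV. \<Sum>l\<in>UNIV.
       partial l (\<lambda>z. heat_leray_kernel t z $ j $ k) (x - y) * F y $ k $ l))"

definition heat_distr :: "real \<Rightarrow> ((R3 \<Rightarrow> real) \<Rightarrow> real) \<Rightarrow> R3 \<Rightarrow> real"
  where "heat_distr t T x = T (\<lambda>y. heat_kernel t (x - y))"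

text \<open>
  \<open>e\<^sup>t\<^sup>\<Delta> P (T e\<^sub>3)\<close> for a tempered distribution \<open>T\<close>.  The kernel of \<open>e\<^sup>t\<^sup>\<Delta> P\<close> decays only like
  \<open>|x|\<^sup>-\<^sup>3\<close> and is not a Schwartz function, so \<open>T\<close> cannot be tested against it.  We use
  \<open>e\<^sup>t\<^sup>\<Delta> P = e\<^sup>(\<^sup>t\<^sup>/\<^sup>2\<^sup>)\<^sup>\<Delta> P e\<^sup>(\<^sup>t\<^sup>/\<^sup>2\<^sup>)\<^sup>\<Delta>\<close>: if \<open>e\<^sup>t\<^sup>\<Delta> T\<close> lies in the space \<open>Y\<close> below, then \<open>e\<^sup>(\<^sup>t\<^sup>/\<^sup>2\<^sup>)\<^sup>\<Delta> T\<close> is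
  bounded and \<open>O(|x|\<^sup>-\<^sup>3)\<close>, and the outer convolution converges absolutely.
\<close>

definition heat_leray_distr :: "real \<Rightarrow> ((R3 \<Rightarrow> real) \<Rightarrow> real) \<Rightarrow> R3 \<Rightarrow> R3"
  where "heat_leray_distr t T = heat_leray (t / 2) (\<lambda>y. heat_distr (t / 2) T y *\<^sub>R e3)"


subsection \<open>The solution spaces\<close>

definition normX :: "(real \<Rightarrow> R3 \<Rightarrow> R3) \<Rightarrow> ereal"
  where "normX u = (SUP (t, x) \<in> {0<..} \<times> UNIV. ereal ((sqrt t + norm x) * norm (u t x)))"

definition normY :: "(real \<Rightarrow> R3 \<Rightarrow> real) \<Rightarrow> ereal"
  where "normY \<theta> = (SUP (t, x) \<in> {0<..} \<times> UNIV. ereal ((sqrt t + norm x) ^ 3 * \<bar>\<theta> t x\<bar>))"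

text \<open>Only the values at times \<open>t > 0\<close> are relevant.\<close>

definition spaceX :: "(real \<Rightarrow> R3 \<Rightarrow> R3) set"
  where "spaceX = {u. (\<lambda>(t, x). u t x) \<in> borel_measurable (lebesgue_on ({0<..} \<times> UNIV)) \<and>
    normX u < \<infinity>}"

definition spaceY :: "(real \<Rightarrow> R3 \<Rightarrow> real) set"
  where "spaceY = {\<theta>. (\<lambda>(t, x). \<theta> t x) \<in> borel_measurable (lebesgue_on ({0<..} \<times> UNIV)) \<and>
    normY \<theta> < \<infinity>}"


subsection \<open>Mild solutions\<close>

text \<open>
  The term \<open>P (\<nabla>\<cdot>(\<theta> u) e\<^sub>3)\<close> is written as \<open>P \<nabla>\<cdot>(e\<^sub>3 \<otimes> \<theta> u)\<close>.  For \<open>(u, \<theta>)\<close> in \<open>X \<times> Y\<close> the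
  integrands of all three Duhamel terms are absolutely integrable in \<open>(s, y)\<close>, so the default value
  of the Bochner integral plays no role.
\<close>

definition mild_solution ::
  "(R3 \<Rightarrow> R3) \<Rightarrow> ((R3 \<Rightarrow> real) \<Rightarrow> real) \<Rightarrow> (real \<Rightarrow> R3 \<Rightarrow> R3) \<Rightarrow> (real \<Rightarrow> R3 \<Rightarrow> real) \<Rightarrow> bool"
  where "mild_solution u0 \<theta>0 u \<theta> \<longleftrightarrow> (\<forall>t>0. \<forall>x.
    u t x = heat t u0 x + t *\<^sub>R heat_leray_distr t \<theta>0 x
      - (LINT s:{0<..<t}|lebesgue. heat_leray_div (t - s) (\<lambda>y. outer (u s y) (u s y)) x)
      - (LINT s:{0<..<t}|lebesgue.
           (t - s) *\<^sub>R heat_leray_div (t - s) (\<lambda>y. outer e3 (\<theta> s y *\<^sub>R u s y)) x) \<and>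
    \<theta> t x = heat_distr t \<theta>0 x
      - (LINT s:{0<..<t}|lebesgue. heat_div (t - s) (\<lambda>y. \<theta> s y *\<^sub>R u s y) x))"

end

theory Submission
  imports Defs "HOL-Probability.Probability"
begin

text \<open>
The solution is the fixed point of a quadratic map, and everything is measured with the parabolic
norm \<open>\<rho>(t, x) = \<surd>t + |x|\<close>: the balls of \<open>X\<close> and \<open>Y\<close> are given by \<open>|u| \<le> r / \<rho>\<close> and
\<open>|\<theta>| \<le> r / \<rho>\<^sup>3\<close>.  The convolution kernels of \<open>e\<^sup>t\<^sup>\<Delta> P \<nabla>\<close> and \<open>e\<^sup>t\<^sup>\<Delta> \<nabla>\<close> are \<open>O(\<rho>\<^sup>-\<^sup>4)\<close>; multiplied by
\<open>t\<close>, the first one is \<open>O(\<rho>\<^sup>-\<^sup>2)\<close>.  The quadratic terms \<open>u \<otimes> u\<close> and \<open>\<theta> u\<close> are \<open>O(\<rho>\<^sup>-\<^sup>2)\<close> and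
\<open>O(\<rho>\<^sup>-\<^sup>4)\<close>.  A parabolic ball of radius \<open>R\<close> has volume of order \<open>R\<^sup>5\<close>, and so the space-time
convolution of \<open>\<rho>\<^sup>-\<^sup>a\<close> and \<open>\<rho>\<^sup>-\<^sup>b\<close> is \<open>O(\<rho>\<^sup>5\<^sup>-\<^sup>a\<^sup>-\<^sup>b)\<close> as soon as \<open>a, b < 5 < a + b\<close>
(\<open>parabolic_convolution\<close>).  For the pairs \<open>(a, b) = (4, 2), (2, 4), (4, 4)\<close> of the three Duhamel
terms the results are \<open>\<rho>\<^sup>-\<^sup>1\<close>, \<open>\<rho>\<^sup>-\<^sup>1\<close> and \<open>\<rho>\<^sup>-\<^sup>3\<close>, which is exactly what \<open>X\<close> and \<open>Y\<close> require.  Hence the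
map preserves a small ball and is a contraction there (\<open>duhamel_map_estimates\<close>).  The part of the
first approximation that is not small by assumption, \<open>e\<^sup>t\<^sup>\<Delta> u\<^sub>0\<close>, is bounded in \<open>norm_heat_le\<close>.

The kernel bounds come from one class of functions, polynomials in \<open>x\<close> and \<open>1 / t\<close> times the heat
kernel, graded by parabolic homogeneity (\<open>heat_class\<close>).  It is closed under differentiation, and
homogeneity of degree \<open>-k\<close> implies the bound \<open>O(\<rho>\<^sup>-\<^sup>k)\<close>.  The Leray projector is brought into this
class by \<open>\<xi>\<^sub>j \<xi>\<^sub>k |\<xi>|\<^sup>-\<^sup>2 exp (- t |\<xi>|\<^sup>2) = \<integral>\<^sub>s\<^sub>\<ge>\<^sub>t \<xi>\<^sub>j \<xi>\<^sub>k exp (- s |\<xi>|\<^sup>2) ds\<close>, which turns into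
\<open>\<delta>\<^sub>j\<^sub>k G\<^sub>t + \<integral>\<^sub>s\<^sub>\<ge>\<^sub>t \<partial>\<^sub>j \<partial>\<^sub>k G\<^sub>s ds\<close> for the kernel (\<open>heat_leray_kernel_eq\<close>).

The iteration runs in Borel measurable functions, so that all Duhamel integrals are honest integrals
over space-time.  The heat flow of a distribution is Borel because it is locally Lipschitz in \<open>(t, x)\<close>
(\<open>heat_distr_locally_lipschitz\<close>).  Uniqueness concerns Lebesgue measurable competitors; but the
Duhamel integrals do not see null sets, and therefore every mild solution is a Borel function at
positive times (\<open>fixed_point_borel\<close>) and the contraction applies to it.
\<close>

section \<open>Integrals of powers of a distance\<close>

lemma dyadic_inside:
  fixes q R :: real
  assumes "0 < q" "q < R"
  shows "\<exists>k. R / 2 ^ Suc k \<le> q \<and> q < R / 2 ^ k"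
proof -
  obtain n where n: "R / 2 ^ n \<le> q"
  proof -
    obtain n where "R / q < 2 ^ n" using real_arch_pow[of 2 "R / q"] by auto
    then have "R / 2 ^ n \<le> q" using assms by (simp add: field_simps)
    then show ?thesis by (rule that)
  qed
  define m where "m = (LEAST n. R / 2 ^ n \<le> q)"
  have m: "R / 2 ^ m \<le> q" unfolding m_def by (rule LeastI[of _ n], rule n)
  have "m \<noteq> 0" using m assms by (cases m) auto
  then obtain k where k: "m = Suc k" by (cases m) auto
  have "\<not> R / 2 ^ k \<le> q" using not_less_Least[of k "\<lambda>n. R / 2 ^ n \<le> q"] k m_def by auto
  with m k show ?thesis by (intro exI[of _ k]) auto
qed

lemma dyadic_outside:
  fixes q R :: real
  assumes "0 < R" "R \<le> q"
  shows "\<exists>k. R * 2 ^ k \<le> q \<and> q < R * 2 ^ Suc k"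
proof -
  obtain n where n: "q < R * 2 ^ n"
  proof -
    obtain n where "q / R < 2 ^ n" using real_arch_pow[of 2 "q / R"] by auto
    then have "q < R * 2 ^ n" using assms by (simp add: field_simps)
    then show ?thesis by (rule that)
  qed
  define m where "m = (LEAST n. q < R * 2 ^ n)"
  have m: "q < R * 2 ^ m" unfolding m_def by (rule LeastI[of _ n], rule n)
  have "m \<noteq> 0" using m assms by (cases m) auto
  then obtain k where k: "m = Suc k" by (cases m) auto
  have "\<not> q < R * 2 ^ k" using not_less_Least[of k "\<lambda>n. q < R * 2 ^ n"] k m_def by auto
  with m k show ?thesis by (intro exI[of _ k]) auto
qed

text \<open>
The form in which a dyadic decomposition is integrated: balls of radii \<open>r k\<close> with weights \<open>\<kappa> k\<close>, such
that weight times volume decays geometrically in \<open>k\<close>.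
\<close>

lemma nn_integral_le_geometric:
  fixes \<kappa> r :: "nat \<Rightarrow> real"
  assumes h[measurable]: "h \<in> borel_measurable M"
    and K: "\<And>r. 0 < r \<Longrightarrow> emeasure M {x \<in> space M. h x < r} \<le> ennreal (K * r ^ d)" "0 \<le> K"
    and pos: "\<And>k. 0 \<le> \<kappa> k" "\<And>k. 0 < r k" "0 \<le> D"
    and le: "\<And>k. \<kappa> k * r k ^ d \<le> D * (1 / 2) ^ k"
  shows "(\<integral>\<^sup>+x. (\<Sum>k. ennreal (\<kappa> k) * indicator {x \<in> space M. h x < r k} x) \<partial>M) \<le> ennreal (2 * K * D)"
proof -
  have "(\<integral>\<^sup>+x. (\<Sum>k. ennreal (\<kappa> k) * indicator {x \<in> space M. h x < r k} x) \<partial>M)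
      = (\<Sum>k. \<integral>\<^sup>+x. ennreal (\<kappa> k) * indicator {x \<in> space M. h x < r k} x \<partial>M)"
    by (rule nn_integral_suminf) measurable
  also have "\<dots> = (\<Sum>k. ennreal (\<kappa> k) * emeasure M {x \<in> space M. h x < r k})"
    by (simp add: nn_integral_cmult_indicator)
  also have "\<dots> \<le> (\<Sum>k. ennreal (K * D * (1 / 2) ^ k))"
  proof (rule suminf_le)
    fix k
    have "ennreal (\<kappa> k) * emeasure M {x \<in> space M. h x < r k} \<le> ennreal (\<kappa> k) * ennreal (K * r k ^ d)"
      by (intro mult_left_mono K pos) auto
    also have "\<dots> = ennreal (\<kappa> k * (K * r k ^ d))" by (rule ennreal_mult'[symmetric]) (rule pos)
    also have "\<kappa> k * (K * r k ^ d) \<le> K * D * (1 / 2) ^ k"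
      using mult_left_mono[OF le[of k] K(2)] by (simp add: ac_simps)
    finally show "ennreal (\<kappa> k) * emeasure M {x \<in> space M. h x < r k} \<le> ennreal (K * D * (1 / 2) ^ k)"
      by (simp add: ennreal_leI)
  qed auto
  also have "\<dots> = ennreal (\<Sum>k. K * D * (1 / 2) ^ k)"
    using K pos by (intro suminf_ennreal2) (auto intro!: summable_mult summable_geometric)
  also have "(\<Sum>k. K * D * (1 / 2) ^ k) = 2 * K * D"
    by (subst suminf_mult) (auto simp: suminf_geometric summable_geometric)
  finally show ?thesis .
qed

lemma two_power_quotient_le:
  assumes "m < n"
  shows "(2::real) ^ (k * m) / 2 ^ (k * n) \<le> (1 / 2) ^ k"
proof -
  have "k * m + k \<le> k * n" using assms by (metis Suc_leI add.commute mult_Suc_right mult_le_mono2)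
  then have "(2::real) ^ (k * m) * 2 ^ k \<le> 2 ^ (k * n)" by (simp add: power_add[symmetric])
  then show ?thesis by (simp add: field_simps)
qed

text \<open>
The \<open>k\<close>-th dyadic shell inside (outside) radius \<open>R\<close> is covered by a ball, on which the integrand is
replaced by its value at the inner radius of the shell.  The condition \<open>a < d\<close> makes the inner sum
geometric and \<open>d < a + b\<close> the outer one; the power of \<open>R\<close> is the one dictated by scaling.  Only upper
bounds for the volumes of balls enter, so that \<open>h\<close> can be any distance-like function.
\<close>

lemma nn_integral_power_decay:
  fixes h :: "'a \<Rightarrow> real"
  assumes h[measurable]: "h \<in> borel_measurable M" and h0: "\<And>x. x \<in> space M \<Longrightarrow> 0 \<le> h x"
    and K: "\<And>r. 0 < r \<Longrightarrow> emeasure M {x \<in> space M. h x < r} \<le> ennreal (K * r ^ d)" "0 \<le> K"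
    and ab: "a < d" "d < a + b" and R: "0 < R"
  shows "(\<integral>\<^sup>+x. ennreal (1 / (h x ^ a * (R + h x) ^ b)) \<partial>M)
    \<le> ennreal (2 * K * (2 ^ a + 2 ^ d) / R ^ (a + b - d))"
proof -
  define c where "c k = 2 ^ (Suc k * a) / R ^ (a + b)" for k
  define e where "e k = 1 / (R * 2 ^ k) ^ (a + b)" for k :: nat
  have pw: "R ^ d * R ^ (a + b - d) = R ^ (a + b)" using ab by (simp add: power_add[symmetric])
  have quot: "R ^ d / R ^ (a + b) = 1 / R ^ (a + b - d)"
    using R pw by (simp add: field_simps)
  have c_le: "c k * (R / 2 ^ k) ^ d \<le> (2 ^ a / R ^ (a + b - d)) * (1 / 2) ^ k" for k
  proof -
    have "c k * (R / 2 ^ k) ^ d = 2 ^ a * (R ^ d / R ^ (a + b)) * (2 ^ (k * a) / 2 ^ (k * d))"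
      by (simp add: c_def power_divide power_mult[symmetric] power_add[symmetric])
    also have "\<dots> \<le> 2 ^ a * (R ^ d / R ^ (a + b)) * (1 / 2) ^ k"
      using R ab by (intro mult_left_mono two_power_quotient_le) auto
    finally show ?thesis by (simp only: quot) simp
  qed
  have e_le: "e k * (R * 2 ^ Suc k) ^ d \<le> (2 ^ d / R ^ (a + b - d)) * (1 / 2) ^ k" for k
  proof -
    have "e k * (R * 2 ^ Suc k) ^ d = 2 ^ d * (R ^ d / R ^ (a + b)) * (2 ^ (k * d) / 2 ^ (k * (a + b)))"
      by (simp add: e_def power_mult_distrib power_mult[symmetric] power_add[symmetric] add_mult_distrib2 mult.commute)
    also have "\<dots> \<le> 2 ^ d * (R ^ d / R ^ (a + b)) * (1 / 2) ^ k"
      using R ab by (intro mult_left_mono two_power_quotient_le) auto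
    finally show ?thesis by (simp only: quot) simp
  qed
  let ?f = "\<lambda>x. (\<Sum>k. ennreal (c k) * indicator {x \<in> space M. h x < R / 2 ^ k} x)"
  let ?g = "\<lambda>x. (\<Sum>k. ennreal (e k) * indicator {x \<in> space M. h x < R * 2 ^ Suc k} x)"
  have "(\<integral>\<^sup>+x. ennreal (1 / (h x ^ a * (R + h x) ^ b)) \<partial>M) \<le> (\<integral>\<^sup>+x. ?f x + ?g x \<partial>M)"
  proof (rule nn_integral_mono)
    fix x assume x: "x \<in> space M"
    have term_le: "v \<le> (\<Sum>k. w k)" if "v \<le> w k" for v :: ennreal and w k
      using that sum_le_suminf[of w "{k}"] by (auto intro: order_trans)
    consider "h x < R" "0 < h x" | "h x = 0" | "R \<le> h x" using h0[OF x] by linarith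
    then show "ennreal (1 / (h x ^ a * (R + h x) ^ b)) \<le> ?f x + ?g x"
    proof cases
      case 1
      then obtain k where k: "R / 2 ^ Suc k \<le> h x" "h x < R / 2 ^ k" using dyadic_inside by blast
      have "(R / 2 ^ Suc k) ^ a * R ^ b \<le> h x ^ a * (R + h x) ^ b"
        using k R 1 by (intro mult_mono power_mono) auto
      then have "1 / (h x ^ a * (R + h x) ^ b) \<le> 1 / ((R / 2 ^ Suc k) ^ a * R ^ b)"
        using R 1 by (intro divide_left_mono mult_pos_pos zero_less_power) auto
      also have "\<dots> = c k" by (simp add: c_def power_divide power_add power_mult power_mult_distrib)
      finally have "ennreal (1 / (h x ^ a * (R + h x) ^ b)) \<le> ?f x"
        using k x by (intro term_le[where k=k]) (auto intro!: ennreal_leI)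
      then show ?thesis by (simp add: add_increasing2)
    next
      case 2
      \<comment> \<open>for \<open>a > 0\<close> the left-hand side is \<open>1 / 0 = 0\<close>\<close>
      have "1 / (h x ^ a * (R + h x) ^ b) \<le> c 0"
        using 2 R by (cases "a = 0") (auto simp: c_def power_0_left)
      then have "ennreal (1 / (h x ^ a * (R + h x) ^ b)) \<le> ?f x"
        using 2 R x by (intro term_le[where k=0]) (auto intro!: ennreal_leI)
      then show ?thesis by (simp add: add_increasing2)
    next
      case 3
      then obtain k where k: "R * 2 ^ k \<le> h x" "h x < R * 2 ^ Suc k" using R dyadic_outside by blast
      have "(R * 2 ^ k) ^ a * (R * 2 ^ k) ^ b \<le> h x ^ a * (R + h x) ^ b"
        using k R 3 by (intro mult_mono power_mono) auto
      then have "1 / (h x ^ a * (R + h x) ^ b) \<le> 1 / ((R * 2 ^ k) ^ a * (R * 2 ^ k) ^ b)"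
        using R 3 by (intro divide_left_mono mult_pos_pos zero_less_power) auto
      also have "\<dots> = e k" by (simp add: e_def power_add)
      finally have "ennreal (1 / (h x ^ a * (R + h x) ^ b)) \<le> ?g x"
        using k x by (intro term_le[where k=k]) (auto intro!: ennreal_leI)
      then show ?thesis by (simp add: add_increasing)
    qed
  qed
  also have "\<dots> = (\<integral>\<^sup>+x. ?f x \<partial>M) + (\<integral>\<^sup>+x. ?g x \<partial>M)"
    by (rule nn_integral_add) measurable
  also have "\<dots> \<le> ennreal (2 * K * (2 ^ a / R ^ (a + b - d))) + ennreal (2 * K * (2 ^ d / R ^ (a + b - d)))"
    using R by (intro add_mono nn_integral_le_geometric[OF h K _ _ _ c_le] nn_integral_le_geometric[OF h K _ _ _ e_le])
      (auto simp: c_def e_def)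
  also have "\<dots> = ennreal (2 * K * (2 ^ a / R ^ (a + b - d)) + 2 * K * (2 ^ d / R ^ (a + b - d)))"
    using K R by (subst ennreal_plus) auto
  also have "2 * K * (2 ^ a / R ^ (a + b - d)) + 2 * K * (2 ^ d / R ^ (a + b - d))
     = 2 * K * (2 ^ a + 2 ^ d) / R ^ (a + b - d)"
    by (simp add: distrib_left add_divide_distrib)
  finally show ?thesis .
qed

lemma borel_measurable_fst_comp [measurable (raw)]:
  "f \<in> borel_measurable M \<Longrightarrow> (\<lambda>x. fst (f x)) \<in> borel_measurable M"
  by (rule measurable_compose[of f M borel]) (auto intro!: borel_measurable_continuous_onI continuous_intros)

lemma borel_measurable_snd_comp [measurable (raw)]:
  "f \<in> borel_measurable M \<Longrightarrow> (\<lambda>x. snd (f x)) \<in> borel_measurable M"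
  by (rule measurable_compose[of f M borel]) (auto intro!: borel_measurable_continuous_onI continuous_intros)

section \<open>Parabolic convolution estimates\<close>

text \<open>
The parabolic norm.  It is subadditive, and its balls of radius \<open>r\<close> in space-time have volume of order
\<open>r\<^sup>5\<close>, because time scales like the square of space.
\<close>

definition pnorm :: "real \<Rightarrow> R3 \<Rightarrow> real"
  where "pnorm t x = sqrt t + norm x"

lemma emeasure_R3_ball_le:
  fixes x :: R3
  assumes "0 < r"
  shows "emeasure lborel {y. norm (x - y) < r} \<le> ennreal (8 * r ^ 3)"
proof -
  have sub: "{y. norm (x - y) < r} \<subseteq> cbox (\<chi> i. x $ i - r) (\<chi> i. x $ i + r)"
  proof
    fix y assume "y \<in> {y. norm (x - y) < r}"
    then have "norm (x - y) < r" by simp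
    then have "\<bar>x $ i - y $ i\<bar> < r" for i
      using component_le_norm_cart[of "x - y" i] by simp
    then show "y \<in> cbox (\<chi> i. x $ i - r) (\<chi> i. x $ i + r)"
      by (auto simp: mem_box_cart abs_less_iff) (smt (verit) abs_less_iff)+
  qed
  have "emeasure lborel {y. norm (x - y) < r} \<le> emeasure lborel (cbox (\<chi> i. x $ i - r) (\<chi> i. x $ i + r) :: R3 set)"
    using sub by (rule emeasure_mono) auto
  also have "\<dots> = ennreal (measure lborel (cbox (\<chi> i. x $ i - r) (\<chi> i. x $ i + r) :: R3 set))"
    by (rule emeasure_eq_ennreal_measure) (use emeasure_lborel_cbox_finite in \<open>auto simp: less_top\<close>)
  also have "measure lborel (cbox (\<chi> i. x $ i - r) (\<chi> i. x $ i + r) :: R3 set) = 8 * r ^ 3"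
    using assms by (subst content_cbox_cart) (auto simp: interval_ne_empty_cart power_mult_distrib)
  finally show ?thesis .
qed

text \<open>
The absolute value extends the norm to all of space-time, and the same bound then serves for balls
around \<open>(t, x)\<close> and around the origin.
\<close>

lemma emeasure_parabolic_ball_le:
  fixes x :: R3
  assumes "0 < r"
  shows "emeasure lborel {p. pnorm \<bar>t - fst p\<bar> (x - snd p) < r} \<le> ennreal (16 * r ^ 5)"
proof -
  have sub: "{p. pnorm \<bar>t - fst p\<bar> (x - snd p) < r} \<subseteq> {t - r\<^sup>2..t + r\<^sup>2} \<times> {y. norm (x - y) < r}"
  proof
    fix p :: "real \<times> R3" assume "p \<in> {p. pnorm \<bar>t - fst p\<bar> (x - snd p) < r}"
    then have p: "sqrt \<bar>t - fst p\<bar> + norm (x - snd p) < r" by (simp add: pnorm_def)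
    have "sqrt \<bar>t - fst p\<bar> < r" using p norm_ge_zero[of "x - snd p"] by linarith
    then have "(sqrt \<bar>t - fst p\<bar>)\<^sup>2 < r\<^sup>2" by (intro power_strict_mono) auto
    then have "\<bar>t - fst p\<bar> < r\<^sup>2" by simp
    moreover have "norm (x - snd p) < r" using p real_sqrt_ge_zero[of "\<bar>t - fst p\<bar>"] by linarith
    ultimately show "p \<in> {t - r\<^sup>2..t + r\<^sup>2} \<times> {y. norm (x - y) < r}"
      by (cases p) (auto simp: abs_less_iff)
  qed
  have m: "{y. norm (x - y) < r} \<in> sets lborel" by measurable
  have "emeasure lborel {p. pnorm \<bar>t - fst p\<bar> (x - snd p) < r}
     \<le> emeasure (lborel \<Otimes>\<^sub>M lborel) ({t - r\<^sup>2..t + r\<^sup>2} \<times> {y. norm (x - y) < r})"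
    unfolding lborel_prod using sub
    by (rule emeasure_mono) (metis (no_types) m atLeastAtMost_borel lborel_prod pair_measureI sets_lborel)
  also have "\<dots> = emeasure lborel {t - r\<^sup>2..t + r\<^sup>2} * emeasure lborel {y. norm (x - y) < r}"
    by (rule lborel.emeasure_pair_measure_Times) (use m in auto)
  also have "\<dots> \<le> ennreal (2 * r\<^sup>2) * ennreal (8 * r ^ 3)"
    using assms by (intro mult_mono emeasure_R3_ball_le) auto
  also have "\<dots> = ennreal (16 * r ^ 5)"
    by (subst ennreal_mult'[symmetric]) (auto simp: power_add[symmetric] eval_nat_numeral)
  finally show ?thesis .
qed


lemma pnorm_nonneg: "0 \<le> t \<Longrightarrow> 0 \<le> pnorm t x"
  by (simp add: pnorm_def)

lemma pnorm_pos: "0 < t \<Longrightarrow> 0 < pnorm t x"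
  by (simp add: pnorm_def add_pos_nonneg)

lemma pnorm_triangle: "0 \<le> s \<Longrightarrow> s \<le> t \<Longrightarrow> pnorm t x \<le> pnorm (t - s) (x - y) + pnorm s y"
  using sqrt_add_le_add_sqrt[of "t - s" s] norm_triangle_ineq[of "x - y" y]
  by (simp add: pnorm_def)

lemma measurable_pnorm [measurable (raw)]:
  assumes [measurable]: "f \<in> borel_measurable M" "g \<in> borel_measurable M"
  shows "(\<lambda>p. pnorm (f p) (g p)) \<in> borel_measurable M"
  unfolding pnorm_def by measurable

text \<open>
If \<open>q1 \<le> q2\<close>, then \<open>q2 \<ge> R / 2\<close> and \<open>q2 \<ge> q1\<close>, hence \<open>3 q2 \<ge> R + q1\<close>.  Thus the product is dominated by
functions of \<open>q1\<close> alone and of \<open>q2\<close> alone, each of which can be integrated by itself.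
\<close>

lemma inverse_powers_split:
  fixes q1 q2 R :: real
  assumes "0 \<le> q1" "0 \<le> q2" "0 < R" "R \<le> q1 + q2"
  shows "1 / (q1 ^ a * q2 ^ b) \<le> 3 ^ b / (q1 ^ a * (R + q1) ^ b) + 3 ^ a / (q2 ^ b * (R + q2) ^ a)"
proof -
  have *: "1 / (p ^ a * q ^ b) \<le> 3 ^ b / (p ^ a * (R + p) ^ b)"
    if "0 \<le> p" "p \<le> q" "R \<le> p + q" for p q :: real and a b
  proof -
    have "(R + p) ^ b \<le> (3 * q) ^ b" using that assms by (intro power_mono) auto
    moreover have "0 < (R + p) ^ b" "0 < q ^ b" using that assms by auto
    ultimately have "1 / q ^ b \<le> 3 ^ b / (R + p) ^ b"
      unfolding power_mult_distrib by (simp add: pos_le_divide_eq pos_divide_le_eq mult.commute)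
    from mult_left_mono[OF this, of "1 / p ^ a"] that show ?thesis by simp
  qed
  show ?thesis
  proof (cases "q1 \<le> q2")
    case True
    have "1 / (q1 ^ a * q2 ^ b) \<le> 3 ^ b / (q1 ^ a * (R + q1) ^ b)"
      using True assms by (intro *) auto
    also have "\<dots> \<le> \<dots> + 3 ^ a / (q2 ^ b * (R + q2) ^ a)" using assms by simp
    finally show ?thesis .
  next
    case False
    have "1 / (q1 ^ a * q2 ^ b) = 1 / (q2 ^ b * q1 ^ a)" by (simp add: mult.commute)
    also have "\<dots> \<le> 3 ^ a / (q2 ^ b * (R + q2) ^ a)"
      using False assms by (intro *) auto
    also have "\<dots> \<le> 3 ^ b / (q1 ^ a * (R + q1) ^ b) + \<dots>" using assms by simp
    finally show ?thesis .
  qed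
qed

text \<open>
By the triangle inequality the integrand is split as in \<open>inverse_powers_split\<close> with
\<open>R = pnorm t x\<close>, and both parts are integrated with \<open>nn_integral_power_decay\<close> in dimension 5.
\<close>

lemma parabolic_convolution:
  assumes ab: "a < 5" "b < 5" "5 < a + b"
  shows "\<exists>C>0. \<forall>t>0. \<forall>x. (\<integral>\<^sup>+s. \<integral>\<^sup>+y. indicator {0<..<t} s *
      ennreal (1 / (pnorm (t - s) (x - y) ^ a * pnorm s y ^ b)) \<partial>lborel \<partial>lborel)
    \<le> ennreal (C / pnorm t x ^ (a + b - 5))"
proof -
  define C :: "nat \<Rightarrow> nat \<Rightarrow> real" where "C a b = 3 ^ b * (2 * 16 * (2 ^ a + 2 ^ 5))" for a b
  have Cpos: "0 < C a b" for a b by (simp add: C_def add_pos_pos)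
  show ?thesis
  proof (intro exI[of _ "C a b + C b a"] conjI allI impI)
    show "0 < C a b + C b a" by (intro add_pos_pos Cpos)
    fix t :: real and x :: R3 assume t: "0 < t"
    define R where "R = pnorm t x"
    have R: "0 < R" using t by (simp add: R_def pnorm_pos)
    define h1 h2 :: "real \<times> R3 \<Rightarrow> real"
      where "h1 p = pnorm \<bar>t - fst p\<bar> (x - snd p)" and "h2 p = pnorm \<bar>0 - fst p\<bar> (0 - snd p)" for p
    have [measurable]: "h1 \<in> borel_measurable borel" "h2 \<in> borel_measurable borel"
      unfolding h1_def[abs_def] h2_def[abs_def] by measurable
    have nn: "0 \<le> h1 p" "0 \<le> h2 p" for p by (auto simp: h1_def h2_def pnorm_nonneg)
    have decay: "(\<integral>\<^sup>+p. ennreal (3 ^ b * (1 / (h p ^ a * (R + h p) ^ b))) \<partial>lborel)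
       \<le> ennreal (C a b / R ^ (a + b - 5))"
      if [measurable]: "h \<in> borel_measurable borel" and "\<And>p. 0 \<le> h p"
        and "\<And>r. 0 < r \<Longrightarrow> emeasure lborel {p. h p < r} \<le> ennreal (16 * r ^ 5)"
        and "a < 5" "5 < a + b" for h :: "real \<times> R3 \<Rightarrow> real" and a b
    proof -
      have "(\<integral>\<^sup>+p. ennreal (3 ^ b * (1 / (h p ^ a * (R + h p) ^ b))) \<partial>lborel)
         = ennreal (3 ^ b) * (\<integral>\<^sup>+p. ennreal (1 / (h p ^ a * (R + h p) ^ b)) \<partial>lborel)"
        using R that by (subst nn_integral_cmult[symmetric]) (auto simp: ennreal_mult'[symmetric])
      also have "\<dots> \<le> ennreal (3 ^ b) * ennreal (2 * 16 * (2 ^ a + 2 ^ 5) / R ^ (a + b - 5))"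
        using that R by (intro mult_left_mono nn_integral_power_decay) auto
      also have "\<dots> = ennreal (C a b / R ^ (a + b - 5))"
        by (subst ennreal_mult'[symmetric]) (auto simp: C_def)
      finally show ?thesis .
    qed
    let ?F = "\<lambda>p. ennreal (3 ^ b * (1 / (h1 p ^ a * (R + h1 p) ^ b)))"
    let ?G = "\<lambda>p. ennreal (3 ^ a * (1 / (h2 p ^ b * (R + h2 p) ^ a)))"
    have le: "indicator {0<..<t} s * ennreal (1 / (pnorm (t - s) (x - y) ^ a * pnorm s y ^ b))
        \<le> ?F (s, y) + ?G (s, y)" for s y
    proof (cases "s \<in> {0<..<t}")
      case True
      have "R \<le> h1 (s, y) + h2 (s, y)"
        using True pnorm_triangle[of s t x y] by (auto simp: R_def h1_def h2_def pnorm_def)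
      from inverse_powers_split[OF nn R this, of a b]
      have "ennreal (1 / (h1 (s, y) ^ a * h2 (s, y) ^ b))
         \<le> ennreal (3 ^ b * (1 / (h1 (s, y) ^ a * (R + h1 (s, y)) ^ b))
             + 3 ^ a * (1 / (h2 (s, y) ^ b * (R + h2 (s, y)) ^ a)))"
        by (intro ennreal_leI) simp
      also have "\<dots> = ?F (s, y) + ?G (s, y)"
        using nn R by (intro ennreal_plus) auto
      finally show ?thesis using True by (simp add: h1_def h2_def pnorm_def)
    qed auto
    have "(\<integral>\<^sup>+s. \<integral>\<^sup>+y. indicator {0<..<t} s *
      ennreal (1 / (pnorm (t - s) (x - y) ^ a * pnorm s y ^ b)) \<partial>lborel \<partial>lborel)
      \<le> (\<integral>\<^sup>+s. \<integral>\<^sup>+y. ?F (s, y) + ?G (s, y) \<partial>lborel \<partial>lborel)"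
      by (intro nn_integral_mono le)
    also have "\<dots> = (\<integral>\<^sup>+p. ?F p + ?G p \<partial>lborel)"
      unfolding lborel_prod[symmetric]
      by (rule lborel.nn_integral_fst) (simp add: lborel_prod)
    also have "\<dots> = (\<integral>\<^sup>+p. ?F p \<partial>lborel) + (\<integral>\<^sup>+p. ?G p \<partial>lborel)"
      by (rule nn_integral_add) measurable
    also have "\<dots> \<le> ennreal (C a b / R ^ (a + b - 5)) + ennreal (C b a / R ^ (b + a - 5))"
      using ab emeasure_parabolic_ball_le[of _ t x] emeasure_parabolic_ball_le[of _ 0 0]
      by (intro add_mono decay) (auto simp: h1_def h2_def pnorm_nonneg)
    also have "\<dots> = ennreal ((C a b + C b a) / R ^ (a + b - 5))"
      using R Cpos[of a b] Cpos[of b a]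
      by (subst ennreal_plus[symmetric]) (auto simp: add_divide_distrib add.commute)
    finally show "(\<integral>\<^sup>+s. \<integral>\<^sup>+y. indicator {0<..<t} s *
      ennreal (1 / (pnorm (t - s) (x - y) ^ a * pnorm s y ^ b)) \<partial>lborel \<partial>lborel)
      \<le> ennreal ((C a b + C b a) / pnorm t x ^ (a + b - 5))" by (simp add: R_def)
  qed
qed

lemma nn_integral_spatial_decay:
  fixes x :: R3
  assumes "a < 3" "3 < a + b" "0 < R"
  shows "(\<integral>\<^sup>+y. ennreal (1 / (norm (x - y) ^ a * (R + norm (x - y)) ^ b)) \<partial>lborel)
    \<le> ennreal (16 * (2 ^ a + 8) / R ^ (a + b - 3))"
  using nn_integral_power_decay[of "\<lambda>y. norm (x - y)" lborel 8 3 a b R] assms emeasure_R3_ball_le[of _ x]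
  by simp

text \<open>
The analogue in space for \<open>1 / |y|\<close>, with \<open>\<surd>t \<rho>\<^sup>-\<^sup>4\<close> as a majorant of the heat kernel that has bounded
integral over space.
\<close>

lemma spatial_convolution:
  "\<exists>C>0. \<forall>t>0. \<forall>x :: R3. (\<integral>\<^sup>+y. ennreal (sqrt t / (pnorm t (x - y) ^ 4 * norm y)) \<partial>lborel)
    \<le> ennreal (C / pnorm t x)"
proof (rule exI[of _ "27 * 16 * 81"], intro conjI allI impI)
  fix t :: real and x :: R3 assume t: "0 < t"
  define R where "R = pnorm t x"
  have R: "0 < R" "sqrt t \<le> R" using t pnorm_pos[of t x] by (simp_all add: R_def) (simp add: pnorm_def)
  let ?F = "\<lambda>y. ennreal (3 * sqrt t / R * (1 / (norm (x - y) ^ 0 * (sqrt t + norm (x - y)) ^ 4)))"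
  let ?G = "\<lambda>y::R3. ennreal (81 * sqrt t * (1 / (norm (0 - y) ^ 1 * (R + norm (0 - y)) ^ 4)))"
  have le: "ennreal (sqrt t / (pnorm t (x - y) ^ 4 * norm y)) \<le> ?F y + ?G y" for y
  proof -
    have pos: "0 < pnorm t (x - y)" using t by (rule pnorm_pos)
    have "R \<le> pnorm t (x - y) + norm y"
      using norm_triangle_ineq[of "x - y" y] by (simp add: R_def pnorm_def)
    from inverse_powers_split[OF _ _ R(1) this, of 4 1] pos
    have "1 / (pnorm t (x - y) ^ 4 * norm y)
      \<le> 3 / (pnorm t (x - y) ^ 4 * (R + pnorm t (x - y))) + 81 / (norm y * (R + norm y) ^ 4)"
      by simp
    also have "3 / (pnorm t (x - y) ^ 4 * (R + pnorm t (x - y))) \<le> 3 / (pnorm t (x - y) ^ 4 * R)"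
      using pos R by (intro divide_left_mono mult_left_mono mult_pos_pos zero_less_power add_pos_pos) auto
    finally have "sqrt t * (1 / (pnorm t (x - y) ^ 4 * norm y))
      \<le> sqrt t * (3 / (pnorm t (x - y) ^ 4 * R) + 81 / (norm y * (R + norm y) ^ 4))"
      using t by (intro mult_left_mono) auto
    then have "ennreal (sqrt t / (pnorm t (x - y) ^ 4 * norm y))
      \<le> ennreal (3 * sqrt t / R * (1 / (norm (x - y) ^ 0 * (sqrt t + norm (x - y)) ^ 4))
          + 81 * sqrt t * (1 / (norm (0 - y) ^ 1 * (R + norm (0 - y)) ^ 4)))"
      by (intro ennreal_leI) (simp add: pnorm_def algebra_simps)
    also have "\<dots> = ?F y + ?G y" using R t by (intro ennreal_plus) auto
    finally show ?thesis .
  qed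
  have "(\<integral>\<^sup>+y. ennreal (sqrt t / (pnorm t (x - y) ^ 4 * norm y)) \<partial>lborel) \<le> (\<integral>\<^sup>+y. ?F y + ?G y \<partial>lborel)"
    by (intro nn_integral_mono le)
  also have "\<dots> = (\<integral>\<^sup>+y. ?F y \<partial>lborel) + (\<integral>\<^sup>+y. ?G y \<partial>lborel)"
    by (rule nn_integral_add) measurable
  also have "\<dots> = ennreal (3 * sqrt t / R) * (\<integral>\<^sup>+y. ennreal (1 / (norm (x - y) ^ 0 * (sqrt t + norm (x - y)) ^ 4)) \<partial>lborel)
    + ennreal (81 * sqrt t) * (\<integral>\<^sup>+y. ennreal (1 / (norm (0 - y :: R3) ^ 1 * (R + norm (0 - y)) ^ 4)) \<partial>lborel)"
    using R t
    by (intro arg_cong2[where f="(+)"]; subst nn_integral_cmult[symmetric])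
       (auto simp: ennreal_mult'[symmetric])
  also have "\<dots> \<le> ennreal (3 * sqrt t / R) * ennreal (16 * (2 ^ 0 + 8) / sqrt t ^ (0 + 4 - 3))
    + ennreal (81 * sqrt t) * ennreal (16 * (2 ^ 1 + 8) / R ^ (1 + 4 - 3))"
    using R t by (intro add_mono mult_left_mono nn_integral_spatial_decay) auto
  also have "\<dots> = ennreal (3 * sqrt t / R * (16 * 9 / sqrt t) + 81 * sqrt t * (16 * 10 / R\<^sup>2))"
    using R t by (simp add: ennreal_mult'[symmetric] ennreal_plus[symmetric] del: ennreal_plus)
  also have "\<dots> \<le> ennreal (27 * 16 * 81 / R)"
  proof (rule ennreal_leI)
    have "sqrt t / R\<^sup>2 \<le> 1 / R" using R by (simp add: field_simps power2_eq_square)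
    moreover have "3 * sqrt t / R * (16 * 9 / sqrt t) = 432 * (1 / R)" using t by (simp add: field_simps)
    ultimately have "3 * sqrt t / R * (16 * 9 / sqrt t) + 81 * sqrt t * (16 * 10 / R\<^sup>2) \<le> 432 * (1 / R) + 12960 * (1 / R)"
      by (simp add: mult.assoc) 
    also have "\<dots> \<le> 27 * 16 * 81 * (1 / R)" using R by (simp add: field_simps)
    finally show "3 * sqrt t / R * (16 * 9 / sqrt t) + 81 * sqrt t * (16 * 10 / R\<^sup>2) \<le> 27 * 16 * 81 / R" by simp
  qed
  finally show "(\<integral>\<^sup>+y. ennreal (sqrt t / (pnorm t (x - y) ^ 4 * norm y)) \<partial>lborel)
    \<le> ennreal (27 * 16 * 81 / pnorm t x)" by (simp add: R_def)
qed auto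

section \<open>Derivatives of the heat kernel\<close>

text \<open>
Linear combinations of \<open>t\<^sup>-\<^sup>m z\<^sup>\<alpha> G\<^sub>t(z)\<close>, graded by the degree of homogeneity under
\<open>(t, z) \<mapsto> (\<lambda>\<^sup>2 t, \<lambda> z)\<close>; the heat kernel itself has degree \<open>-3\<close>.  All space and time derivatives of
the heat kernel belong to this class.  The rule \<open>cong\<close> identifies functions that agree at positive
times; at times \<open>t \<le> 0\<close> the formulas for the derivatives need not hold.
\<close>

inductive heat_class :: "int \<Rightarrow> (real \<Rightarrow> R3 \<Rightarrow> real) \<Rightarrow> bool" where
  kernel: "heat_class (-3) heat_kernel"
| coord: "heat_class k f \<Longrightarrow> heat_class (k + 1) (\<lambda>t z. z $ i * f t z)"
| time: "heat_class k f \<Longrightarrow> heat_class (k - 2) (\<lambda>t z. f t z / t)"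
| add: "heat_class k f \<Longrightarrow> heat_class k g \<Longrightarrow> heat_class k (\<lambda>t z. f t z + g t z)"
| scale: "heat_class k f \<Longrightarrow> heat_class k (\<lambda>t z. c * f t z)"
| cong: "heat_class k f \<Longrightarrow> (\<And>t z. 0 < t \<Longrightarrow> g t z = f t z) \<Longrightarrow> heat_class k g"

lemma borel_measurable_vec_nth_comp [measurable (raw)]:
  fixes f :: "'a \<Rightarrow> 'b::topological_space ^ 'n"
  shows "f \<in> borel_measurable M \<Longrightarrow> (\<lambda>x. f x $ i) \<in> borel_measurable M"
  by (rule measurable_compose[of f M borel]) (auto intro!: borel_measurable_continuous_onI continuous_intros)

lemma measurable_heat_kernel [measurable (raw)]:
  assumes [measurable]: "f \<in> borel_measurable M" "g \<in> borel_measurable M"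
  shows "(\<lambda>x. heat_kernel (f x) (g x)) \<in> borel_measurable M"
  unfolding heat_kernel_def by measurable

lemma heat_class_measurable:
  "heat_class k f \<Longrightarrow> (\<lambda>p. indicator {0<..} (fst p) * f (fst p) (snd p)) \<in> borel_measurable borel"
proof (induction rule: heat_class.induct)
  case (coord k f i)
  note coord.IH[measurable]
  have "(\<lambda>p. snd p $ i * (indicator {0<..} (fst p) * f (fst p) (snd p))) \<in> borel_measurable borel"
    by measurable
  then show ?case by (simp add: ac_simps)
next
  case (time k f)
  note time.IH[measurable]
  have "(\<lambda>p. (indicator {0<..} (fst p) * f (fst p) (snd p)) / fst p) \<in> borel_measurable borel"
    by measurable
  then show ?case by simp
next
  case (add k f g)
  note add.IH[measurable]
  have "(\<lambda>p. (indicator {0<..} (fst p) * f (fst p) (snd p)) + (indicator {0<..} (fst p) * g (fst p) (snd p))) \<in> borel_measurable borel"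
    by measurable
  then show ?case by (simp add: distrib_left)
next
  case (scale k f c)
  note scale.IH[measurable]
  have "(\<lambda>p. c * (indicator {0<..} (fst p) * f (fst p) (snd p))) \<in> borel_measurable borel"
    by measurable
  then show ?case by (simp add: ac_simps)
next
  case (cong k f g)
  moreover have "(\<lambda>p::real\<times>R3. indicator {0<..} (fst p) * f (fst p) (snd p)) = (\<lambda>p. indicator {0<..} (fst p) * g (fst p) (snd p))"
    using cong.hyps by (auto simp: fun_eq_iff indicator_def)
  ultimately show ?case by simp
qed measurable

text \<open>
From \<open>((1 + r) / m)\<^sup>m \<le> exp (1 + r)\<close> and \<open>1 + r - r\<^sup>2 / 4 \<le> 2\<close>.
\<close>

lemma power_times_exp_quadratic_le:
  fixes r :: real
  assumes "0 \<le> r"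
  shows "(1 + r) ^ m * exp (- (r\<^sup>2 / 4)) \<le> real m ^ m * exp 2"
proof (cases "m = 0")
  case True
  have "- (r\<^sup>2 / 4) \<le> 2" using zero_le_power2[of r] by linarith
  then have "exp (- (r\<^sup>2 / 4)) \<le> exp 2" by simp
  then show ?thesis using True by simp
next
  case False
  have "((1 + r) / m) ^ m \<le> (1 + (1 + r) / m) ^ m"
    using assms by (intro power_mono) auto
  also have "\<dots> \<le> exp (1 + r)"
    using False assms by (intro exp_ge_one_plus_x_over_n_power_n) auto
  finally have "(1 + r) ^ m \<le> real m ^ m * exp (1 + r)"
    using False by (simp add: power_divide field_simps)
  then have "(1 + r) ^ m * exp (- (r\<^sup>2 / 4)) \<le> real m ^ m * exp (1 + r) * exp (- (r\<^sup>2 / 4))"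
    by (rule mult_right_mono) simp
  also have "\<dots> = real m ^ m * exp (1 + r - r\<^sup>2 / 4)" by (simp add: mult_exp_exp mult.assoc)
  also have "\<dots> \<le> real m ^ m * exp 2"
  proof -
    have "0 \<le> (r / 2 - 1)\<^sup>2" by simp
    then have "1 + r - r\<^sup>2 / 4 \<le> 2" by (simp add: power2_eq_square algebra_simps)
    then show ?thesis by (intro mult_left_mono) auto
  qed
  finally show ?thesis .
qed

lemma powr_three_halves: "0 < t \<Longrightarrow> t powr (- 3 / 2) = sqrt t powi (-3)"
proof -
  assume t: "0 < t"
  have "t powr (3 / 2) = (t powr (1 / 2)) powr 3" unfolding powr_powr by simp
  also have "\<dots> = sqrt t ^ 3" using t by (simp only: powr_half_sqrt) (simp add: powr_numeral)
  finally have "t powr (- (3 / 2)) = inverse (sqrt t ^ 3)" by (simp only: powr_minus)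
  then show ?thesis by (simp add: power_int_minus)
qed

text \<open>
Proved for all \<open>m\<close> at once: since \<open>|z\<^sub>i| \<le> \<rho>\<close>, a factor \<open>z\<^sub>i\<close> is absorbed by using the induction
hypothesis for \<open>m + 1\<close>.
\<close>

lemma heat_class_decay:
  "heat_class k f \<Longrightarrow> \<exists>C\<ge>0. \<forall>t>0. \<forall>z. \<bar>f t z\<bar> * pnorm t z ^ m \<le> C * sqrt t powi (k + int m)"
proof (induction arbitrary: m rule: heat_class.induct)
  case kernel
  define C where "C = (4 * pi) powr (- 3 / 2) * (real m ^ m * exp 2)"
  show ?case
  proof (intro exI[of _ C] conjI allI impI)
    show "0 \<le> C" by (simp add: C_def)
    fix t :: real and z :: R3 assume t: "0 < t"
    \<comment> \<open>the quotient is scale invariant: \<open>\<rho> = \<surd>t (1 + r)\<close> and \<open>|z|\<^sup>2 / (4 t) = r\<^sup>2 / 4\<close>\<close>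
    define r where "r = norm z / sqrt t"
    have r: "0 \<le> r" using t by (simp add: r_def)
    have rho: "pnorm t z = sqrt t * (1 + r)" using t by (simp add: pnorm_def r_def field_simps)
    have "(norm z)\<^sup>2 / (4 * t) = r\<^sup>2 / 4" using t by (simp add: r_def power_divide)
    then have "- (norm z)\<^sup>2 / (4 * t) = - (r\<^sup>2 / 4)" by simp
    then have hk: "heat_kernel t z = (4 * pi) powr (- 3 / 2) * sqrt t powi (-3) * exp (- (r\<^sup>2 / 4))"
      using t unfolding heat_kernel_def by (simp only: powr_mult powr_three_halves)
    have "\<bar>heat_kernel t z\<bar> * pnorm t z ^ m
      = (4 * pi) powr (- 3 / 2) * ((1 + r) ^ m * exp (- (r\<^sup>2 / 4))) * (sqrt t powi (-3) * sqrt t powi int m)"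
      using t by (simp add: hk rho abs_mult power_mult_distrib)
    also have "\<dots> \<le> (4 * pi) powr (- 3 / 2) * (real m ^ m * exp 2) * (sqrt t powi (-3) * sqrt t powi int m)"
      using t r by (intro mult_right_mono mult_left_mono power_times_exp_quadratic_le) auto
    also have "sqrt t powi (-3) * sqrt t powi int m = sqrt t powi (-3 + int m)"
      using t by (intro power_int_add[symmetric]) auto
    finally show "\<bar>heat_kernel t z\<bar> * pnorm t z ^ m \<le> C * sqrt t powi (-3 + int m)"
      by (simp add: C_def)
  qed
next
  case (coord k f i)
  obtain C where C: "0 \<le> C" "\<And>t z. 0 < t \<Longrightarrow> \<bar>f t z\<bar> * pnorm t z ^ Suc m \<le> C * sqrt t powi (k + int (Suc m))"
    using coord.IH[of "Suc m"] by auto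
  show ?case
  proof (intro exI[of _ C] conjI allI impI C(1))
    fix t :: real and z :: R3 assume t: "0 < t"
    have zi: "\<bar>z $ i\<bar> \<le> pnorm t z"
      using component_le_norm_cart[of z i] t real_sqrt_ge_zero[of t] unfolding pnorm_def by linarith
    have "\<bar>z $ i * f t z\<bar> * pnorm t z ^ m \<le> pnorm t z * \<bar>f t z\<bar> * pnorm t z ^ m"
      using zi t by (auto simp: abs_mult pnorm_nonneg intro!: mult_right_mono)
    also have "\<dots> \<le> C * sqrt t powi (k + int (Suc m))" using C(2)[OF t, of z] by (simp add: ac_simps)
    finally show "\<bar>z $ i * f t z\<bar> * pnorm t z ^ m \<le> C * sqrt t powi (k + 1 + int m)" by (simp add: ac_simps)
  qed
next
  case (time k f)
  obtain C where C: "0 \<le> C" "\<And>t z. 0 < t \<Longrightarrow> \<bar>f t z\<bar> * pnorm t z ^ m \<le> C * sqrt t powi (k + int m)"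
    using time.IH[of m] by auto
  show ?case
  proof (intro exI[of _ C] conjI allI impI C(1))
    fix t :: real and z :: R3 assume t: "0 < t"
    have "sqrt t powi (k - 2 + int m) = sqrt t powi (k + int m + - 2)" by (simp add: algebra_simps)
    also have "\<dots> = sqrt t powi (k + int m) / t"
      using t by (subst power_int_add) (auto simp: power_int_minus divide_inverse)
    finally show "\<bar>f t z / t\<bar> * pnorm t z ^ m \<le> C * sqrt t powi (k - 2 + int m)"
      using C(2)[OF t, of z] t by (simp add: divide_right_mono)
  qed
next
  case (add k f g)
  obtain C where C: "0 \<le> C" "\<And>t z. 0 < t \<Longrightarrow> \<bar>f t z\<bar> * pnorm t z ^ m \<le> C * sqrt t powi (k + int m)"
    using add.IH(1)[of m] by auto
  obtain D where D: "0 \<le> D" "\<And>t z. 0 < t \<Longrightarrow> \<bar>g t z\<bar> * pnorm t z ^ m \<le> D * sqrt t powi (k + int m)"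
    using add.IH(2)[of m] by auto
  show ?case
  proof (intro exI[of _ "C + D"] conjI allI impI)
    show "0 \<le> C + D" using C(1) D(1) by simp
    fix t :: real and z :: R3 assume t: "0 < t"
    have "\<bar>f t z + g t z\<bar> * pnorm t z ^ m \<le> (\<bar>f t z\<bar> + \<bar>g t z\<bar>) * pnorm t z ^ m"
      using t by (intro mult_right_mono abs_triangle_ineq) (simp add: pnorm_nonneg)
    then show "\<bar>f t z + g t z\<bar> * pnorm t z ^ m \<le> (C + D) * sqrt t powi (k + int m)"
      using C(2)[OF t, of z] D(2)[OF t, of z] by (simp add: distrib_right)
  qed
next
  case (scale k f c)
  obtain C where C: "0 \<le> C" "\<And>t z. 0 < t \<Longrightarrow> \<bar>f t z\<bar> * pnorm t z ^ m \<le> C * sqrt t powi (k + int m)"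
    using scale.IH[of m] by auto
  show ?case
    using C by (intro exI[of _ "\<bar>c\<bar> * C"]) (auto simp: abs_mult mult.assoc intro!: mult_left_mono)
next
  case (cong k f g)
  then show ?case by simp
qed

lemma partial_eq: "(f has_derivative D) (at x) \<Longrightarrow> partial i f x = D (axis i 1)"
  unfolding partial_def using frechet_derivative_at by metis

lemma has_derivative_partial:
  assumes "f differentiable (at x)"
  shows "(f has_derivative (\<lambda>v. \<Sum>i\<in>UNIV. v $ i * partial i f x)) (at x)"
proof -
  obtain D where D: "(f has_derivative D) (at x)" using assms by (auto simp: differentiable_def)
  interpret D: linear D using D by (rule has_derivative_linear)
  have "D v = (\<Sum>i\<in>UNIV. v $ i * partial i f x)" for v
  proof -
    have "v = (\<Sum>i\<in>UNIV. v $ i *\<^sub>R axis i 1)"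
      using basis_expansion[of v] by (simp add: scalar_mult_eq_scaleR)
    then have "D v = D (\<Sum>i\<in>UNIV. v $ i *\<^sub>R axis i 1)" by simp
    also have "\<dots> = (\<Sum>i\<in>UNIV. v $ i * D (axis i 1))" by (simp add: D.sum D.scale)
    finally show ?thesis using partial_eq[OF D] by simp
  qed
  then have "D = (\<lambda>v. \<Sum>i\<in>UNIV. v $ i * partial i f x)" by auto
  then show ?thesis using D by simp
qed

text \<open>
Evaluates a derivative of the form \<open>v \<mapsto> \<Sum>\<^sub>i v\<^sub>i g\<^sub>i\<close> in a coordinate direction.
\<close>

lemma partial_sum_axis: "(\<Sum>i\<in>UNIV. axis j (1::real) $ i * g i) = (g j :: real)"
  by (simp add: axis_def if_distrib[of "\<lambda>x. x * _"] cong: if_cong)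

text \<open>
\<open>g i\<close> are the partial derivatives in space and \<open>h\<close> is the derivative in time, at positive times.
\<close>

definition heat_class_derivatives where
  "heat_class_derivatives k f g h \<longleftrightarrow> (\<forall>i. heat_class (k - 1) (g i)) \<and> heat_class (k - 2) h \<and>
     (\<forall>t>0. \<forall>z. (f t has_derivative (\<lambda>v. \<Sum>i\<in>UNIV. v $ i * g i t z)) (at z) \<and>
        ((\<lambda>s. f s z) has_real_derivative h t z) (at t))"

lemma heat_class_derivativesD:
  assumes "heat_class_derivatives k f g h"
  shows "heat_class (k - 1) (g i)" "heat_class (k - 2) h"
    "0 < t \<Longrightarrow> (f t has_derivative (\<lambda>v. \<Sum>i\<in>UNIV. v $ i * g i t z)) (at z)"
    "0 < t \<Longrightarrow> ((\<lambda>s. f s z) has_real_derivative h t z) (at t)"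
  using assms by (auto simp: heat_class_derivatives_def)

text \<open>
The product rule, applied along the generation of the class.  A space derivative lowers the degree by
one and a time derivative by two.
\<close>

lemma heat_class_derivatives_ex: "heat_class k f \<Longrightarrow> \<exists>g h. heat_class_derivatives k f g h"
proof (induction rule: heat_class.induct)
  case kernel
  let ?G = heat_kernel
  let ?g = "\<lambda>i t z. (- 1 / 2) * (z $ i * ?G t z / t)"
  let ?h = "\<lambda>t z. (- 3 / 2) * (?G t z / t) +
     (1 / 4) * ((z $ 1 * (z $ 1 * ?G t z / t / t) + z $ 2 * (z $ 2 * ?G t z / t / t)) + z $ 3 * (z $ 3 * ?G t z / t / t))"
  have g: "heat_class (-3 - 1) (?g i)" for i
    using heat_class.scale[OF heat_class.time[OF heat_class.coord[OF heat_class.kernel]], of "- 1 / 2" i] by simp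
  have q: "heat_class (-3 - 2) (\<lambda>t z. z $ i * (z $ i * ?G t z / t / t))" for i
    using heat_class.coord[OF heat_class.time[OF heat_class.time[OF heat_class.coord[OF heat_class.kernel, of i]]], of i]
    by simp
  have h: "heat_class (-3 - 2) ?h"
    by (intro heat_class.add heat_class.scale q heat_class.time heat_class.kernel)
  show ?case
  unfolding heat_class_derivatives_def
  proof (intro exI[of _ ?g] exI[of _ ?h] conjI allI impI g h)
    fix t :: real and z :: R3 assume t: "0 < t"
    have s3: "(\<Sum>i\<in>UNIV. v $ i * (- 1 / 2 * (z $ i * ?G t z / t))) = - (z \<bullet> v) / (2 * t) * ?G t z" for v :: R3
      by (simp add: inner_vec_def sum_distrib_left sum_distrib_right sum_divide_distrib sum_negf[symmetric] mult_ac)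
    have "((\<lambda>z. (4 * pi * t) powr (- 3 / 2) * exp (- (z \<bullet> z) / (4 * t))) has_derivative
       (\<lambda>v. (4 * pi * t) powr (- 3 / 2) * (exp (- (z \<bullet> z) / (4 * t)) * (- (2 * (z \<bullet> v)) / (4 * t))))) (at z)"
      using t by (auto intro!: derivative_eq_intros simp: inner_commute fun_eq_iff)
    then show "(?G t has_derivative (\<lambda>v. \<Sum>i\<in>UNIV. v $ i * (- 1 / 2 * (z $ i * ?G t z / t)))) (at z)"
      unfolding s3 unfolding heat_kernel_def[abs_def] power2_norm_eq_inner by (simp add: field_simps)
    define P E where "P = (4 * pi * t) powr (- 3 / 2)" and "E = exp (- (norm z)\<^sup>2 / (4 * t))"
    have "((\<lambda>s. (4 * pi * s) powr (- 3 / 2) * exp (- (norm z)\<^sup>2 / (4 * s))) has_real_derivative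
      (- 3 / 2) * (4 * pi) * (4 * pi * t) powr (- 3 / 2 - 1) * E + P * (E * ((norm z)\<^sup>2 / (4 * t\<^sup>2)))) (at t)"
      using t unfolding P_def E_def by (auto intro!: derivative_eq_intros simp: power2_eq_square field_simps)
    moreover have "(4 * pi * t) powr (- 3 / 2 - 1) = P / (4 * pi * t)"
      unfolding P_def by (simp only: powr_diff) (use t in simp)
    moreover have "(norm z)\<^sup>2 = z $ 1 * z $ 1 + z $ 2 * z $ 2 + z $ 3 * z $ 3"
      by (simp add: power2_norm_eq_inner inner_vec_def sum_3)
    moreover have "(- 3 / 2) * (4 * pi) * (P / (4 * pi * t)) * E
        + P * (E * ((z $ 1 * z $ 1 + z $ 2 * z $ 2 + z $ 3 * z $ 3) / (4 * t\<^sup>2))) = ?h t z"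
      using t unfolding heat_kernel_def[of t z] P_def[symmetric] E_def[symmetric]
      by (simp add: power2_eq_square field_simps)
    ultimately show "((\<lambda>s. ?G s z) has_real_derivative ?h t z) (at t)"
      unfolding heat_kernel_def[abs_def] by (simp only:)
  qed
next
  case (coord k f j)
  obtain g h where "heat_class_derivatives k f g h"
    using coord.IH by blast
  note gh = heat_class_derivativesD[OF this]
  let ?g = "\<lambda>i t z. z $ j * g i t z + (if i = j then 1 else 0) * f t z"
  let ?h = "\<lambda>t z. z $ j * h t z"
  have g: "heat_class (k + 1 - 1) (?g i)" for i
    using heat_class.coord[OF gh(1)[of i], of j] coord.hyps by (intro heat_class.add heat_class.scale) auto
  have h: "heat_class (k + 1 - 2) ?h" using heat_class.coord[OF gh(2), of j] by simp
  show ?case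
  unfolding heat_class_derivatives_def
  proof (intro exI[of _ ?g] exI[of _ ?h] conjI allI impI g h)
    fix t :: real and z :: R3 assume t: "0 < t"
    have "((\<lambda>z. z $ j * f t z) has_derivative (\<lambda>v. z $ j * (\<Sum>i\<in>UNIV. v $ i * g i t z) + v $ j * f t z)) (at z)"
      by (intro has_derivative_mult gh t bounded_linear_imp_has_derivative bounded_linear_vec_nth)
    moreover have "(\<Sum>i\<in>UNIV. v $ i * ((if i = j then 1 else 0) * f t z)) = v $ j * f t z" for v :: R3
      by (simp add: if_distrib[of "\<lambda>x. x * _"] if_distrib[of "\<lambda>x. _ * x"] cong: if_cong)
    ultimately show "((\<lambda>z. z $ j * f t z) has_derivative (\<lambda>v. \<Sum>i\<in>UNIV. v $ i * ?g i t z)) (at z)"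
      by (simp add: distrib_left sum.distrib sum_distrib_left mult_ac)
    show "((\<lambda>s. z $ j * f s z) has_real_derivative ?h t z) (at t)"
      using gh(4)[OF t] by (rule DERIV_cmult)
  qed
next
  case (time k f)
  obtain g h where "heat_class_derivatives k f g h"
    using time.IH by blast
  note gh = heat_class_derivativesD[OF this]
  let ?g = "\<lambda>i t z. g i t z / t"
  let ?h = "\<lambda>t z. h t z / t + (-1) * (f t z / t / t)"
  have g: "heat_class (k - 2 - 1) (?g i)" for i
    using heat_class.time[OF gh(1)[of i]] by (simp add: algebra_simps)
  have h: "heat_class (k - 2 - 2) ?h"
    using heat_class.time[OF gh(2)] heat_class.time[OF heat_class.time[OF time.hyps]]
    by (intro heat_class.add heat_class.scale) (auto simp: algebra_simps)
  show ?case
  unfolding heat_class_derivatives_def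
  proof (intro exI[of _ ?g] exI[of _ ?h] conjI allI impI g h)
    fix t :: real and z :: R3 assume t: "0 < t"
    show "((\<lambda>z. f t z / t) has_derivative (\<lambda>v. \<Sum>i\<in>UNIV. v $ i * ?g i t z)) (at z)"
      using has_derivative_mult_left[OF gh(3)[OF t, of z], of "1 / t"]
      by (simp add: sum_divide_distrib)
    show "((\<lambda>s. f s z / s) has_real_derivative ?h t z) (at t)"
      using t by (auto intro!: derivative_eq_intros gh(4) simp: field_simps)
  qed
next
  case (add k f1 f2)
  obtain g1 h1 where "heat_class_derivatives k f1 g1 h1"
    using add.IH(1) by blast
  note g1h1 = heat_class_derivativesD[OF this]
  obtain g2 h2 where "heat_class_derivatives k f2 g2 h2"
    using add.IH(2) by blast
  note g2h2 = heat_class_derivativesD[OF this]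
  have sum: "(\<Sum>i\<in>UNIV. v $ i * (g1 i t z + g2 i t z))
     = (\<Sum>i\<in>UNIV. v $ i * g1 i t z) + (\<Sum>i\<in>UNIV. v $ i * g2 i t z)" for v z :: R3 and t
    by (simp add: distrib_left sum.distrib)
  show ?case
  unfolding heat_class_derivatives_def
  proof (intro exI[of _ "\<lambda>i t z. g1 i t z + g2 i t z"] exI[of _ "\<lambda>t z. h1 t z + h2 t z"] conjI allI impI)
    show "heat_class (k - 1) (\<lambda>t z. g1 i t z + g2 i t z)" for i by (intro heat_class.add g1h1(1) g2h2(1))
    show "heat_class (k - 2) (\<lambda>t z. h1 t z + h2 t z)" by (intro heat_class.add g1h1(2) g2h2(2))
    fix t :: real and z :: R3 assume t: "0 < t"
    show "((\<lambda>z. f1 t z + f2 t z) has_derivative (\<lambda>v. \<Sum>i\<in>UNIV. v $ i * (g1 i t z + g2 i t z))) (at z)"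
      unfolding sum by (intro has_derivative_add g1h1(3) g2h2(3) t)
    show "((\<lambda>s. f1 s z + f2 s z) has_real_derivative h1 t z + h2 t z) (at t)"
      by (intro DERIV_add g1h1(4) g2h2(4) t)
  qed
next
  case (scale k f c)
  obtain g h where "heat_class_derivatives k f g h"
    using scale.IH by blast
  note gh = heat_class_derivativesD[OF this]
  have sum: "(\<Sum>i\<in>UNIV. v $ i * (c * g i t z)) = c * (\<Sum>i\<in>UNIV. v $ i * g i t z)" for v z :: R3 and t
    by (simp add: sum_distrib_left mult_ac)
  show ?case
  unfolding heat_class_derivatives_def
  proof (intro exI[of _ "\<lambda>i t z. c * g i t z"] exI[of _ "\<lambda>t z. c * h t z"] conjI allI impI)
    show "heat_class (k - 1) (\<lambda>t z. c * g i t z)" for i by (intro heat_class.scale gh(1))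
    show "heat_class (k - 2) (\<lambda>t z. c * h t z)" by (intro heat_class.scale gh(2))
    fix t :: real and z :: R3 assume t: "0 < t"
    show "((\<lambda>z. c * f t z) has_derivative (\<lambda>v. \<Sum>i\<in>UNIV. v $ i * (c * g i t z))) (at z)"
      unfolding sum by (intro has_derivative_mult_right gh(3) t)
    show "((\<lambda>s. c * f s z) has_real_derivative c * h t z) (at t)"
      by (intro DERIV_cmult gh(4) t)
  qed
next
  case (cong k f f')
  obtain g h where "heat_class_derivatives k f g h"
    using cong.IH by blast
  note gh = heat_class_derivativesD[OF this]
  show ?case
  unfolding heat_class_derivatives_def
  proof (intro exI[of _ g] exI[of _ h] conjI allI impI gh(1,2))
    fix t :: real and z :: R3 assume t: "0 < t"
    have "f' t = f t" using cong.hyps t by auto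
    then show "(f' t has_derivative (\<lambda>v. \<Sum>i\<in>UNIV. v $ i * g i t z)) (at z)" using gh(3)[OF t] by simp
    show "((\<lambda>s. f' s z) has_real_derivative h t z) (at t)"
      by (rule has_field_derivative_transform_within_open[OF gh(4)[OF t], of "{0<..}"])
        (use t cong.hyps in auto)
  qed
qed

lemma heat_class_differentiable:
  assumes "heat_class k f" "0 < t"
  shows "f t differentiable (at z)"
proof -
  obtain g h where "heat_class_derivatives k f g h" using heat_class_derivatives_ex[OF assms(1)] by blast
  from heat_class_derivativesD(3)[OF this assms(2)] show ?thesis by (rule differentiableI)
qed

lemma heat_class_partial:
  assumes "heat_class k f"
  shows "heat_class (k - 1) (\<lambda>t. partial i (f t))"
proof -
  obtain g h where "heat_class_derivatives k f g h" using heat_class_derivatives_ex[OF assms] by blast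
  note gh = heat_class_derivativesD[OF this]
  show ?thesis
  proof (rule heat_class.cong[OF gh(1)])
    fix t z assume "(0::real) < t"
    from partial_eq[OF gh(3)[OF this], of i] show "partial i (f t) z = g i t z"
      by (simp only: partial_sum_axis)
  qed
qed

lemma heat_class_time_derivative:
  assumes "heat_class k f"
  shows "\<exists>h. heat_class (k - 2) h \<and> (\<forall>t>0. \<forall>z. ((\<lambda>s. f s z) has_real_derivative h t z) (at t))"
  using heat_class_derivatives_ex[OF assms] unfolding heat_class_derivatives_def by blast

section \<open>Differentiation under the integral sign\<close>

lemma mvt_along_segment:
  fixes f :: "R3 \<Rightarrow> real"
  assumes "\<And>x. f differentiable (at x)"
  obtains r where "0 < r" "r < 1" "f (z + v) - f z = (\<Sum>i\<in>UNIV. v $ i * partial i f (z + r *\<^sub>R v))"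
proof -
  have "((\<lambda>r. f (z + r *\<^sub>R v)) has_derivative (\<lambda>d. \<Sum>i\<in>UNIV. (d *\<^sub>R v) $ i * partial i f (z + r *\<^sub>R v)))
      (at r within {0..1})" for r :: real
  proof -
    have "((\<lambda>r. z + r *\<^sub>R v) has_derivative (\<lambda>d. d *\<^sub>R v)) (at r within {0..1})"
      by (auto intro!: derivative_eq_intros)
    from has_derivative_compose[OF this has_derivative_partial[OF assms]]
    show ?thesis by simp
  qed
  from mvt_simple[of 0 1 "\<lambda>r. f (z + r *\<^sub>R v)", OF _ this]
  obtain r where "r \<in> {0<..<1}"
    "f (z + 1 *\<^sub>R v) - f (z + 0 *\<^sub>R v) = (\<Sum>i\<in>UNIV. ((1 - 0) *\<^sub>R v) $ i * partial i f (z + r *\<^sub>R v))" by auto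
  then show ?thesis by (intro that[of r]) auto
qed

lemma abs_component_le: "\<bar>v $ i\<bar> \<le> norm v" for v :: R3
  using component_le_norm_cart[of v i] by simp

lemma lipschitz_of_partials_bounded:
  fixes f :: "R3 \<Rightarrow> real"
  assumes d: "\<And>x. f differentiable (at x)" and B: "\<And>i x. \<bar>partial i f x\<bar> \<le> B"
  shows "\<bar>f (z + v) - f z\<bar> \<le> 3 * B * norm v"
proof -
  obtain r where r: "f (z + v) - f z = (\<Sum>i\<in>UNIV. v $ i * partial i f (z + r *\<^sub>R v))"
    by (rule mvt_along_segment[OF d])
  have "\<bar>\<Sum>i\<in>UNIV. v $ i * partial i f (z + r *\<^sub>R v)\<bar> \<le> (\<Sum>i\<in>(UNIV::3 set). norm v * B)"
    by (intro order_trans[OF sum_abs] sum_mono) (simp add: abs_mult mult_mono abs_component_le B)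
  then show ?thesis by (simp add: r mult_ac)
qed

lemma taylor_remainder:
  fixes f :: "R3 \<Rightarrow> real"
  assumes d: "\<And>x. f differentiable (at x)" "\<And>i x. partial i f differentiable (at x)"
    and B: "\<And>i j x. \<bar>partial j (partial i f) x\<bar> \<le> B"
  shows "\<bar>f (z + v) - f z - (\<Sum>i\<in>UNIV. v $ i * partial i f z)\<bar> \<le> 9 * B * (norm v)\<^sup>2"
proof -
  have B0: "0 \<le> B" using B[of undefined undefined undefined] abs_ge_zero order_trans by blast
  obtain r where r: "0 < r" "r < 1" "f (z + v) - f z = (\<Sum>i\<in>UNIV. v $ i * partial i f (z + r *\<^sub>R v))"
    by (rule mvt_along_segment[OF d(1)])
  have "\<bar>partial i f (z + r *\<^sub>R v) - partial i f z\<bar> \<le> 3 * B * norm v" for i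
  proof -
    have "\<bar>partial i f (z + r *\<^sub>R v) - partial i f z\<bar> \<le> 3 * B * norm (r *\<^sub>R v)"
      by (rule lipschitz_of_partials_bounded[OF d(2) B])
    also have "norm (r *\<^sub>R v) \<le> norm v" using r by (simp add: mult_left_le_one_le)
    finally show ?thesis using B0 by (simp add: mult_left_mono)
  qed
  then have "\<bar>\<Sum>i\<in>UNIV. v $ i * (partial i f (z + r *\<^sub>R v) - partial i f z)\<bar>
      \<le> (\<Sum>i\<in>(UNIV::3 set). norm v * (3 * B * norm v))"
    by (intro order_trans[OF sum_abs] sum_mono) (simp add: abs_mult mult_mono abs_component_le)
  moreover have "f (z + v) - f z - (\<Sum>i\<in>UNIV. v $ i * partial i f z)
     = (\<Sum>i\<in>UNIV. v $ i * (partial i f (z + r *\<^sub>R v) - partial i f z))"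
    by (simp add: r(3) right_diff_distrib sum_subtractf)
  ultimately show ?thesis by (simp add: power2_eq_square mult_ac)
qed

text \<open>
A bound \<open>h \<xi>\<close> for the second partial derivatives that is uniform in \<open>x\<close> makes the Taylor remainder
\<open>O(|v|\<^sup>2 h \<xi>)\<close> by \<open>taylor_remainder\<close>.  This can be integrated over \<open>\<xi>\<close>, and gives differentiability of the
integral directly.
\<close>

lemma differentiate_under_integral:
  fixes f :: "R3 \<Rightarrow> 'b \<Rightarrow> real"
  assumes int: "\<And>x. integrable M (f x)" "\<And>i x. integrable M (\<lambda>\<xi>. partial i (\<lambda>x. f x \<xi>) x)" "integrable M h"
    and d: "\<And>x \<xi>. \<xi> \<in> space M \<Longrightarrow> (\<lambda>x. f x \<xi>) differentiable (at x)"
      "\<And>i x \<xi>. \<xi> \<in> space M \<Longrightarrow> partial i (\<lambda>x. f x \<xi>) differentiable (at x)"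
    and B: "\<And>i j x \<xi>. \<xi> \<in> space M \<Longrightarrow> \<bar>partial j (partial i (\<lambda>x. f x \<xi>)) x\<bar> \<le> h \<xi>"
  shows "(\<lambda>x. LINT \<xi>|M. f x \<xi>) differentiable (at z)"
    and "partial i (\<lambda>x. LINT \<xi>|M. f x \<xi>) z = (LINT \<xi>|M. partial i (\<lambda>x. f x \<xi>) z)"
proof -
  define D where "D i = (LINT \<xi>|M. partial i (\<lambda>x. f x \<xi>) z)" for i
  have "((\<lambda>x. LINT \<xi>|M. f x \<xi>) has_derivative (\<lambda>v. \<Sum>i\<in>UNIV. v $ i * D i)) (at z)"
  proof (rule has_derivativeI_sandwich[of 1])
    show "bounded_linear (\<lambda>v::R3. \<Sum>i\<in>UNIV. v $ i * D i)"
      by (intro bounded_linear_sum bounded_linear_mult_const bounded_linear_vec_nth)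
    fix y assume "y \<noteq> z"
    define v where "v = y - z"
    have y: "y = z + v" and v: "v \<noteq> 0" using \<open>y \<noteq> z\<close> by (auto simp: v_def)
    have rem: "(LINT \<xi>|M. f y \<xi>) - (LINT \<xi>|M. f z \<xi>) - (\<Sum>i\<in>UNIV. v $ i * D i)
       = (LINT \<xi>|M. f y \<xi> - f z \<xi> - (\<Sum>i\<in>UNIV. v $ i * partial i (\<lambda>x. f x \<xi>) z))"
      by (simp add: D_def int)
    have "\<bar>LINT \<xi>|M. f y \<xi> - f z \<xi> - (\<Sum>i\<in>UNIV. v $ i * partial i (\<lambda>x. f x \<xi>) z)\<bar>
       \<le> (LINT \<xi>|M. 9 * h \<xi> * (norm v)\<^sup>2)"
    proof -
      have "norm (LINT \<xi>|M. f y \<xi> - f z \<xi> - (\<Sum>i\<in>UNIV. v $ i * partial i (\<lambda>x. f x \<xi>) z))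
       \<le> (LINT \<xi>|M. 9 * h \<xi> * (norm v)\<^sup>2)"
      proof (rule order_trans[OF integral_norm_bound integral_mono])
        fix \<xi> assume "\<xi> \<in> space M"
        then show "norm (f y \<xi> - f z \<xi> - (\<Sum>i\<in>UNIV. v $ i * partial i (\<lambda>x. f x \<xi>) z)) \<le> 9 * h \<xi> * (norm v)\<^sup>2"
          unfolding y real_norm_def by (intro taylor_remainder d B)
      qed (auto intro!: int Bochner_Integration.integrable_diff Bochner_Integration.integrable_sum integrable_mult_right integrable_mult_left)
      then show ?thesis by simp
    qed
    then have "\<bar>(LINT \<xi>|M. f y \<xi>) - (LINT \<xi>|M. f z \<xi>) - (\<Sum>i\<in>UNIV. v $ i * D i)\<bar>
       \<le> 9 * (LINT \<xi>|M. h \<xi>) * (norm v)\<^sup>2"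
      by (simp add: rem)
    then show "norm ((LINT \<xi>|M. f y \<xi>) - (LINT \<xi>|M. f z \<xi>) - (\<Sum>i\<in>UNIV. (y - z) $ i * D i)) / norm (y - z)
       \<le> 9 * (LINT \<xi>|M. h \<xi>) * norm (y - z)"
      using v unfolding v_def[symmetric] by (simp add: pos_divide_le_eq power2_eq_square mult.assoc)
  next
    show "((\<lambda>y. 9 * (LINT \<xi>|M. h \<xi>) * norm (y - z)) \<longlongrightarrow> 0) (at z)"
      by (rule tendsto_eq_intros | simp)+
  qed simp
  then show "(\<lambda>x. LINT \<xi>|M. f x \<xi>) differentiable (at z)"
    "partial i (\<lambda>x. LINT \<xi>|M. f x \<xi>) z = (LINT \<xi>|M. partial i (\<lambda>x. f x \<xi>) z)"
    using partial_eq[of "\<lambda>x. LINT \<xi>|M. f x \<xi>" "\<lambda>v. \<Sum>i\<in>UNIV. v $ i * D i" z i]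
    by (auto simp: D_def partial_sum_axis intro: differentiableI)
qed

text \<open>
Up to a factor the Gaussian is the heat kernel at time \<open>1 / (4 s)\<close>, to which \<open>heat_class_decay\<close>
applies.
\<close>

lemma integrable_norm_power_times_gaussian:
  assumes "0 < s"
  shows "integrable lborel (\<lambda>\<xi>::R3. norm \<xi> ^ m * exp (- s * (norm \<xi>)\<^sup>2))"
proof -
  define t where "t = 1 / (4 * s)"
  have t: "0 < t" using assms by (simp add: t_def)
  obtain C0 where C0: "0 \<le> C0"
    "\<forall>t>0. \<forall>\<xi>. \<bar>heat_kernel t \<xi>\<bar> * pnorm t \<xi> ^ (m + 4) \<le> C0 * sqrt t powi (-3 + int (m + 4))"
    using heat_class_decay[OF heat_class.kernel, of "m + 4"] by blast
  define C where "C = C0 * sqrt t powi (-3 + int (m + 4))"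
  have C: "0 \<le> C" "\<And>\<xi>. \<bar>heat_kernel t \<xi>\<bar> * pnorm t \<xi> ^ (m + 4) \<le> C"
    using C0 t by (auto simp: C_def)
  define c where "c = (4 * pi * t) powr (- 3 / 2)"
  have c: "0 < c" using t by (simp add: c_def)
  have le: "norm \<xi> ^ m * exp (- s * (norm \<xi>)\<^sup>2) \<le> C / c * (1 / (norm (0 - \<xi>) ^ 0 * (sqrt t + norm (0 - \<xi>)) ^ 4))" for \<xi> :: R3
  proof -
    have G: "heat_kernel t \<xi> = c * exp (- s * (norm \<xi>)\<^sup>2)"
      using assms by (simp add: heat_kernel_def c_def t_def)
    have "norm \<xi> ^ m * exp (- s * (norm \<xi>)\<^sup>2) * pnorm t \<xi> ^ 4
      \<le> pnorm t \<xi> ^ m * exp (- s * (norm \<xi>)\<^sup>2) * pnorm t \<xi> ^ 4"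
      using t by (intro mult_right_mono power_mono) (auto simp: pnorm_def)
    also have "\<dots> \<le> C / c"
      using C(2)[of \<xi>] c unfolding G by (simp add: pos_le_divide_eq abs_mult power_add mult_ac)
    finally show ?thesis
      using zero_less_power[OF pnorm_pos[OF t, of \<xi>], of 4] unfolding pnorm_def
      by (simp add: pos_le_divide_eq[symmetric])
  qed
  have fin: "(\<integral>\<^sup>+\<xi>. ennreal (C / c * (1 / (norm (0 - \<xi> :: R3) ^ 0 * (sqrt t + norm (0 - \<xi>)) ^ 4))) \<partial>lborel) < \<infinity>"
  proof -
    have "(\<integral>\<^sup>+\<xi>. ennreal (C / c * (1 / (norm (0 - \<xi> :: R3) ^ 0 * (sqrt t + norm (0 - \<xi>)) ^ 4))) \<partial>lborel)
       = ennreal (C / c) * (\<integral>\<^sup>+\<xi>. ennreal (1 / (norm (0 - \<xi> :: R3) ^ 0 * (sqrt t + norm (0 - \<xi>)) ^ 4)) \<partial>lborel)"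
      using C(1) c by (subst nn_integral_cmult[symmetric]) (auto simp: ennreal_mult'[symmetric])
    also have "\<dots> \<le> ennreal (C / c) * ennreal (16 * (2 ^ 0 + 8) / sqrt t ^ (0 + 4 - 3))"
      using t by (intro mult_left_mono nn_integral_spatial_decay) auto
    also have "\<dots> < \<infinity>" by (simp add: ennreal_mult_less_top)
    finally show ?thesis .
  qed
  show ?thesis
  proof (rule integrableI_bounded)
    have "(\<integral>\<^sup>+\<xi>. ennreal (norm (norm (\<xi>::R3) ^ m * exp (- s * (norm \<xi>)\<^sup>2))) \<partial>lborel)
      \<le> (\<integral>\<^sup>+\<xi>. ennreal (C / c * (1 / (norm (0 - \<xi> :: R3) ^ 0 * (sqrt t + norm (0 - \<xi>)) ^ 4))) \<partial>lborel)"
      using le by (intro nn_integral_mono ennreal_leI) simp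
    then show "(\<integral>\<^sup>+\<xi>. ennreal (norm (norm (\<xi>::R3) ^ m * exp (- s * (norm \<xi>)\<^sup>2))) \<partial>lborel) < \<infinity>"
      using fin by (rule le_less_trans)
  qed measurable
qed

lemma integrable_dominated_by_gaussian:
  fixes f :: "R3 \<Rightarrow> 'b::{banach, second_countable_topology}"
  assumes "0 < s" and [measurable]: "f \<in> borel_measurable borel"
    and "\<And>\<xi>. norm (f \<xi>) \<le> norm \<xi> ^ m * exp (- s * (norm \<xi>)\<^sup>2)"
  shows "integrable lborel f"
  by (rule Bochner_Integration.integrable_bound[OF integrable_norm_power_times_gaussian[OF assms(1), of m]])
    (use assms(3) in auto)

section \<open>The Fourier transform of the heat kernel\<close>

text \<open>
The characteristic function of the standard normal distribution, rescaled by \<open>c = 1 / \<surd>(2 s)\<close>.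
\<close>

lemma gaussian_fourier_1D:
  fixes a s :: real
  assumes s: "0 < s"
  shows "integrable lborel (\<lambda>\<xi>. iexp (a * \<xi>) * complex_of_real (exp (- s * \<xi>\<^sup>2)))"
    and "(CLINT \<xi>|lborel. iexp (a * \<xi>) * complex_of_real (exp (- s * \<xi>\<^sup>2)))
      = complex_of_real (sqrt (pi / s) * exp (- a\<^sup>2 / (4 * s)))"
proof -
  \<comment> \<open>with this scaling \<open>s (c x)\<^sup>2 = x\<^sup>2 / 2\<close>, the exponent of the standard normal density\<close>
  define c where "c = 1 / sqrt (2 * s)"
  have c: "0 < c" using s by (simp add: c_def)
  have c2: "s * c\<^sup>2 = 1 / 2" using s by (simp add: c_def power_divide)
  let ?f = "\<lambda>\<xi>. iexp (a * \<xi>) * complex_of_real (exp (- s * \<xi>\<^sup>2))"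
  have fc: "?f (0 + c * x) = complex_of_real (sqrt (2 * pi)) * (std_normal_density x *\<^sub>R iexp ((a * c) * x))" for x
  proof -
    have "- s * (c * x)\<^sup>2 = - (s * c\<^sup>2) * x\<^sup>2" by (simp add: power_mult_distrib)
    then have "- s * (c * x)\<^sup>2 = - x\<^sup>2 / 2" unfolding c2 by simp
    then have e: "exp (- s * (c * x)\<^sup>2) = sqrt (2 * pi) * std_normal_density x"
      by (simp add: std_normal_density_def)
    show ?thesis
      unfolding add_0 e by (simp add: scaleR_conv_of_real mult_ac)
  qed
  have int: "integrable lborel (\<lambda>x. std_normal_density x *\<^sub>R iexp ((a * c) * x))"
    by (rule Bochner_Integration.integrable_bound[of lborel std_normal_density]) auto
  have ch: "(CLINT x|lborel. std_normal_density x *\<^sub>R iexp ((a * c) * x)) = complex_of_real (exp (- (a * c)\<^sup>2 / 2))"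
    using fun_cong[OF char_std_normal_distribution, of "a * c"] unfolding char_def
    by (subst (asm) integral_density) auto
  show "integrable lborel ?f"
  proof -
    have "integrable lborel (\<lambda>x. ?f (0 + c * x))" unfolding fc by (intro integrable_mult_right int)
    then show ?thesis using lborel_integrable_real_affine_iff[of c ?f 0] c by simp
  qed
  have "(CLINT \<xi>|lborel. ?f \<xi>) = \<bar>c\<bar> *\<^sub>R (CLINT x|lborel. ?f (0 + c * x))"
    using c by (intro lborel_integral_real_affine) simp
  also have "\<dots> = complex_of_real (c * sqrt (2 * pi) * exp (- (a * c)\<^sup>2 / 2))"
    unfolding fc integral_mult_right_zero ch using c by (simp add: scaleR_conv_of_real)
  also have "c * sqrt (2 * pi) = sqrt (pi / s)"
    using s by (simp add: c_def real_sqrt_divide real_sqrt_mult)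
  also have "- (a * c)\<^sup>2 / 2 = - a\<^sup>2 / (4 * s)"
    using s by (simp add: c_def power_divide power_mult_distrib)
  finally show "(CLINT \<xi>|lborel. ?f \<xi>) = complex_of_real (sqrt (pi / s) * exp (- a\<^sup>2 / (4 * s)))" .
qed

lemma norm_power2_Basis: "(norm x)\<^sup>2 = (\<Sum>b\<in>Basis. (x \<bullet> b)\<^sup>2)" for x :: "'a::euclidean_space"
  unfolding power2_norm_eq_inner by (subst euclidean_inner) (simp add: power2_eq_square)

lemma gaussian_fourier:
  fixes x :: "'a::euclidean_space"
  assumes s: "0 < s"
  shows "(CLINT \<xi>|lborel. cis (x \<bullet> \<xi>) * complex_of_real (exp (- s * (norm \<xi>)\<^sup>2)))
     = complex_of_real (sqrt (pi / s) ^ DIM('a) * exp (- (norm x)\<^sup>2 / (4 * s)))"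
proof -
  interpret product_sigma_finite "\<lambda>b::'a. lborel :: real measure" by standard
  let ?F = "\<lambda>\<xi>::'a. cis (x \<bullet> \<xi>) * complex_of_real (exp (- s * (norm \<xi>)\<^sup>2))"
  let ?f = "\<lambda>b \<xi>. iexp ((x \<bullet> b) * \<xi>) * complex_of_real (exp (- s * \<xi>\<^sup>2))"
  have F: "?F (\<Sum>b\<in>Basis. \<xi> b *\<^sub>R b) = (\<Prod>b\<in>Basis. ?f b (\<xi> b))" for \<xi> :: "'a \<Rightarrow> real"
  proof -
    have "x \<bullet> (\<Sum>b\<in>Basis. \<xi> b *\<^sub>R b) = (\<Sum>b\<in>Basis. (x \<bullet> b) * \<xi> b)"
      by (simp add: inner_sum_right mult.commute)
    then have 1: "cis (x \<bullet> (\<Sum>b\<in>Basis. \<xi> b *\<^sub>R b)) = (\<Prod>b\<in>Basis. iexp ((x \<bullet> b) * \<xi> b))"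
      by (simp add: cis_conv_exp exp_sum sum_distrib_left)
    have "(norm (\<Sum>b\<in>Basis. \<xi> b *\<^sub>R b))\<^sup>2 = (\<Sum>b\<in>Basis. (\<xi> b)\<^sup>2)"
      unfolding norm_power2_Basis by (intro sum.cong) auto
    then have 2: "exp (- s * (norm (\<Sum>b\<in>Basis. \<xi> b *\<^sub>R b))\<^sup>2) = (\<Prod>b\<in>Basis. exp (- s * (\<xi> b)\<^sup>2))"
      by (simp add: sum_distrib_left exp_sum[symmetric] sum_negf)
    show ?thesis unfolding 1 2 by (simp add: prod.distrib)
  qed
  have "integral\<^sup>L lborel ?F = (CLINT \<xi>|(\<Pi>\<^sub>M b\<in>Basis. lborel). ?F (\<Sum>b\<in>Basis. \<xi> b *\<^sub>R b))"
    by (subst lborel_eq, subst integral_distr) (auto intro!: borel_measurable_continuous_onI continuous_intros)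
  also have "\<dots> = (\<Prod>b\<in>Basis. CLINT \<xi>|lborel. ?f b \<xi>)"
    unfolding F by (rule product_integral_prod) (rule finite_Basis, rule gaussian_fourier_1D(1)[OF s])
  also have "\<dots> = (\<Prod>b\<in>Basis. complex_of_real (sqrt (pi / s) * exp (- (x \<bullet> b)\<^sup>2 / (4 * s))))"
    by (simp only: gaussian_fourier_1D(2)[OF s])
  also have "\<dots> = complex_of_real (sqrt (pi / s) ^ DIM('a) * exp (- (norm x)\<^sup>2 / (4 * s)))"
    unfolding norm_power2_Basis
    by (simp add: prod.distrib exp_sum[symmetric] sum_divide_distrib[symmetric] sum_negf flip: of_real_prod of_real_mult)
  finally show ?thesis .
qed

lemma heat_kernel_fourier:
  assumes s: "0 < s"
  shows "(LINT \<xi>|lborel. cos (x \<bullet> \<xi>) * exp (- s * (norm \<xi>)\<^sup>2)) = (2 * pi) ^ 3 * heat_kernel s x"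
proof -
  have int: "integrable lborel (\<lambda>\<xi>::R3. cis (x \<bullet> \<xi>) * complex_of_real (exp (- s * (norm \<xi>)\<^sup>2)))"
    by (rule integrable_dominated_by_gaussian[OF s, where m = 0])
       (auto simp: norm_mult intro!: borel_measurable_continuous_onI continuous_intros)
  have "(LINT \<xi>|lborel. cos (x \<bullet> \<xi>) * exp (- s * (norm \<xi>)\<^sup>2))
      = (LINT \<xi>|lborel. Re (cis (x \<bullet> \<xi>) * complex_of_real (exp (- s * (norm \<xi>)\<^sup>2))))"
    by simp
  also have "\<dots> = Re (CLINT \<xi>|lborel. cis (x \<bullet> \<xi>) * complex_of_real (exp (- s * (norm \<xi>)\<^sup>2)))"
    by (rule integral_Re[OF int])
  also have "\<dots> = sqrt (pi / s) ^ 3 * exp (- (norm x)\<^sup>2 / (4 * s))"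
    by (simp only: gaussian_fourier[OF s] Re_complex_of_real) simp
  also have "sqrt (pi / s) ^ 3 = (2 * pi) ^ 3 * (4 * pi * s) powr (- 3 / 2)"
  proof -
    have "(4 * pi * s) powr (- 3 / 2) = inverse (sqrt (4 * pi * s) ^ 3)"
      using s powr_three_halves[of "4 * pi * s"] by (simp add: power_int_minus)
    moreover have "sqrt (4 * pi * s) * sqrt (pi / s) = 2 * pi"
      using s by (simp add: real_sqrt_mult[symmetric]) (simp add: real_sqrt_mult)
    then have "(2 * pi) ^ 3 = sqrt (4 * pi * s) ^ 3 * sqrt (pi / s) ^ 3"
      by (simp add: power_mult_distrib[symmetric])
    ultimately show ?thesis using s by simp
  qed
  finally show ?thesis by (simp add: heat_kernel_def mult.assoc)
qed

lemma partial_wave: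
  fixes \<xi> :: R3
  shows "(\<lambda>x. cos (x \<bullet> \<xi>) * w) differentiable (at x)"
    and "partial i (\<lambda>x. cos (x \<bullet> \<xi>) * w) = (\<lambda>x. sin (x \<bullet> \<xi>) * (- \<xi> $ i * w))"
    and "(\<lambda>x. sin (x \<bullet> \<xi>) * w) differentiable (at x)"
    and "partial i (\<lambda>x. sin (x \<bullet> \<xi>) * w) = (\<lambda>x. cos (x \<bullet> \<xi>) * (\<xi> $ i * w))"
proof -
  have c: "((\<lambda>x. cos (x \<bullet> \<xi>) * w) has_derivative (\<lambda>v. - sin (x \<bullet> \<xi>) * (v \<bullet> \<xi>) * w)) (at x)" for x
    by (auto intro!: derivative_eq_intros)
  have s: "((\<lambda>x. sin (x \<bullet> \<xi>) * w) has_derivative (\<lambda>v. cos (x \<bullet> \<xi>) * (v \<bullet> \<xi>) * w)) (at x)" for x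
    by (auto intro!: derivative_eq_intros)
  have ax: "axis i 1 \<bullet> \<xi> = \<xi> $ i" by (simp add: inner_axis' )
  show "(\<lambda>x. cos (x \<bullet> \<xi>) * w) differentiable (at x)" using c by (rule differentiableI)
  show "(\<lambda>x. sin (x \<bullet> \<xi>) * w) differentiable (at x)" using s by (rule differentiableI)
  show "partial i (\<lambda>x. cos (x \<bullet> \<xi>) * w) = (\<lambda>x. sin (x \<bullet> \<xi>) * (- \<xi> $ i * w))"
    by (rule ext) (simp add: partial_eq[OF c] ax)
  show "partial i (\<lambda>x. sin (x \<bullet> \<xi>) * w) = (\<lambda>x. cos (x \<bullet> \<xi>) * (\<xi> $ i * w))"
    by (rule ext) (simp add: partial_eq[OF s] ax)
qed

lemma partial_cmult:
  assumes "f differentiable (at x)"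
  shows "partial i (\<lambda>x. c * f x) x = c * partial i f x"
proof -
  obtain D where D: "(f has_derivative D) (at x)" using assms by (auto simp: differentiable_def)
  show ?thesis by (simp add: partial_eq[OF has_derivative_mult_right[OF D]] partial_eq[OF D])
qed

text \<open>
Two differentiations of \<open>heat_kernel_fourier\<close> under the integral sign; each is justified by the
integrability of \<open>|\<xi>|\<^sup>m exp (- s |\<xi>|\<^sup>2)\<close>.
\<close>

lemma heat_kernel_second_partial_fourier:
  assumes s: "0 < s"
  shows "(LINT \<xi>|lborel. cos (x \<bullet> \<xi>) * (\<xi> $ i * \<xi> $ j * exp (- s * (norm \<xi>)\<^sup>2)))
    = - ((2 * pi) ^ 3 * partial i (partial j (heat_kernel s)) x)"
proof -
  define w where "w \<xi> = exp (- s * (norm \<xi>)\<^sup>2)" for \<xi> :: R3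
  have w: "0 \<le> w \<xi>" for \<xi> by (simp add: w_def)
  have int: "integrable lborel (\<lambda>\<xi>. norm \<xi> ^ m * w \<xi>)" for m
    unfolding w_def by (rule integrable_norm_power_times_gaussian[OF s])
  have [measurable]: "w \<in> borel_measurable borel" unfolding w_def[abs_def] by measurable
  have dom: "integrable lborel f" if [measurable]: "f \<in> borel_measurable borel" and "\<And>\<xi>. \<bar>f \<xi>\<bar> \<le> norm \<xi> ^ m * w \<xi>" for f m
    using that(2) w by (intro Bochner_Integration.integrable_bound[OF int[of m]]) auto
  have c1: "\<bar>\<xi> $ i\<bar> \<le> norm \<xi>" for \<xi> :: R3 and i by (rule abs_component_le)
  have c2: "\<bar>\<xi> $ i * \<xi> $ j\<bar> \<le> (norm \<xi>)\<^sup>2" for \<xi> :: R3 and i j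
    using mult_mono[OF c1[of \<xi> i] c1[of \<xi> j]] by (simp add: abs_mult power2_eq_square)
  have c3: "\<bar>\<xi> $ i * (\<xi> $ j * \<xi> $ k)\<bar> \<le> norm \<xi> ^ 3" for \<xi> :: R3 and i j k
    using mult_mono[OF c1[of \<xi> i] c2[of \<xi> j k]] by (simp add: abs_mult power2_eq_square power3_eq_cube)
  have tr: "\<bar>cos r * a\<bar> \<le> b" "\<bar>sin r * a\<bar> \<le> b" if "\<bar>a\<bar> \<le> b" for r a b :: real
    using mult_mono[OF abs_cos_le_one[of r] that] mult_mono[OF abs_sin_le_one[of r] that] by (auto simp: abs_mult)
  have m1: "\<bar>a * w \<xi>\<bar> \<le> b * w \<xi>" if "\<bar>a\<bar> \<le> b" for a b \<xi>
    using w[of \<xi>] that by (simp add: abs_mult mult_right_mono)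
  have step1: "partial j (\<lambda>x. LINT \<xi>|lborel. cos (x \<bullet> \<xi>) * w \<xi>) x
      = (LINT \<xi>|lborel. partial j (\<lambda>x. cos (x \<bullet> \<xi>) * w \<xi>) x)" for x
  proof (rule differentiate_under_integral(2))
    show "integrable lborel (\<lambda>\<xi>. cos (x \<bullet> \<xi>) * w \<xi>)" for x
      by (rule dom[where m=0]) (auto intro!: tr simp: w)
    show "integrable lborel (\<lambda>\<xi>. partial i (\<lambda>x. cos (x \<bullet> \<xi>) * w \<xi>) x)" for i x
      unfolding partial_wave by (rule dom[where m=1]) (auto intro!: tr m1 simp: c1)
    show "integrable lborel (\<lambda>\<xi>. (norm \<xi>)\<^sup>2 * w \<xi>)" by (rule int)
    show "\<bar>partial k (partial i (\<lambda>x. cos (x \<bullet> \<xi>) * w \<xi>)) x\<bar> \<le> (norm \<xi>)\<^sup>2 * w \<xi>" for i k x \<xi>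
      unfolding partial_wave using m1[OF c2[of \<xi> k i]] by (intro tr) (simp add: mult_ac)
  qed (simp_all only: partial_wave)
  have step2: "partial i (\<lambda>x. LINT \<xi>|lborel. sin (x \<bullet> \<xi>) * (- \<xi> $ j * w \<xi>)) x
      = (LINT \<xi>|lborel. partial i (\<lambda>x. sin (x \<bullet> \<xi>) * (- \<xi> $ j * w \<xi>)) x)" for x
  proof (rule differentiate_under_integral(2))
    show "integrable lborel (\<lambda>\<xi>. sin (x \<bullet> \<xi>) * (- \<xi> $ j * w \<xi>))" for x
      by (rule dom[where m=1]) (auto intro!: tr m1 simp: c1)
    show "integrable lborel (\<lambda>\<xi>. partial i (\<lambda>x. sin (x \<bullet> \<xi>) * (- \<xi> $ j * w \<xi>)) x)" for i x
      unfolding partial_wave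
    proof (rule dom[where m=2])
      show "\<bar>cos (x \<bullet> \<xi>) * (\<xi> $ i * (- \<xi> $ j * w \<xi>))\<bar> \<le> (norm \<xi>)\<^sup>2 * w \<xi>" for \<xi>
        using m1[OF c2[of \<xi> i j]] by (intro tr) (simp add: mult_ac)
    qed measurable
    show "integrable lborel (\<lambda>\<xi>. norm \<xi> ^ 3 * w \<xi>)" by (rule int)
    show "\<bar>partial k (partial i (\<lambda>x. sin (x \<bullet> \<xi>) * (- \<xi> $ j * w \<xi>))) x\<bar> \<le> norm \<xi> ^ 3 * w \<xi>" for i k x \<xi>
      unfolding partial_wave using m1[OF c3[of \<xi> k i j]] by (intro tr) (simp add: mult_ac)
  qed (simp_all only: partial_wave)
  have cm: "partial j (\<lambda>x. (2 * pi) ^ 3 * heat_kernel s x) = (\<lambda>x. (2 * pi) ^ 3 * partial j (heat_kernel s) x)"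
    by (rule ext, rule partial_cmult, rule heat_class_differentiable[OF heat_class.kernel s])
  have "(LINT \<xi>|lborel. cos (x \<bullet> \<xi>) * (\<xi> $ i * (- \<xi> $ j * w \<xi>)))
     = partial i (partial j (\<lambda>x. LINT \<xi>|lborel. cos (x \<bullet> \<xi>) * w \<xi>)) x"
    unfolding step1 partial_wave(2) step2 unfolding partial_wave(4) ..
  also have "\<dots> = partial i (\<lambda>x. (2 * pi) ^ 3 * partial j (heat_kernel s) x) x"
    unfolding w_def heat_kernel_fourier[OF s] cm ..
  also have "\<dots> = (2 * pi) ^ 3 * partial i (partial j (heat_kernel s)) x"
    by (rule partial_cmult, rule heat_class_differentiable[OF heat_class_partial[OF heat_class.kernel] s])
  finally have "(LINT \<xi>|lborel. - (cos (x \<bullet> \<xi>) * (\<xi> $ i * \<xi> $ j * w \<xi>)))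
     = (2 * pi) ^ 3 * partial i (partial j (heat_kernel s)) x"
    by (simp add: mult.assoc)
  then show ?thesis by (simp add: w_def)
qed

section \<open>The kernel of the heat semigroup composed with the Leray projector\<close>

lemma has_integral_exp_tail:
  fixes a t :: real
  assumes a: "0 < a"
  shows "has_bochner_integral lborel (\<lambda>s. indicator {t..} s * exp (- s * a)) (exp (- t * a) / a)"
proof (rule has_bochner_integral_nn_integral)
  have "((\<lambda>s. exp (- (a * s))) \<longlongrightarrow> 0) at_top"
    using a by (intro filterlim_compose[OF exp_at_bot] filterlim_compose[OF filterlim_uminus_at_bot_at_top]
       filterlim_tendsto_pos_mult_at_top[OF tendsto_const a filterlim_ident])
  then have lim: "((\<lambda>s. - exp (- s * a) / a) \<longlongrightarrow> 0) at_top"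
    using tendsto_divide[OF tendsto_minus tendsto_const[of a], of "\<lambda>s. exp (- s * a)" 0 at_top] a
    by (simp add: mult.commute)
  have "(\<integral>\<^sup>+s. ennreal (exp (- s * a)) * indicator {t..} s \<partial>lborel) = ennreal (0 - (- exp (- t * a) / a))"
    using a by (intro nn_integral_FTC_atLeast lim) (auto intro!: derivative_eq_intros)
  then show "(\<integral>\<^sup>+s. ennreal (indicator {t..} s * exp (- s * a)) \<partial>lborel) = ennreal (exp (- t * a) / a)"
    by (simp add: ennreal_mult' ennreal_indicator mult.commute)
qed (use a in auto)

lemma nn_integral_inverse_power_tail:
  fixes q t :: real
  assumes q: "0 < t + q"
  shows "(\<integral>\<^sup>+s. ennreal (1 / (s + q) ^ (n + 2)) * indicator {t..} s \<partial>lborel) = ennreal (1 / (real (n + 1) * (t + q) ^ (n + 1)))"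
proof -
  let ?F = "\<lambda>s::real. - (1 / (real (n + 1) * (s + q) ^ (n + 1)))"
  have lim: "(?F \<longlongrightarrow> 0) at_top"
  proof -
    have "filterlim (\<lambda>s. real (n + 1) * (s + q) ^ (n + 1)) at_top at_top"
      unfolding add.commute[of _ q]
      by (intro filterlim_tendsto_pos_mult_at_top[OF tendsto_const] filterlim_pow_at_top
           filterlim_tendsto_add_at_top[OF tendsto_const filterlim_ident]) auto
    then have "((\<lambda>s. 1 / (real (n + 1) * (s + q) ^ (n + 1))) \<longlongrightarrow> 0) at_top"
      by (rule real_tendsto_divide_at_top[OF tendsto_const])
    then show ?thesis using tendsto_minus by force
  qed
  have "(\<integral>\<^sup>+s. ennreal (1 / (s + q) ^ (n + 2)) * indicator {t..} s \<partial>lborel) = ennreal (0 - ?F t)"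
  proof (rule nn_integral_FTC_atLeast[OF _ _ _ lim])
    fix s assume "t \<le> s"
    then have s: "0 < s + q" using q by simp
    have pw: "(s + q) ^ (n + 1) * (s + q) ^ (n + 1) = (s + q) ^ n * (s + q) ^ (n + 2)"
      by (simp add: power_add[symmetric])
    have "((\<lambda>s. - (inverse (real (n + 1)) * inverse ((s + q) ^ (n + 1)))) has_real_derivative
       (inverse (real (n + 1)) * (inverse ((s + q) ^ (n + 1)) * (real (n + 1) * (s + q) ^ n) * inverse ((s + q) ^ (n + 1))))) (at s)"
    proof -
      have "((\<lambda>s. (s + q) ^ (n + 1)) has_real_derivative real (n + 1) * (s + q) ^ n) (at s)"
        by (rule derivative_eq_intros | simp)+
      from DERIV_minus[OF DERIV_cmult[OF DERIV_inverse'[OF this]]] s show ?thesis by simp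
    qed
    moreover have "inverse (real (n + 1)) * (inverse ((s + q) ^ (n + 1)) * (real (n + 1) * (s + q) ^ n) * inverse ((s + q) ^ (n + 1)))
       = (s + q) ^ n / ((s + q) ^ (n + 1) * (s + q) ^ (n + 1))"
      using s by (simp add: divide_inverse)
    moreover have "\<dots> = 1 / (s + q) ^ (n + 2)" unfolding pw using s by simp
    moreover have "?F = (\<lambda>s. - (inverse (real (n + 1)) * inverse ((s + q) ^ (n + 1))))"
      by (simp add: divide_inverse)
    ultimately show "(?F has_real_derivative 1 / (s + q) ^ (n + 2)) (at s)" by (simp only:)
    show "0 \<le> 1 / (s + q) ^ (n + 2)" using s by simp
  qed measurable
  then show ?thesis by simp
qed

lemma heat_class_measurable_comp [measurable (raw)]:
  assumes "heat_class k F" and [measurable]: "f \<in> borel_measurable M" "g \<in> borel_measurable M"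
  shows "(\<lambda>x. indicator {0<..} (f x) * F (f x) (g x)) \<in> borel_measurable M"
proof -
  have "(\<lambda>x. (f x, g x)) \<in> borel_measurable M" by measurable
  from measurable_compose[OF this heat_class_measurable[OF assms(1)]] show ?thesis by simp
qed

text \<open>
In \<open>heat_class_decay\<close> the power of \<open>t\<close> disappears if \<open>m\<close> is minus the degree.
\<close>

lemma heat_class_bound:
  assumes "heat_class k f" "k = - int m"
  shows "\<exists>C\<ge>0. \<forall>t>0. \<forall>z. \<bar>f t z\<bar> \<le> C / pnorm t z ^ m"
proof -
  obtain C where C: "0 \<le> C" "\<forall>t>0. \<forall>z. \<bar>f t z\<bar> * pnorm t z ^ m \<le> C * sqrt t powi (k + int m)"
    using heat_class_decay[OF assms(1), of m] by blast
  have "\<bar>f t z\<bar> \<le> C / pnorm t z ^ m" if "0 < t" for t z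
    using C(2) that zero_less_power[OF pnorm_pos[OF that, of z], of m] by (simp add: assms(2) pos_le_divide_eq)
  then show ?thesis using C(1) by blast
qed

text \<open>
For the integrals over \<open>s \<ge> t\<close> below a bound is needed that is integrable in \<open>s\<close> and uniform in \<open>z\<close>;
degree \<open>-4\<close> is enough for \<open>1 / s\<^sup>2\<close>.
\<close>

lemma heat_class_tail_bound:
  assumes "heat_class k f" "k = - int m" "4 \<le> m" "0 < t"
  shows "\<exists>C\<ge>0. \<forall>s\<ge>t. \<forall>z. \<bar>f s z\<bar> \<le> C * (1 / s\<^sup>2)"
proof -
  obtain C where C: "0 \<le> C" "\<forall>t>0. \<forall>z. \<bar>f t z\<bar> \<le> C / pnorm t z ^ m"
    using heat_class_bound[OF assms(1,2)] by blast
  show ?thesis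
  proof (intro exI[of _ "C / sqrt t ^ (m - 4)"] conjI allI impI)
    show "0 \<le> C / sqrt t ^ (m - 4)" using C(1) assms by simp
    fix s z assume s: "t \<le> s"
    have "sqrt t ^ (m - 4) * s\<^sup>2 = sqrt t ^ (m - 4) * sqrt s ^ 4"
      using s assms by (simp add: power4_eq_xxxx power2_eq_square)
    also have "\<dots> \<le> sqrt s ^ (m - 4) * sqrt s ^ 4"
      using s assms by (intro mult_right_mono power_mono) auto
    also have "\<dots> = sqrt s ^ m" using assms by (simp add: power_add[symmetric])
    also have "\<dots> \<le> pnorm s z ^ m" using s assms by (intro power_mono) (auto simp: pnorm_def)
    finally have "C / pnorm s z ^ m \<le> C / (sqrt t ^ (m - 4) * s\<^sup>2)"
      using C(1) s assms by (intro divide_left_mono mult_pos_pos zero_less_power pnorm_pos) auto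
    moreover have "\<bar>f s z\<bar> \<le> C / pnorm s z ^ m" using C(2) s assms by auto
    ultimately show "\<bar>f s z\<bar> \<le> C / sqrt t ^ (m - 4) * (1 / s\<^sup>2)" by simp
  qed
qed

lemma integrable_inverse_square_tail:
  assumes "0 < t"
  shows "integrable lborel (\<lambda>s::real. indicator {t..} s * (C * (1 / s\<^sup>2)))"
proof -
  have "integrable lborel (\<lambda>s::real. 1 / s\<^sup>2 * indicator {t..} s)"
  proof (rule integrableI_bounded)
    have "(\<integral>\<^sup>+s. ennreal (norm (1 / s\<^sup>2 * indicator {t..} s)) \<partial>lborel) = (\<integral>\<^sup>+s. ennreal (1 / (s + 0) ^ (0 + 2)) * indicator {t..} s \<partial>lborel)"
      by (intro nn_integral_cong) (auto simp: indicator_def power2_eq_square)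
    also have "\<dots> < \<infinity>" using assms by (subst nn_integral_inverse_power_tail) auto
    finally show "(\<integral>\<^sup>+s. ennreal (norm (1 / s\<^sup>2 * indicator {t..} s)) \<partial>lborel) < \<infinity>" .
  qed measurable
  from integrable_mult_right[OF this, of C] show ?thesis by (simp add: mult_ac)
qed

lemma heat_class_tail_integrable:
  assumes "heat_class k f" "k = - int m" "4 \<le> m" "0 < t"
  shows "integrable lborel (\<lambda>s. indicator {t..} s * f s z)"
proof -
  obtain C where C: "\<forall>s\<ge>t. \<forall>z. \<bar>f s z\<bar> \<le> C * (1 / s\<^sup>2)"
    using heat_class_tail_bound[OF assms] by blast
  have "(\<lambda>s. indicator {t..} s * (indicator {0<..} s * f s z)) \<in> borel_measurable lborel"
    by (intro borel_measurable_times heat_class_measurable_comp[OF assms(1)]) auto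
  then have m: "(\<lambda>s. indicator {t..} s * f s z) \<in> borel_measurable lborel"
    by (rule measurable_cong[THEN iffD1, rotated]) (use assms(4) in \<open>auto simp: indicator_def\<close>)
  show ?thesis
  proof (rule Bochner_Integration.integrable_bound[OF integrable_inverse_square_tail[OF assms(4), of C] m])
    have "norm (indicator {t..} s * f s z) \<le> norm (indicator {t..} s * (C * (1 / s\<^sup>2)))" for s
    proof (cases "t \<le> s")
      case True
      then have "\<bar>f s z\<bar> \<le> C * (1 / s\<^sup>2)" using C by blast
      also have "\<dots> \<le> \<bar>C * (1 / s\<^sup>2)\<bar>" by (rule abs_ge_self)
      finally show ?thesis using True by simp
    qed simp
    then show "AE s in lborel. norm (indicator {t..} s * f s z) \<le> norm (indicator {t..} s * (C * (1 / s\<^sup>2)))"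
      by simp
  qed
qed

text \<open>
For \<open>\<xi> \<noteq> 0\<close> the singular factor of the symbol is a time integral,
\<open>exp (- t |\<xi>|\<^sup>2) / |\<xi>|\<^sup>2 = \<integral>\<^sub>s\<^sub>\<ge>\<^sub>t exp (- s |\<xi>|\<^sup>2) ds\<close>.  After exchanging the integrals, the inner
one is the Fourier integral of \<open>- \<partial>\<^sub>j \<partial>\<^sub>k G\<^sub>s\<close>.
\<close>

lemma heat_leray_kernel_eq:
  assumes t: "0 < t"
  shows "heat_leray_kernel t x $ j $ k = (if j = k then 1 else 0) * heat_kernel t x
    + (LINT s|lborel. indicator {t..} s * partial j (partial k (heat_kernel s)) x)"
proof -
  define w where "w \<xi> = exp (- t * (norm \<xi>)\<^sup>2)" for \<xi> :: R3
  define \<delta> :: real where "\<delta> = (if j = k then 1 else 0)"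
  have \<delta>: "\<bar>\<delta>\<bar> \<le> 1" by (simp add: \<delta>_def)
  have [measurable]: "w \<in> borel_measurable borel" unfolding w_def[abs_def] by measurable
  have quot: "\<bar>\<xi> $ j * \<xi> $ k / (norm \<xi>)\<^sup>2\<bar> \<le> 1" for \<xi> :: R3
  proof (cases "\<xi> = 0")
    case False
    have "\<bar>\<xi> $ j * \<xi> $ k\<bar> \<le> (norm \<xi>)\<^sup>2"
      using mult_mono[OF abs_component_le[of \<xi> j] abs_component_le[of \<xi> k]] by (simp add: abs_mult power2_eq_square)
    then show ?thesis using False by simp
  qed simp
  have sym: "leray_symbol \<xi> $ j $ k = \<delta> - \<xi> $ j * \<xi> $ k / (norm \<xi>)\<^sup>2" for \<xi>
    by (simp add: leray_symbol_def \<delta>_def)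
  let ?S = "\<lambda>\<xi>. cis (x \<bullet> \<xi>) * complex_of_real (w \<xi> * (\<delta> - \<xi> $ j * \<xi> $ k / (norm \<xi>)\<^sup>2))"
  let ?A = "\<lambda>\<xi>. cos (x \<bullet> \<xi>) * (\<xi> $ j * \<xi> $ k / (norm \<xi>)\<^sup>2 * w \<xi>)"
  have [measurable]: "(\<lambda>\<xi>. cis (x \<bullet> \<xi>)) \<in> borel_measurable borel"
    by (intro borel_measurable_continuous_onI continuous_intros)
  have m: "?S \<in> borel_measurable borel" by measurable
  have intw: "integrable lborel w"
    using integrable_norm_power_times_gaussian[OF t, of 0] by (simp add: w_def[abs_def])
  have intS: "integrable lborel ?S"
  proof (rule Bochner_Integration.integrable_bound[OF integrable_mult_right[OF intw, of 2]])
    have "norm (?S \<xi>) \<le> norm (2 * w \<xi>)" for \<xi>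
    proof -
      have "\<bar>\<delta> - \<xi> $ j * \<xi> $ k / (norm \<xi>)\<^sup>2\<bar> \<le> 2" 
        using quot[of \<xi>] abs_triangle_ineq4[of \<delta> "\<xi> $ j * \<xi> $ k / (norm \<xi>)\<^sup>2"] \<delta> by linarith
      then have "w \<xi> * \<bar>\<delta> - \<xi> $ j * \<xi> $ k / (norm \<xi>)\<^sup>2\<bar> \<le> w \<xi> * 2"
        by (intro mult_left_mono) (auto simp: w_def)
      moreover have "norm (?S \<xi>) = \<bar>w \<xi> * (\<delta> - \<xi> $ j * \<xi> $ k / (norm \<xi>)\<^sup>2)\<bar>"
        by (simp only: norm_mult norm_cis norm_of_real mult_1_left)
      ultimately show ?thesis by (simp add: abs_mult w_def mult.commute)
    qed
    then show "AE \<xi> in lborel. norm (?S \<xi>) \<le> norm (2 * w \<xi>)" by simp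
  qed (use m in simp)
  have intA: "integrable lborel ?A"
  proof (rule Bochner_Integration.integrable_bound[OF intw])
    have "norm (?A \<xi>) \<le> norm (w \<xi>)" for \<xi>
    proof -
      have "\<bar>cos (x \<bullet> \<xi>)\<bar> * \<bar>\<xi> $ j * \<xi> $ k / (norm \<xi>)\<^sup>2\<bar> \<le> 1 * 1"
        by (intro mult_mono quot) auto
      from mult_right_mono[OF this, of "\<bar>w \<xi>\<bar>"] show ?thesis by (simp add: abs_mult mult.assoc)
    qed
    then show "AE \<xi> in lborel. norm (?A \<xi>) \<le> norm (w \<xi>)" by simp
  qed measurable
  have intC: "integrable lborel (\<lambda>\<xi>. cos (x \<bullet> \<xi>) * w \<xi>)"
    by (rule Bochner_Integration.integrable_bound[OF intw])
       (auto simp: abs_mult intro!: mult_left_le_one_le)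
  let ?f = "\<lambda>p::R3 \<times> real. cos (x \<bullet> fst p) * (fst p $ j * fst p $ k) * (indicator {t..} (snd p) * exp (- snd p * (norm (fst p))\<^sup>2))"
  have inner: "has_bochner_integral lborel (\<lambda>s. indicator {t..} s * exp (- s * (norm \<xi>)\<^sup>2)) (w \<xi> / (norm \<xi>)\<^sup>2)" if "\<xi> \<noteq> 0" for \<xi> :: R3
    unfolding w_def using that by (intro has_integral_exp_tail) auto
  have innerA: "(LINT s|lborel. ?f (\<xi>, s)) = ?A \<xi>" for \<xi>
  proof (cases "\<xi> = 0")
    case False
    show ?thesis
      unfolding fst_conv snd_conv integral_mult_right_zero has_bochner_integral_integral_eq[OF inner[OF False]] by simp
  qed simp
  have intf: "integrable (lborel \<Otimes>\<^sub>M lborel) ?f"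
  proof (rule lborel_pair.Fubini_integrable)
    show "AE \<xi> in lborel. integrable lborel (\<lambda>s. ?f (\<xi>, s))"
    proof (rule AE_I2)
      fix \<xi> :: R3
      show "integrable lborel (\<lambda>s. ?f (\<xi>, s))"
      proof (cases "\<xi> = 0")
        case False
        show ?thesis
          unfolding fst_conv snd_conv by (intro integrable_mult_right integrable.intros[OF inner[OF False]])
      qed simp
    qed
    have "(LINT s|lborel. norm (?f (\<xi>, s))) = norm (?A \<xi>)" for \<xi>
    proof (cases "\<xi> = 0")
      case False
      have "(LINT s|lborel. norm (?f (\<xi>, s)))
        = (LINT s|lborel. \<bar>cos (x \<bullet> \<xi>) * (\<xi> $ j * \<xi> $ k)\<bar> * (indicator {t..} s * exp (- s * (norm \<xi>)\<^sup>2)))"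
        by (intro Bochner_Integration.integral_cong) (auto simp: abs_mult)
      also have "\<dots> = \<bar>cos (x \<bullet> \<xi>) * (\<xi> $ j * \<xi> $ k)\<bar> * (w \<xi> / (norm \<xi>)\<^sup>2)"
        unfolding integral_mult_right_zero has_bochner_integral_integral_eq[OF inner[OF False]] ..
      finally show ?thesis by (simp add: abs_mult w_def)
    qed simp
    then show "integrable lborel (\<lambda>\<xi>. LINT s|lborel. norm (?f (\<xi>, s)))"
      using integrable_norm[OF intA] by simp
  qed (unfold lborel_prod, measurable)
  have "(LINT \<xi>|lborel. ?A \<xi>) = (LINT \<xi>|lborel. LINT s|lborel. ?f (\<xi>, s))" unfolding innerA ..
  also have "\<dots> = (LINT s|lborel. LINT \<xi>|lborel. ?f (\<xi>, s))"
    using lborel_pair.Fubini_integral[of "\<lambda>\<xi> s. ?f (\<xi>, s)"] intf by (simp add: case_prod_unfold)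
  also have "\<dots> = (LINT s|lborel. - ((2 * pi) ^ 3) * (indicator {t..} s * partial j (partial k (heat_kernel s)) x))"
  proof (rule Bochner_Integration.integral_cong[OF refl])
    fix s :: real
    have "(LINT \<xi>|lborel. ?f (\<xi>, s)) = indicator {t..} s * (LINT \<xi>|lborel. cos (x \<bullet> \<xi>) * (\<xi> $ j * \<xi> $ k * exp (- s * (norm \<xi>)\<^sup>2)))"
      by (subst integral_mult_right_zero[symmetric]) (auto intro!: Bochner_Integration.integral_cong simp: mult_ac)
    also have "\<dots> = - ((2 * pi) ^ 3) * (indicator {t..} s * partial j (partial k (heat_kernel s)) x)"
      using t heat_kernel_second_partial_fourier[of s x j k] by (auto simp: indicator_def)
    finally show "(LINT \<xi>|lborel. ?f (\<xi>, s)) = - ((2 * pi) ^ 3) * (indicator {t..} s * partial j (partial k (heat_kernel s)) x)" .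
  qed
  also have "\<dots> = - ((2 * pi) ^ 3) * (LINT s|lborel. indicator {t..} s * partial j (partial k (heat_kernel s)) x)"
    by (rule integral_mult_right_zero)
  finally have A: "(LINT \<xi>|lborel. ?A \<xi>) = - ((2 * pi) ^ 3) * (LINT s|lborel. indicator {t..} s * partial j (partial k (heat_kernel s)) x)" .
  have "heat_leray_kernel t x $ j $ k = Re (integral\<^sup>L lebesgue ?S) / (2 * pi) ^ 3"
    by (simp add: heat_leray_kernel_def sym w_def)
  also have "integral\<^sup>L lebesgue ?S = integral\<^sup>L lborel ?S"
    by (rule integral_completion) (use m in simp)
  also have "Re (integral\<^sup>L lborel ?S) = (LINT \<xi>|lborel. Re (?S \<xi>))"
    by (rule integral_Re[OF intS, symmetric])
  also have "\<dots> = (LINT \<xi>|lborel. \<delta> * (cos (x \<bullet> \<xi>) * w \<xi>) - ?A \<xi>)"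
    by (intro Bochner_Integration.integral_cong) (auto simp: algebra_simps)
  also have "\<dots> = \<delta> * (LINT \<xi>|lborel. cos (x \<bullet> \<xi>) * w \<xi>) - (LINT \<xi>|lborel. ?A \<xi>)"
    by (simp only: Bochner_Integration.integral_diff[OF integrable_mult_right[OF intC] intA] integral_mult_right_zero)
  also have "(LINT \<xi>|lborel. cos (x \<bullet> \<xi>) * w \<xi>) = (2 * pi) ^ 3 * heat_kernel t x"
    unfolding w_def by (rule heat_kernel_fourier[OF t])
  finally have "heat_leray_kernel t x $ j $ k
    = (\<delta> * ((2 * pi) ^ 3 * heat_kernel t x) - (LINT \<xi>|lborel. ?A \<xi>)) / (2 * pi) ^ 3" .
  moreover have "(\<delta> * (c * G) - (- c * I)) / c = \<delta> * G + I" if "c \<noteq> 0" for c G I :: real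
    using that by (simp add: field_simps)
  ultimately show ?thesis unfolding A by (simp add: \<delta>_def)
qed

lemma heat_leray_kernel_partial:
  assumes t: "0 < t"
  shows "partial l (\<lambda>z. heat_leray_kernel t z $ j $ k) x = (if j = k then 1 else 0) * partial l (heat_kernel t) x
    + (LINT s|lborel. indicator {t..} s * partial l (partial j (partial k (heat_kernel s))) x)"
proof -
  define g where "g s = partial j (partial k (heat_kernel s))" for s
  have g: "heat_class (- int 5) g"
    using heat_class_partial[OF heat_class_partial[OF heat_class.kernel, of k], of j] by (simp add: g_def[abs_def])
  have g1: "heat_class (- int 6) (\<lambda>s. partial i (g s))" for i
    using heat_class_partial[OF g, of i] by simp
  have g2: "heat_class (- int 7) (\<lambda>s. partial m (partial i (g s)))" for i m
    using heat_class_partial[OF g1, of m] by simp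
  have cut: "partial i (\<lambda>x. indicator {t..} s * f s x) = (\<lambda>x. indicator {t..} s * partial i (f s) x)"
    if "heat_class n f" for i f s n
  proof (cases "t \<le> s")
    case True
    then show ?thesis using partial_cmult[OF heat_class_differentiable[OF that, of s], where c=1] t by simp
  next
    case False
    have "partial i (\<lambda>x::R3. 0) x = 0" for x by (rule partial_eq) (rule has_derivative_const)
    then show ?thesis using False by (simp add: fun_eq_iff)
  qed
  have cutd: "(\<lambda>x. indicator {t..} s * f s x) differentiable (at x)" if "heat_class n f" for f s x n
    using heat_class_differentiable[OF that, of s x] t by (cases "t \<le> s") auto
  have ex: "\<exists>B. \<forall>s\<ge>t. \<forall>z. \<forall>i m. \<bar>partial m (partial i (g s)) z\<bar> \<le> B * (1 / s\<^sup>2)"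
  proof -
    have "\<forall>i m. \<exists>C\<ge>0. \<forall>s\<ge>t. \<forall>z. \<bar>partial m (partial i (g s)) z\<bar> \<le> C * (1 / s\<^sup>2)"
      by (intro allI heat_class_tail_bound[OF g2 refl _ t]) simp
    then obtain C where C: "\<And>i m. 0 \<le> C i m" "\<And>i m s z. t \<le> s \<Longrightarrow> \<bar>partial m (partial i (g s)) z\<bar> \<le> C i m * (1 / s\<^sup>2)"
      by metis
    have "C i m \<le> (\<Sum>i\<in>UNIV. \<Sum>m\<in>UNIV. C i m)" for i m
    proof -
      have "C i m \<le> (\<Sum>m\<in>UNIV. C i m)" by (rule member_le_sum) (auto simp: C)
      also have "\<dots> \<le> (\<Sum>i\<in>UNIV. \<Sum>m\<in>UNIV. C i m)" by (rule member_le_sum) (auto simp: C sum_nonneg)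
      finally show ?thesis .
    qed
    then have "\<bar>partial m (partial i (g s)) z\<bar> \<le> (\<Sum>i\<in>UNIV. \<Sum>m\<in>UNIV. C i m) * (1 / s\<^sup>2)" if "t \<le> s" for s z i m
      by (intro order_trans[OF C(2)[OF that]] mult_right_mono) auto
    then show ?thesis by blast
  qed
  then obtain B where B: "\<And>s z i m. t \<le> s \<Longrightarrow> \<bar>partial m (partial i (g s)) z\<bar> \<le> B * (1 / s\<^sup>2)" by blast
  have P: "integrable lborel (\<lambda>s. indicator {t..} s * g s x)"
    "integrable lborel (\<lambda>s. partial i (\<lambda>x. indicator {t..} s * g s x) x)"
    "(\<lambda>x. indicator {t..} s * g s x) differentiable (at x)"
    "partial i (\<lambda>x. indicator {t..} s * g s x) differentiable (at x)" for i x s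
    unfolding cut[OF g]
    by (rule heat_class_tail_integrable[OF g refl _ t], simp)
       (rule heat_class_tail_integrable[OF g1 refl _ t], simp, rule cutd[OF g], rule cutd[OF g1])
  have bound: "\<bar>partial m (partial i (\<lambda>x. indicator {t..} s * g s x)) x\<bar> \<le> indicator {t..} s * (B * (1 / s\<^sup>2))" for i m x s
    unfolding cut[OF g] cut[OF g1] using B[of s m i x] by (auto simp: indicator_def)
  note I = differentiate_under_integral[OF P(1,2) integrable_inverse_square_tail[OF t] P(3,4) bound]
  have add: "partial l (\<lambda>x. c * f x + h x) x = c * partial l f x + partial l h x"
    if fh: "f differentiable (at x)" "h differentiable (at x)" for f h and c :: real
  proof -
    obtain D E where DE: "(f has_derivative D) (at x)" "(h has_derivative E) (at x)"
      using fh by (auto simp: differentiable_def)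
    show ?thesis
      using partial_eq[OF has_derivative_add[OF has_derivative_mult_right[OF DE(1)] DE(2)], of l c] partial_eq[OF DE(1), of l] partial_eq[OF DE(2), of l]
      by simp
  qed
  have "(\<lambda>z. heat_leray_kernel t z $ j $ k) = (\<lambda>z. (if j = k then 1 else 0) * heat_kernel t z + (LINT s|lborel. indicator {t..} s * g s z))"
    unfolding g_def by (rule ext) (rule heat_leray_kernel_eq[OF t])
  then have "partial l (\<lambda>z. heat_leray_kernel t z $ j $ k) x
     = (if j = k then 1 else 0) * partial l (heat_kernel t) x + partial l (\<lambda>x. LINT s|lborel. indicator {t..} s * g s x) x"
    using add[OF heat_class_differentiable[OF heat_class.kernel t] I(1), of "if j = k then 1 else 0"] by (simp only:)
  then show ?thesis unfolding I(2)[of l x] cut[OF g] by (simp add: g_def)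
qed

text \<open>
The third derivatives of the heat kernel are \<open>O((\<surd>s + |x|)\<^sup>-\<^sup>6) = O((s + |x|\<^sup>2)\<^sup>-\<^sup>3)\<close>, and integration
over \<open>s \<ge> t\<close> gains one power of \<open>t + |x|\<^sup>2\<close>.
\<close>

lemma heat_leray_kernel_partial_bound:
  "\<exists>C>0. \<forall>t>0. \<forall>x. \<bar>partial l (\<lambda>z. heat_leray_kernel t z $ j $ k) x\<bar> \<le> C / pnorm t x ^ 4"
proof -
  have "heat_class (- int 4) (\<lambda>t. partial l (heat_kernel t))"
    using heat_class_partial[OF heat_class.kernel, of l] by simp
  from heat_class_bound[OF this refl] obtain C1 where C1: "0 \<le> C1"
    "\<And>t x. 0 < t \<Longrightarrow> \<bar>partial l (heat_kernel t) x\<bar> \<le> C1 / pnorm t x ^ 4" by blast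
  define g where "g s = partial l (partial j (partial k (heat_kernel s)))" for s
  have g: "heat_class (- int 6) g"
    using heat_class_partial[OF heat_class_partial[OF heat_class_partial[OF heat_class.kernel, of k], of j], of l]
    by (simp add: g_def[abs_def])
  from heat_class_bound[OF g refl] obtain C2 where C2: "0 \<le> C2"
    "\<And>t x. 0 < t \<Longrightarrow> \<bar>g t x\<bar> \<le> C2 / pnorm t x ^ 6" by blast
  show ?thesis
  proof (intro exI[of _ "C1 + 2 * C2 + 1"] conjI allI impI)
    show "0 < C1 + 2 * C2 + 1" using C1 C2 by simp
    fix t :: real and x :: R3 assume t: "0 < t"
    define R where "R = pnorm t x"
    have R: "0 < R" using t by (simp add: R_def pnorm_pos)
    define q where "q = (norm x)\<^sup>2"
    have q: "0 \<le> q" by (simp add: q_def)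
    have Rq: "R\<^sup>2 \<le> 2 * (t + q)"
      using sum_squares_bound[of "sqrt t" "norm x"] t by (simp add: R_def pnorm_def q_def power2_sum)
    have "norm (LINT s|lborel. indicator {t..} s * g s x) \<le> (\<integral>\<^sup>+s. norm (indicator {t..} s * g s x) \<partial>lborel)"
      by (rule integral_norm_bound_ennreal[OF heat_class_tail_integrable[OF g refl _ t]]) simp
    also have "\<dots> \<le> (\<integral>\<^sup>+s. ennreal C2 * (ennreal (1 / (s + q) ^ (1 + 2)) * indicator {t..} s) \<partial>lborel)"
    proof (rule nn_integral_mono)
      fix s :: real
      show "ennreal (norm (indicator {t..} s * g s x)) \<le> ennreal C2 * (ennreal (1 / (s + q) ^ (1 + 2)) * indicator {t..} s)"
      proof (cases "t \<le> s")
        case True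
        then have s: "0 < s" using t by simp
        have "s + q \<le> (pnorm s x)\<^sup>2" using s by (simp add: pnorm_def q_def power2_sum)
        then have "(s + q) ^ 3 \<le> ((pnorm s x)\<^sup>2) ^ 3" using s q by (intro power_mono) auto
        then have "(s + q) ^ 3 \<le> pnorm s x ^ 6" by (simp add: power_mult[symmetric])
        then have "C2 / pnorm s x ^ 6 \<le> C2 * (1 / (s + q) ^ 3)"
          using s q C2(1) by (auto intro!: divide_left_mono mult_pos_pos zero_less_power pnorm_pos add_pos_nonneg)
        then have "\<bar>g s x\<bar> \<le> C2 * (1 / (s + q) ^ 3)" using C2(2)[OF s, of x] by linarith
        then have "\<bar>g s x\<bar> \<le> C2 * (1 / (s + q) ^ (1 + 2))" by (simp add: numeral_3_eq_3 del: power_Suc)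
        then show ?thesis using True C2(1) s q by (simp add: ennreal_mult'[symmetric] ennreal_leI)
      qed simp
    qed
    also have "\<dots> = ennreal C2 * ennreal (1 / (real (1 + 1) * (t + q) ^ (1 + 1)))"
      using t q by (subst nn_integral_cmult) (auto simp only: nn_integral_inverse_power_tail, auto)
    also have "\<dots> = ennreal (C2 * (1 / (2 * (t + q)\<^sup>2)))"
      using C2(1) by (subst ennreal_mult'[symmetric]) (auto simp: power2_eq_square)
    finally have "norm (LINT s|lborel. indicator {t..} s * g s x) \<le> C2 * (1 / (2 * (t + q)\<^sup>2))"
      using C2(1) by (simp add: ennreal_le_iff)
    also have "\<dots> \<le> C2 * (2 / R ^ 4)"
    proof (rule mult_left_mono[OF _ C2(1)])
      have "(R\<^sup>2)\<^sup>2 \<le> (2 * (t + q))\<^sup>2" using Rq by (intro power_mono) auto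
      then have "R ^ 4 \<le> 4 * (t + q)\<^sup>2" unfolding power_mult_distrib by simp
      moreover have "0 < (t + q)\<^sup>2" using t q by auto
      ultimately show "1 / (2 * (t + q)\<^sup>2) \<le> 2 / R ^ 4" using R by (simp add: field_simps)
    qed
    finally have tail: "\<bar>LINT s|lborel. indicator {t..} s * g s x\<bar> \<le> 2 * C2 / R ^ 4" by (simp add: mult.commute)
    have "\<bar>partial l (\<lambda>z. heat_leray_kernel t z $ j $ k) x\<bar>
      \<le> \<bar>(if j = k then 1 else 0) * partial l (heat_kernel t) x\<bar> + \<bar>LINT s|lborel. indicator {t..} s * g s x\<bar>"
      unfolding heat_leray_kernel_partial[OF t] g_def by (rule abs_triangle_ineq)
    also have "\<bar>(if j = k then 1 else 0) * partial l (heat_kernel t) x\<bar> \<le> C1 / R ^ 4"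
      using C1(2)[OF t, of x] C1(1) R by (simp add: R_def)
    also note tail
    also have "C1 / R ^ 4 + 2 * C2 / R ^ 4 \<le> (C1 + 2 * C2 + 1) / R ^ 4"
      using R by (simp add: add_divide_distrib)
    finally show "\<bar>partial l (\<lambda>z. heat_leray_kernel t z $ j $ k) x\<bar> \<le> (C1 + 2 * C2 + 1) / pnorm t x ^ 4"
      by (simp add: R_def)
  qed
qed

lemma heat_leray_kernel_partial_measurable:
  "(\<lambda>p. indicator {0<..} (fst p) * partial l (\<lambda>z. heat_leray_kernel (fst p) z $ j $ k) (snd p)) \<in> borel_measurable borel"
proof -
  define g where "g s = partial l (partial j (partial k (heat_kernel s)))" for s
  have g: "heat_class (-3 - 1 - 1 - 1) g"
    unfolding g_def[abs_def] by (intro heat_class_partial heat_class.kernel)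
  have [measurable]: "(\<lambda>q::(real \<times> R3) \<times> real. indicator {0<..} (snd q) * g (snd q) (snd (fst q))) \<in> borel_measurable (borel \<Otimes>\<^sub>M lborel)"
    by (rule heat_class_measurable_comp[OF g]) auto
  have [measurable]: "(\<lambda>p::real \<times> R3. indicator {0<..} (fst p) * partial l (heat_kernel (fst p)) (snd p)) \<in> borel_measurable borel"
    by (rule heat_class_measurable[OF heat_class_partial[OF heat_class.kernel]])
  have "(\<lambda>p. (if j = k then 1 else 0) * (indicator {0<..} (fst p) * partial l (heat_kernel (fst p)) (snd p))
    + indicator {0<..} (fst p) * (LINT s|lborel. (if fst p \<le> s then 1 else 0) * (indicator {0<..} s * g s (snd p)))) \<in> borel_measurable (borel :: (real \<times> R3) measure)"
    by measurable
  moreover have "indicator {0<..} (fst p) * partial l (\<lambda>z. heat_leray_kernel (fst p) z $ j $ k) (snd p)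
    = (if j = k then 1 else 0) * (indicator {0<..} (fst p) * partial l (heat_kernel (fst p)) (snd p))
    + indicator {0<..} (fst p) * (LINT s|lborel. (if fst p \<le> s then 1 else 0) * (indicator {0<..} s * g s (snd p)))" for p :: "real \<times> R3"
  proof (cases "0 < fst p")
    case True
    have "(LINT s|lborel. (if fst p \<le> s then 1 else 0) * (indicator {0<..} s * g s (snd p)))
       = (LINT s|lborel. indicator {fst p..} s * g s (snd p))"
      using True by (intro Bochner_Integration.integral_cong) auto
    then show ?thesis using True by (simp add: heat_leray_kernel_partial g_def)
  qed simp
  ultimately show ?thesis by simp
qed

section \<open>Lebesgue measurable functions and their Borel versions\<close>

lemma borel_measurable_lebesgue_AE_eq:
  fixes f g :: "'a::euclidean_space \<Rightarrow> 'b::topological_space"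
  assumes g: "g \<in> borel_measurable borel" and ae: "AE x in lborel. f x = g x"
  shows "f \<in> borel_measurable lebesgue"
proof (rule measurableI)
  fix A :: "'b set" assume "A \<in> sets borel"
  then have "g -` A \<in> sets lebesgue" using measurable_sets[OF g, of A] by auto
  moreover have "AE x in lebesgue. x \<in> g -` A \<longleftrightarrow> x \<in> f -` A"
    using AE_completion[OF ae] by eventually_elim simp
  ultimately show "f -` A \<inter> space lebesgue \<in> sets lebesgue"
    using completion.in_sets_AE[of "g -` A" "f -` A" lborel] by simp
qed simp

text \<open>
Integrals over the completed measure depend only on a Borel version of the integrand.  This is how
the Lebesgue integrals in the definition of a mild solution are transferred to product measures, for
which Fubini's theorem is available.
\<close>

lemma integral_lebesgue_AE_eq:
  fixes f g :: "'a::euclidean_space \<Rightarrow> 'b::{banach, second_countable_topology}"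
  assumes g: "g \<in> borel_measurable borel" and ae: "AE x in lborel. f x = g x"
  shows "(LINT x|lebesgue. f x) = (LINT x|lborel. g x)"
proof -
  have "(LINT x|lebesgue. f x) = (LINT x|lebesgue. g x)"
    using g by (intro integral_cong_AE borel_measurable_lebesgue_AE_eq[OF g ae] AE_completion[OF ae])
      (simp add: measurable_completion)
  also have "\<dots> = (LINT x|lborel. g x)" using g by (intro integral_completion) simp
  finally show ?thesis .
qed

lemma lebesgue_measurable_AE_eq_borel:
  fixes f :: "'a::euclidean_space \<Rightarrow> 'b::euclidean_space"
  assumes "f \<in> borel_measurable lebesgue"
  shows "\<exists>g\<in>borel_measurable borel. AE x in lborel. f x = g x"
proof -
  have "\<exists>h\<in>borel_measurable lborel. AE x in lborel. f x \<bullet> b = h x" for b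
    using assms by (intro completion_ex_borel_measurable_real borel_measurable_inner) auto
  then obtain h where h: "\<And>b. h b \<in> borel_measurable lborel" "\<And>b. AE x in lborel. f x \<bullet> b = h b x" by metis
  have "AE x in lborel. \<forall>b\<in>Basis. f x \<bullet> b = h b x"
    using h(2) by (intro AE_finite_allI) auto
  then have "AE x in lborel. f x = (\<Sum>b\<in>Basis. h b x *\<^sub>R b)"
  proof eventually_elim
    case (elim x)
    have "(\<Sum>b\<in>Basis. h b x *\<^sub>R b) = (\<Sum>b\<in>Basis. (f x \<bullet> b) *\<^sub>R b)"
      using elim by (intro sum.cong) auto
    then show ?case by (simp only: euclidean_representation)
  qed
  moreover have "(\<lambda>x. \<Sum>b\<in>Basis. h b x *\<^sub>R b) \<in> borel_measurable borel"
    using h(1) by (intro borel_measurable_sum borel_measurable_scaleR) auto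
  ultimately show ?thesis by (intro bexI)
qed

lemma borel_measurable_vecI:
  fixes f :: "'a \<Rightarrow> 'b::euclidean_space ^ 'n"
  assumes "\<And>i. (\<lambda>x. f x $ i) \<in> borel_measurable M"
  shows "f \<in> borel_measurable M"
  unfolding borel_measurable_euclidean_space[of f]
proof
  fix b :: "'b ^ 'n" assume "b \<in> Basis"
  then obtain i c where "b = axis i c" by (auto simp: Basis_vec_def)
  then have "f x \<bullet> b = f x $ i \<bullet> c" for x by (simp add: inner_axis)
  then show "(\<lambda>x. f x \<bullet> b) \<in> borel_measurable M"
    using assms[of i] by (auto intro!: borel_measurable_inner)
qed

section \<open>The heat flow of the initial velocity\<close>

text \<open>
True for every function, since the integral of a function that is not integrable is 0.
\<close>

lemma norm_integral_le_nn_integral: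
  fixes f :: "'a \<Rightarrow> 'b::{banach, second_countable_topology}"
  shows "ennreal (norm (LINT x|M. f x)) \<le> (\<integral>\<^sup>+x. ennreal (norm (f x)) \<partial>M)"
  by (cases "integrable M f") (auto intro: integral_norm_bound_ennreal simp: not_integrable_integral_eq)

text \<open>
The heat kernel is \<open>O(\<surd>t \<rho>\<^sup>-\<^sup>4)\<close> by \<open>heat_class_decay\<close> with \<open>m = 4\<close>; what remains is
\<open>spatial_convolution\<close>.
\<close>

lemma norm_heat_le:
  "\<exists>C>0. \<forall>f r. 0 \<le> r \<longrightarrow> (\<forall>x. norm x * norm (f x) \<le> r) \<longrightarrow>
     (\<forall>t>0. \<forall>x. norm (heat t f x) \<le> C * r / pnorm t x)"
proof -
  obtain C1 where C1: "0 \<le> C1" "\<forall>t>0. \<forall>z. \<bar>heat_kernel t z\<bar> * pnorm t z ^ 4 \<le> C1 * sqrt t powi (-3 + int 4)"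
    using heat_class_decay[OF heat_class.kernel, of 4] by blast
  obtain C2 where C2: "0 < C2" "\<forall>t>0. \<forall>x::R3. (\<integral>\<^sup>+y. ennreal (sqrt t / (pnorm t (x - y) ^ 4 * norm y)) \<partial>lborel) \<le> ennreal (C2 / pnorm t x)"
    using spatial_convolution by blast
  show ?thesis
  proof (intro exI[of _ "(C1 + 1) * C2"] conjI allI impI)
    show "0 < (C1 + 1) * C2" using C1 C2 by simp
    fix f :: "R3 \<Rightarrow> R3" and r t :: real and x :: R3
    assume r: "0 \<le> r" and f: "\<forall>x. norm x * norm (f x) \<le> r" and t: "0 < t"
    have G: "\<bar>heat_kernel t z\<bar> \<le> C1 * (sqrt t / pnorm t z ^ 4)" for z
      using C1(2) t zero_less_power[OF pnorm_pos[OF t, of z], of 4] by (simp add: pos_le_divide_eq)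
    have "ennreal (norm (heat t f x)) \<le> (\<integral>\<^sup>+y. ennreal (norm (heat_kernel t (x - y) *\<^sub>R f y)) \<partial>lborel)"
      unfolding heat_def nn_integral_completion[of lborel, symmetric] by (rule norm_integral_le_nn_integral)
    also have "\<dots> \<le> (\<integral>\<^sup>+y. ennreal (C1 * r) * ennreal (sqrt t / (pnorm t (x - y) ^ 4 * norm y)) \<partial>lborel)"
    proof (rule nn_integral_mono_AE)
      show "AE y in lborel. ennreal (norm (heat_kernel t (x - y) *\<^sub>R f y))
          \<le> ennreal (C1 * r) * ennreal (sqrt t / (pnorm t (x - y) ^ 4 * norm y))"
        using AE_lborel_singleton[of 0]
      proof eventually_elim
        case (elim y)
        have "norm (f y) \<le> r / norm y" using f elim by (simp add: pos_le_divide_eq mult.commute)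
        then have "\<bar>heat_kernel t (x - y)\<bar> * norm (f y) \<le> C1 * (sqrt t / pnorm t (x - y) ^ 4) * (r / norm y)"
          using C1(1) t by (intro mult_mono G) (auto simp: pnorm_nonneg)
        then show ?case
          using C1(1) r by (subst ennreal_mult'[symmetric]) (auto intro!: ennreal_leI simp: mult_ac)
      qed
    qed
    also have "\<dots> = ennreal (C1 * r) * (\<integral>\<^sup>+y. ennreal (sqrt t / (pnorm t (x - y) ^ 4 * norm y)) \<partial>lborel)"
      by (rule nn_integral_cmult) measurable
    also have "\<dots> \<le> ennreal (C1 * r) * ennreal (C2 / pnorm t x)"
      using C2(2) t by (intro mult_left_mono) auto
    also have "\<dots> = ennreal (C1 * r * (C2 / pnorm t x))"
      using C1(1) r by (subst ennreal_mult') auto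
    finally have "norm (heat t f x) \<le> C1 * r * (C2 / pnorm t x)"
      using C1(1) C2(1) r t by (subst (asm) ennreal_le_iff) (auto simp: pnorm_nonneg)
    also have "\<dots> \<le> (C1 + 1) * r * (C2 / pnorm t x)"
      using r C2(1) t by (intro mult_right_mono) (auto simp: pnorm_nonneg)
    finally show "norm (heat t f x) \<le> (C1 + 1) * C2 * r / pnorm t x" by (simp add: mult_ac)
  qed
qed

lemma borel_measurable_heat:
  assumes "u0 \<in> borel_measurable lebesgue"
  shows "(\<lambda>p. heat (fst p) u0 (snd p)) \<in> borel_measurable borel"
proof -
  obtain g where g[measurable]: "g \<in> borel_measurable borel" and ae: "AE x in lborel. u0 x = g x"
    using lebesgue_measurable_AE_eq_borel[OF assms] by blast
  have "heat t u0 x = (LINT y|lborel. heat_kernel t (x - y) *\<^sub>R g y)" for t x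
    unfolding heat_def by (rule integral_lebesgue_AE_eq) (measurable, use ae in \<open>eventually_elim, simp\<close>)
  then show ?thesis by simp
qed

section \<open>The heat flow of a tempered distribution\<close>

lemma sqrt_power_int_bounded:
  fixes n :: int
  assumes "0 < a" "a \<le> t" "t \<le> b"
  shows "sqrt t powi n \<le> sqrt a powi n + sqrt b powi n"
proof (cases "0 \<le> n")
  case True
  then have "sqrt t powi n \<le> sqrt b powi n" using assms by (intro power_int_mono) auto
  moreover have "0 \<le> sqrt a powi n" using assms by simp
  ultimately show ?thesis by linarith
next
  case False
  have "sqrt a powi (-n) \<le> sqrt t powi (-n)" using False assms by (intro power_int_mono) auto
  then have "inverse (sqrt t powi (-n)) \<le> inverse (sqrt a powi (-n))"
    using assms by (intro le_imp_inverse_le) auto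
  then have "sqrt t powi n \<le> sqrt a powi n" by (simp add: power_int_minus)
  moreover have "0 \<le> sqrt b powi n" using assms by simp
  ultimately show ?thesis by linarith
qed

text \<open>
On compact sets of \<open>(t, x)\<close> the weight \<open>1 + |y|\<close> is dominated by \<open>\<rho>(t, x - y)\<close>, so that
\<open>heat_class_decay\<close> bounds all Schwartz weights.
\<close>

lemma heat_class_weighted_bound:
  assumes f: "heat_class k f" and a: "0 < a" "0 \<le> M"
  shows "\<exists>C\<ge>0. \<forall>t\<in>{a..b}. \<forall>x\<in>cball 0 M. \<forall>y. (1 + norm y) ^ N * \<bar>f t (x - y)\<bar> \<le> C"
proof -
  obtain C where C: "0 \<le> C" "\<forall>t>0. \<forall>z. \<bar>f t z\<bar> * pnorm t z ^ N \<le> C * sqrt t powi (k + int N)"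
    using heat_class_decay[OF f, of N] by blast
  define c where "c = 1 + (1 + M) / sqrt a"
  have c: "0 \<le> c" using a by (simp add: c_def)
  define B where "B = sqrt a powi (k + int N) + sqrt b powi (k + int N)"
  show ?thesis
  proof (intro exI[of _ "\<bar>c ^ N * (C * B)\<bar>"] conjI ballI allI)
    fix t x y assume t: "t \<in> {a..b}" and x: "x \<in> cball (0::R3) M"
    have t0: "0 < t" using t a by auto
    have "1 + norm y \<le> 1 + M + norm (x - y)"
      using x norm_triangle_ineq4[of x "x - y"] by simp
    also have "1 + M \<le> (1 + M) / sqrt a * sqrt t"
    proof -
      have "1 \<le> sqrt t / sqrt a" using t a by simp
      from mult_left_mono[OF this, of "1 + M"] a show ?thesis by simp
    qed
    also have "(1 + M) / sqrt a * sqrt t + norm (x - y) \<le> c * pnorm t (x - y)"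
      using a t0 by (simp add: c_def pnorm_def algebra_simps)
    finally have "(1 + norm y) ^ N \<le> (c * pnorm t (x - y)) ^ N" by (intro power_mono) auto
    then have "(1 + norm y) ^ N * \<bar>f t (x - y)\<bar> \<le> c ^ N * (\<bar>f t (x - y)\<bar> * pnorm t (x - y) ^ N)"
      using mult_right_mono[of "(1 + norm y) ^ N" "(c * pnorm t (x - y)) ^ N" "\<bar>f t (x - y)\<bar>"]
      by (simp add: power_mult_distrib mult_ac)
    also have "\<dots> \<le> c ^ N * (C * sqrt t powi (k + int N))"
      using C(2) t0 c by (intro mult_left_mono) auto
    also have "\<dots> \<le> c ^ N * (C * B)"
      unfolding B_def using C(1) c t a by (intro mult_left_mono sqrt_power_int_bounded) auto
    finally show "(1 + norm y) ^ N * \<bar>f t (x - y)\<bar> \<le> \<bar>c ^ N * (C * B)\<bar>" by linarith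
  qed simp
qed

text \<open>
The mean value theorem in \<open>t\<close> and along the segment from \<open>x\<close> to \<open>x'\<close>; the derivatives belong to the
class again and are bounded with the same weight.
\<close>

lemma heat_class_weighted_lipschitz:
  assumes f: "heat_class k f" and a: "0 < a" "0 \<le> M"
  shows "\<exists>L\<ge>0. \<forall>t\<in>{a..b}. \<forall>t'\<in>{a..b}. \<forall>x\<in>cball 0 M. \<forall>x'\<in>cball 0 M. \<forall>y.
     (1 + norm y) ^ N * \<bar>f t' (x' - y) - f t (x - y)\<bar> \<le> L * (\<bar>t' - t\<bar> + norm (x' - x))"
proof -
  obtain h where h: "heat_class (k - 2) h" "\<forall>t>0. \<forall>z. ((\<lambda>s. f s z) has_real_derivative h t z) (at t)"
    using heat_class_time_derivative[OF f] by blast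
  obtain A where A: "0 \<le> A" "\<forall>t\<in>{a..b}. \<forall>x\<in>cball 0 M. \<forall>y. (1 + norm y) ^ N * \<bar>h t (x - y)\<bar> \<le> A"
    using heat_class_weighted_bound[OF h(1) a] by blast
  have "\<forall>i. \<exists>C\<ge>0. \<forall>t\<in>{a..b}. \<forall>x\<in>cball 0 M. \<forall>y. (1 + norm y) ^ N * \<bar>partial i (f t) (x - y)\<bar> \<le> C"
    by (intro allI heat_class_weighted_bound[OF heat_class_partial[OF f] a])
  then obtain C where C: "\<forall>i. 0 \<le> C i \<and> (\<forall>t\<in>{a..b}. \<forall>x\<in>cball 0 M. \<forall>y. (1 + norm y) ^ N * \<bar>partial i (f t) (x - y)\<bar> \<le> C i)"
    by (rule choice[THEN exE])
  define L where "L = A + (\<Sum>i\<in>UNIV. C i)"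
  have SC: "0 \<le> (\<Sum>i\<in>UNIV. C i)" using C by (intro sum_nonneg) auto
  show ?thesis
  proof (intro exI[of _ L] conjI ballI allI)
    show "0 \<le> L" using A SC by (simp add: L_def)
    fix t t' x x' and y :: R3
    assume t: "t \<in> {a..b}" "t' \<in> {a..b}" and x: "x \<in> cball (0::R3) M" "x' \<in> cball (0::R3) M"
    define W where "W = (1 + norm y) ^ N"
    have W: "0 \<le> W" by (simp add: W_def)
    have time: "W * \<bar>f s' (x - y) - f s (x - y)\<bar> \<le> A * \<bar>s' - s\<bar>" if "s \<in> {a..b}" "s' \<in> {a..b}" "s < s'" for s s'
    proof -
      have "\<exists>z>s. z < s' \<and> f s' (x - y) - f s (x - y) = (s' - s) * h z (x - y)"
        using that h(2) a by (intro MVT2) auto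
      then obtain z where z: "s < z" "z < s'" "f s' (x - y) - f s (x - y) = (s' - s) * h z (x - y)" by blast
      have "W * \<bar>h z (x - y)\<bar> \<le> A" unfolding W_def using A(2) z that x by auto
      then show ?thesis using that mult_left_mono[of "W * \<bar>h z (x - y)\<bar>" A "s' - s"] by (simp add: z(3) abs_mult mult_ac)
    qed
    have T: "W * \<bar>f t' (x - y) - f t (x - y)\<bar> \<le> A * \<bar>t' - t\<bar>"
      using time[of t t'] time[of t' t] t by (cases t t' rule: linorder_cases) (auto simp: abs_minus_commute)
    have X: "W * \<bar>f t' (x' - y) - f t' (x - y)\<bar> \<le> (\<Sum>i\<in>UNIV. C i) * norm (x' - x)"
    proof -
      obtain r where r: "0 < r" "r < 1" "f t' (x - y + (x' - x)) - f t' (x - y) = (\<Sum>i\<in>UNIV. (x' - x) $ i * partial i (f t') (x - y + r *\<^sub>R (x' - x)))"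
      proof (rule mvt_along_segment[of "f t'" "x - y" "x' - x"])
        show "f t' differentiable (at z)" for z
          using heat_class_differentiable[OF f, of t'] t a by auto
      qed
      have seg: "x + r *\<^sub>R (x' - x) \<in> cball 0 M"
      proof -
        have "(1 - r) *\<^sub>R x + r *\<^sub>R x' \<in> cball 0 M" using x r by (intro convexD[OF convex_cball]) auto
        then show ?thesis by (simp add: algebra_simps)
      qed
      have "W * \<bar>\<Sum>i\<in>UNIV. (x' - x) $ i * partial i (f t') (x - y + r *\<^sub>R (x' - x))\<bar>
         \<le> W * (\<Sum>i\<in>UNIV. \<bar>(x' - x) $ i * partial i (f t') (x - y + r *\<^sub>R (x' - x))\<bar>)"
        using W by (intro mult_left_mono sum_abs)
      also have "\<dots> = (\<Sum>i\<in>UNIV. \<bar>(x' - x) $ i\<bar> * (W * \<bar>partial i (f t') (x + r *\<^sub>R (x' - x) - y)\<bar>))"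
      proof -
        have eq: "x - y + r *\<^sub>R (x' - x) = x + r *\<^sub>R (x' - x) - y" by simp
        show ?thesis unfolding eq sum_distrib_left abs_mult by (simp only: mult.left_commute)
      qed
      also have "\<dots> \<le> (\<Sum>i\<in>UNIV. norm (x' - x) * C i)"
        using C seg t W unfolding W_def by (intro sum_mono mult_mono abs_component_le) auto
      finally show ?thesis using r(3) by (simp add: sum_distrib_right mult.commute)
    qed
    have "W * \<bar>f t' (x' - y) - f t (x - y)\<bar> \<le> W * (\<bar>f t' (x' - y) - f t' (x - y)\<bar> + \<bar>f t' (x - y) - f t (x - y)\<bar>)"
      using W by (intro mult_left_mono) auto
    also have "\<dots> \<le> (\<Sum>i\<in>UNIV. C i) * norm (x' - x) + A * \<bar>t' - t\<bar>" using X T by (simp add: distrib_left)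
    also have "\<dots> \<le> L * (\<bar>t' - t\<bar> + norm (x' - x))"
      using A SC by (simp add: L_def algebra_simps)
    finally show "(1 + norm y) ^ N * \<bar>f t' (x' - y) - f t (x - y)\<bar> \<le> L * (\<bar>t' - t\<bar> + norm (x' - x))" by (simp add: W_def)
  qed
qed

lemma partial_reflect:
  assumes "g differentiable (at (x - y))"
  shows "(\<lambda>y. g (x - y)) differentiable (at y)" "partial i (\<lambda>y. g (x - y)) y = - partial i g (x - y)"
proof -
  have "((\<lambda>y. x - y) has_derivative (\<lambda>v. - v)) (at y)" by (auto intro!: derivative_eq_intros)
  from has_derivative_compose[OF this has_derivative_partial[OF assms]]
  have D: "((\<lambda>y. g (x - y)) has_derivative (\<lambda>v. \<Sum>i\<in>UNIV. (- v) $ i * partial i g (x - y))) (at y)" .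
  then show "(\<lambda>y. g (x - y)) differentiable (at y)" by (rule differentiableI)
  have "(\<Sum>j\<in>UNIV. (- axis i 1) $ j * partial j g (x - y)) = - (\<Sum>j\<in>UNIV. axis i 1 $ j * partial j g (x - y))"
    by (simp add: sum_negf[symmetric])
  then show "partial i (\<lambda>y. g (x - y)) y = - partial i g (x - y)"
    using partial_eq[OF D, of i] by (simp only: partial_sum_axis)
qed

text \<open>
The signs that the reflection \<open>y \<mapsto> x - y\<close> produces are absorbed in \<open>g\<close>.
\<close>

lemma partials_reflected_heat_kernel:
  "\<exists>k g. heat_class k g \<and> (\<forall>t>0. \<forall>x. partials is (\<lambda>y. heat_kernel t (x - y)) = (\<lambda>y. g t (x - y)))"
proof (induction "is")
  case Nil
  show ?case using heat_class.kernel by auto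
next
  case (Cons i "is")
  then obtain k g where g: "heat_class k g" "\<forall>t>0. \<forall>x. partials is (\<lambda>y. heat_kernel t (x - y)) = (\<lambda>y. g t (x - y))"
    by blast
  have "heat_class (k - 1) (\<lambda>t z. (-1) * partial i (g t) z)"
    by (intro heat_class.scale heat_class_partial g)
  moreover have "partials (i # is) (\<lambda>y. heat_kernel t (x - y)) = (\<lambda>y. (-1) * partial i (g t) (x - y))" if "0 < t" for t x
    using g that partial_reflect(2)[OF heat_class_differentiable[OF g(1) that]] by auto
  ultimately show ?case by blast
qed

lemma reflected_heat_kernel_schwartz:
  assumes t: "0 < t"
  shows "(\<lambda>y. heat_kernel t (x - y)) \<in> schwartz"
proof -
  have "partials is (\<lambda>y. heat_kernel t (x - y)) differentiable (at y)" for "is" y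
  proof -
    obtain k g where g: "heat_class k g" "\<forall>t>0. \<forall>x. partials is (\<lambda>y. heat_kernel t (x - y)) = (\<lambda>y. g t (x - y))"
      using partials_reflected_heat_kernel by blast
    then show ?thesis using t partial_reflect(1)[OF heat_class_differentiable[OF g(1) t]] by simp
  qed
  moreover have "bounded (range (\<lambda>y. (1 + norm y) ^ N * partials is (\<lambda>y. heat_kernel t (x - y)) y))" for N "is"
  proof -
    obtain k g where g: "heat_class k g" "\<forall>t>0. \<forall>x. partials is (\<lambda>y. heat_kernel t (x - y)) = (\<lambda>y. g t (x - y))"
      using partials_reflected_heat_kernel by blast
    obtain C where C: "\<forall>s\<in>{t..t}. \<forall>x'\<in>cball 0 (norm x). \<forall>y. (1 + norm y) ^ N * \<bar>g s (x' - y)\<bar> \<le> C"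
      using heat_class_weighted_bound[OF g(1) t, of "norm x" t N] by auto
    have "norm ((1 + norm y) ^ N * partials is (\<lambda>y. heat_kernel t (x - y)) y) \<le> C" for y
      using C g(2) t by (simp add: abs_mult)
    then show ?thesis by (auto simp: bounded_iff intro!: exI[of _ C])
  qed
  ultimately show ?thesis by (simp add: schwartz_def smooth_def)
qed

lemma partials_linear_combination:
  assumes "smooth f" "smooth g"
  shows "partials is (\<lambda>x. a * f x + c * g x) = (\<lambda>x. a * partials is f x + c * partials is g x)"
proof (induction "is")
  case (Cons i "is")
  have "partial i (\<lambda>x. a * partials is f x + c * partials is g x) x
    = a * partial i (partials is f) x + c * partial i (partials is g) x" for x
  proof -
    obtain D E where DE: "(partials is f has_derivative D) (at x)" "(partials is g has_derivative E) (at x)"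
      using assms unfolding smooth_def differentiable_def by blast
    have "((\<lambda>x. a * partials is f x + c * partials is g x) has_derivative (\<lambda>v. a * D v + c * E v)) (at x)"
      by (intro has_derivative_add has_derivative_mult_right DE)
    from partial_eq[OF this, of i] show ?thesis by (simp add: partial_eq[OF DE(1)] partial_eq[OF DE(2)])
  qed
  then show ?case by (simp add: Cons)
qed simp

lemma schwartz_linear_combination:
  assumes f: "f \<in> schwartz" and g: "g \<in> schwartz"
  shows "(\<lambda>x. a * f x + c * g x) \<in> schwartz"
proof -
  have sm: "smooth f" "smooth g" using f g by (auto simp: schwartz_def)
  have "smooth (\<lambda>x. a * f x + c * g x)"
    unfolding smooth_def partials_linear_combination[OF sm]
    using sm by (auto simp: smooth_def intro!: differentiable_add differentiable_mult)
  moreover have "bounded (range (\<lambda>x. (1 + norm x) ^ N * partials is (\<lambda>x. a * f x + c * g x) x))" for N "is"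
  proof -
    obtain A B where AB: "\<And>x. \<bar>(1 + norm x) ^ N * partials is f x\<bar> \<le> A" "\<And>x. \<bar>(1 + norm x) ^ N * partials is g x\<bar> \<le> B"
      using f g unfolding schwartz_def bounded_iff by fastforce
    have "\<bar>(1 + norm x) ^ N * (a * partials is f x + c * partials is g x)\<bar> \<le> \<bar>a\<bar> * A + \<bar>c\<bar> * B" for x
    proof -
      have "\<bar>(1 + norm x) ^ N * (a * partials is f x + c * partials is g x)\<bar>
        = \<bar>a * ((1 + norm x) ^ N * partials is f x) + c * ((1 + norm x) ^ N * partials is g x)\<bar>"
        by (simp add: algebra_simps)
      also have "\<dots> \<le> \<bar>a * ((1 + norm x) ^ N * partials is f x)\<bar> + \<bar>c * ((1 + norm x) ^ N * partials is g x)\<bar>"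
        by (rule abs_triangle_ineq)
      also have "\<dots> \<le> \<bar>a\<bar> * A + \<bar>c\<bar> * B"
        using AB[of x] by (subst (1 2) abs_mult) (intro add_mono mult_left_mono; simp)
      finally show ?thesis .
    qed
    then show ?thesis
      unfolding partials_linear_combination[OF sm] by (auto simp: bounded_iff)
  qed
  ultimately show ?thesis by (simp add: schwartz_def)
qed

text \<open>
The functional is bounded by one Schwartz norm, which involves finitely many partial derivatives.
For each of them \<open>heat_class_weighted_lipschitz\<close> estimates the difference of two heat kernels.
\<close>

lemma heat_distr_locally_lipschitz:
  assumes T: "tempered_distribution T" and a: "0 < a" "0 \<le> M"
  shows "\<exists>L\<ge>0. \<forall>t\<in>{a..b}. \<forall>t'\<in>{a..b}. \<forall>x\<in>cball 0 M. \<forall>x'\<in>cball 0 M.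
     \<bar>heat_distr t' T x' - heat_distr t T x\<bar> \<le> L * (\<bar>t' - t\<bar> + norm (x' - x))"
proof -
  have add: "T (\<lambda>x. \<phi> x + \<psi> x) = T \<phi> + T \<psi>" if "\<phi> \<in> schwartz" "\<psi> \<in> schwartz" for \<phi> \<psi>
    using T that by (simp add: tempered_distribution_def)
  have scale: "T (\<lambda>x. c * \<phi> x) = c * T \<phi>" if "\<phi> \<in> schwartz" for \<phi> c
    using T that by (simp add: tempered_distribution_def)
  obtain C N where C: "\<forall>\<phi>\<in>schwartz. \<bar>T \<phi>\<bar> \<le> C * schwartz_norm N \<phi>"
    using T by (auto simp: tempered_distribution_def)
  have "\<forall>is. \<exists>L\<ge>0. \<forall>t\<in>{a..b}. \<forall>t'\<in>{a..b}. \<forall>x\<in>cball 0 M. \<forall>x'\<in>cball 0 M. \<forall>y.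
     (1 + norm y) ^ N * \<bar>partials is (\<lambda>y. heat_kernel t' (x' - y)) y - partials is (\<lambda>y. heat_kernel t (x - y)) y\<bar>
       \<le> L * (\<bar>t' - t\<bar> + norm (x' - x))"
  proof
    fix "is" :: "3 list"
    obtain k g where g: "heat_class k g" "\<forall>t>0. \<forall>x. partials is (\<lambda>y. heat_kernel t (x - y)) = (\<lambda>y. g t (x - y))"
      using partials_reflected_heat_kernel by blast
    show "\<exists>L\<ge>0. \<forall>t\<in>{a..b}. \<forall>t'\<in>{a..b}. \<forall>x\<in>cball 0 M. \<forall>x'\<in>cball 0 M. \<forall>y.
       (1 + norm y) ^ N * \<bar>partials is (\<lambda>y. heat_kernel t' (x' - y)) y - partials is (\<lambda>y. heat_kernel t (x - y)) y\<bar>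
         \<le> L * (\<bar>t' - t\<bar> + norm (x' - x))"
      using heat_class_weighted_lipschitz[OF g(1) a, of b N] g(2) a(1) by auto
  qed
  then obtain L where L: "\<forall>is. 0 \<le> L is \<and> (\<forall>t\<in>{a..b}. \<forall>t'\<in>{a..b}. \<forall>x\<in>cball 0 M. \<forall>x'\<in>cball 0 M. \<forall>y.
     (1 + norm y) ^ N * \<bar>partials is (\<lambda>y. heat_kernel t' (x' - y)) y - partials is (\<lambda>y. heat_kernel t (x - y)) y\<bar>
       \<le> L is * (\<bar>t' - t\<bar> + norm (x' - x)))"
    by (rule choice[THEN exE])
  define I where "I = {is :: 3 list. length is \<le> N}"
  have fin: "finite I" using finite_lists_length_le[of "UNIV :: 3 set" N] by (simp add: I_def)
  define K where "K = (\<Sum>is\<in>I. L is)"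
  have LK: "L is \<le> K" if "is \<in> I" for "is" unfolding K_def using L fin that by (intro member_le_sum) auto
  have K: "0 \<le> K" unfolding K_def using L by (intro sum_nonneg) auto
  show ?thesis
  proof (intro exI[of _ "\<bar>C\<bar> * K"] conjI ballI)
    show "0 \<le> \<bar>C\<bar> * K" using K by simp
    fix t t' x x' assume t: "t \<in> {a..b}" "t' \<in> {a..b}" and x: "x \<in> cball (0::R3) M" "x' \<in> cball (0::R3) M"
    define d where "d = \<bar>t' - t\<bar> + norm (x' - x)"
    have d: "0 \<le> d" by (simp add: d_def)
    define \<phi> \<phi>' where "\<phi> = (\<lambda>y. heat_kernel t (x - y))" and "\<phi>' = (\<lambda>y. heat_kernel t' (x' - y))"
    have S: "\<phi> \<in> schwartz" "\<phi>' \<in> schwartz"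
      using reflected_heat_kernel_schwartz t a by (auto simp: \<phi>_def \<phi>'_def)
    have sm: "smooth \<phi>" "smooth \<phi>'" using S by (auto simp: schwartz_def)
    define \<psi> where "\<psi> = (\<lambda>y. 1 * \<phi>' y + (-1) * \<phi> y)"
    have \<psi>: "\<psi> \<in> schwartz" unfolding \<psi>_def by (rule schwartz_linear_combination[OF S(2,1)])
    have "T \<psi> = T \<phi>' - T \<phi>"
    proof -
      have "(\<lambda>y. (-1) * \<phi> y) \<in> schwartz" using schwartz_linear_combination[OF S(1) S(1), of "-1" 0] by simp
      from add[OF S(2) this] scale[OF S(1), of "-1"] show ?thesis by (simp add: \<psi>_def)
    qed
    have el: "(1 + norm y) ^ N * \<bar>partials is \<psi> y\<bar> \<le> K * d" if "is \<in> I" for "is" y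
    proof -
      have "(1 + norm y) ^ N * \<bar>partials is \<psi> y\<bar> \<le> L is * d"
        unfolding \<psi>_def partials_linear_combination[OF sm(2,1)] unfolding d_def \<phi>_def \<phi>'_def
        using L t x by simp
      also have "\<dots> \<le> K * d" using LK[OF that] d by (rule mult_right_mono)
      finally show ?thesis .
    qed
    let ?h = "\<lambda>(is, y). (1 + norm y) ^ N * \<bar>partials is \<psi> y\<bar>"
    \<comment> \<open>the sign of \<open>C\<close> is unknown, so that the norm is estimated from below as well\<close>
    have ne: "([], 0) \<in> I \<times> (UNIV :: R3 set)" by (simp add: I_def)
    have up: "schwartz_norm N \<psi> \<le> K * d"
      unfolding schwartz_norm_def I_def[symmetric] using ne el by (intro cSUP_least) auto
    have "bdd_above (?h ` (I \<times> UNIV))" using el by (intro bdd_aboveI[of _ "K * d"]) auto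
    from cSUP_upper[OF ne this] have "?h ([], 0) \<le> schwartz_norm N \<psi>"
      unfolding schwartz_norm_def I_def[symmetric] .
    moreover have "0 \<le> ?h ([], 0)" by simp
    ultimately have lo: "0 \<le> schwartz_norm N \<psi>" by linarith
    have "\<bar>T \<psi>\<bar> \<le> C * schwartz_norm N \<psi>" using C \<psi> by blast
    also have "\<dots> \<le> \<bar>C\<bar> * schwartz_norm N \<psi>" using lo by (intro mult_right_mono) auto
    also have "\<dots> \<le> \<bar>C\<bar> * (K * d)" using up by (intro mult_left_mono) auto
    finally show "\<bar>heat_distr t' T x' - heat_distr t T x\<bar> \<le> \<bar>C\<bar> * K * (\<bar>t' - t\<bar> + norm (x' - x))"
      using \<open>T \<psi> = T \<phi>' - T \<phi>\<close> by (simp add: heat_distr_def \<phi>_def \<phi>'_def d_def mult.assoc)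
  qed
qed

lemma continuous_on_heat_distr:
  assumes T: "tempered_distribution T"
  shows "continuous_on ({0<..} \<times> UNIV) (\<lambda>p. heat_distr (fst p) T (snd p))"
  unfolding continuous_on_eq_continuous_at[OF open_Times[OF open_greaterThan open_UNIV]]
proof
  fix p :: "real \<times> R3" assume "p \<in> {0<..} \<times> UNIV"
  then obtain t x where p: "p = (t, x)" and t: "0 < t" by auto
  have "0 < t / 2" "0 \<le> norm x + 1" using t by auto
  from heat_distr_locally_lipschitz[OF T this, of "2 * t"]
  obtain L where L: "0 \<le> L" "\<forall>s\<in>{t / 2..2 * t}. \<forall>s'\<in>{t / 2..2 * t}. \<forall>z\<in>cball 0 (norm x + 1). \<forall>z'\<in>cball 0 (norm x + 1).
     \<bar>heat_distr s' T z' - heat_distr s T z\<bar> \<le> L * (\<bar>s' - s\<bar> + norm (z' - z))"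
    by blast
  have lim: "((\<lambda>q. L * (\<bar>fst q - t\<bar> + norm (snd q - x))) \<longlongrightarrow> 0) (at p)"
  proof -
    have "((\<lambda>q. L * (\<bar>fst q - t\<bar> + norm (snd q - x))) \<longlongrightarrow> L * (\<bar>fst p - t\<bar> + norm (snd p - x))) (at p)"
      by (intro tendsto_intros)
    then show ?thesis by (simp add: p)
  qed
  have ev: "\<forall>\<^sub>F q in at p. norm (heat_distr (fst q) T (snd q) - heat_distr t T x) \<le> L * (\<bar>fst q - t\<bar> + norm (snd q - x))"
  proof -
    have "\<forall>\<^sub>F q in at p. dist q p < min (t / 2) 1" 
      using t unfolding eventually_at
      by (intro exI[of _ "min (t / 2) 1"]) auto
    then show ?thesis
    proof eventually_elim
      case (elim q)
      have "\<bar>fst q - t\<bar> < t / 2" "norm (snd q - x) < 1"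
        using elim dist_fst_le[of q p] dist_snd_le[of q p] by (auto simp: p dist_real_def dist_norm)
      then have "t / 2 \<le> fst q" "fst q \<le> 2 * t" "norm (snd q) \<le> norm x + 1"
        using norm_triangle_ineq2[of "snd q" x] t by linarith+
      then have "fst q \<in> {t / 2..2 * t}" "snd q \<in> cball 0 (norm x + 1)" by auto
      moreover have "t \<in> {t / 2..2 * t}" "x \<in> cball 0 (norm x + 1)" using t by auto
      ultimately show ?case using L(2) unfolding real_norm_def by blast
    qed
  qed
  have "((\<lambda>q. heat_distr (fst q) T (snd q) - heat_distr t T x) \<longlongrightarrow> 0) (at p)"
    by (rule Lim_null_comparison[OF ev lim])
  then show "isCont (\<lambda>p. heat_distr (fst p) T (snd p)) p"
    by (simp add: isCont_def p Lim_null[symmetric])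
qed

lemma borel_measurable_heat_distr:
  assumes T: "tempered_distribution T"
  shows "(\<lambda>p. indicator {0<..} (fst p) * heat_distr (fst p) T (snd p)) \<in> borel_measurable borel"
proof -
  have "(\<lambda>p. indicator ({0<..} \<times> UNIV) p *\<^sub>R heat_distr (fst p) T (snd p)) \<in> borel_measurable borel"
    by (intro borel_measurable_continuous_on_indicator continuous_on_heat_distr T)
       (auto intro!: borel_open open_Times)
  then show ?thesis by (simp add: indicator_times)
qed

lemma borel_measurable_heat_leray_kernel [measurable]:
  "(\<lambda>p. heat_leray_kernel (fst p) (snd p)) \<in> borel_measurable borel"
proof (intro borel_measurable_vecI)
  fix j k
  let ?S = "\<lambda>q::(real \<times> R3) \<times> R3. cis (snd (fst q) \<bullet> snd q) *
     complex_of_real (exp (- fst (fst q) * (norm (snd q))\<^sup>2) * ((if j = k then 1 else 0) - snd q $ j * snd q $ k / (norm (snd q))\<^sup>2))"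
  have cis: "cis \<in> borel_measurable borel"
    by (intro borel_measurable_continuous_onI continuous_intros)
  have [measurable]: "(\<lambda>q::(real \<times> R3) \<times> R3. cis (snd (fst q) \<bullet> snd q)) \<in> borel_measurable (borel \<Otimes>\<^sub>M lborel)"
    by (rule measurable_compose[OF _ cis]) measurable
  have S: "?S \<in> borel_measurable (borel \<Otimes>\<^sub>M lborel)" by measurable
  have eq: "heat_leray_kernel (fst p) (snd p) $ j $ k = Re (LINT \<xi>|lborel. ?S (p, \<xi>)) / (2 * pi) ^ 3" for p
  proof -
    have "(\<lambda>\<xi>. ?S (p, \<xi>)) \<in> borel_measurable lborel"
      by (rule measurable_compose[OF _ S]) measurable
    then have "integral\<^sup>L lebesgue (\<lambda>\<xi>. ?S (p, \<xi>)) = (LINT \<xi>|lborel. ?S (p, \<xi>))" by (rule integral_completion)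
    then show ?thesis by (simp add: heat_leray_kernel_def leray_symbol_def)
  qed
  have "(\<lambda>p. LINT \<xi>|lborel. ?S (p, \<xi>)) \<in> borel_measurable borel"
    by (rule lborel.borel_measurable_lebesgue_integral) (use S in \<open>simp add: case_prod_unfold\<close>)
  then show "(\<lambda>p. heat_leray_kernel (fst p) (snd p) $ j $ k) \<in> borel_measurable borel"
    unfolding eq by (intro borel_measurable_divide borel_measurable_Re) auto
qed

lemma borel_measurable_heat_leray_distr:
  assumes T: "tempered_distribution T"
  shows "(\<lambda>p. indicator {0<..} (fst p) *\<^sub>R heat_leray_distr (fst p) T (snd p)) \<in> borel_measurable borel"
proof -
  let ?H = "\<lambda>q::(real \<times> R3) \<times> R3. heat_leray_kernel (fst (fst q) / 2) (snd (fst q) - snd q) *v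
      ((indicator {0<..} (fst (fst q) / 2) * heat_distr (fst (fst q) / 2) T (snd q)) *\<^sub>R e3)"
  have K: "(\<lambda>q::(real \<times> R3) \<times> R3. heat_leray_kernel (fst (fst q) / 2) (snd (fst q) - snd q)) \<in> borel_measurable (borel \<Otimes>\<^sub>M lborel)"
    using measurable_compose[OF _ borel_measurable_heat_leray_kernel, of "\<lambda>q::(real \<times> R3) \<times> R3. (fst (fst q) / 2, snd (fst q) - snd q)" "borel \<Otimes>\<^sub>M lborel"]
    by simp
  have D[measurable]: "(\<lambda>q::(real \<times> R3) \<times> R3. indicator {0<..} (fst (fst q) / 2) * heat_distr (fst (fst q) / 2) T (snd q)) \<in> borel_measurable (borel \<Otimes>\<^sub>M lborel)"
    using measurable_compose[OF _ borel_measurable_heat_distr[OF T], of "\<lambda>q::(real \<times> R3) \<times> R3. (fst (fst q) / 2, snd q)" "borel \<Otimes>\<^sub>M lborel"]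
    by simp
  have H: "?H \<in> borel_measurable (borel \<Otimes>\<^sub>M lborel)"
  proof (rule borel_measurable_vecI)
    fix i
    show "(\<lambda>q. ?H q $ i) \<in> borel_measurable (borel \<Otimes>\<^sub>M lborel)"
      unfolding matrix_vector_mult_def using K by simp
  qed
  have "(\<lambda>p. indicator {0<..} (fst p) *\<^sub>R (LINT y|lborel. ?H (p, y))) \<in> borel_measurable borel"
    by (intro borel_measurable_scaleR lborel.borel_measurable_lebesgue_integral) (use H in \<open>auto simp: case_prod_unfold\<close>)
  moreover have "indicator {0<..} (fst p) *\<^sub>R heat_leray_distr (fst p) T (snd p) = indicator {0<..} (fst p) *\<^sub>R (LINT y|lborel. ?H (p, y))" for p
  proof (cases "0 < fst p")
    case True
    have "(\<lambda>y. ?H (p, y)) \<in> borel_measurable lborel" by (rule measurable_compose[OF _ H]) measurable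
    then have "(LINT y|lebesgue. ?H (p, y)) = (LINT y|lborel. ?H (p, y))" by (rule integral_completion)
    then show ?thesis using True by (simp add: heat_leray_distr_def heat_leray_def)
  qed simp
  ultimately show ?thesis by (simp only:)
qed

section \<open>Duhamel integrals with parabolic kernels\<close>

text \<open>
The operators \<open>N \<tau> z\<close> stand for a convolution kernel that acts linearly on the values of the field.
Only positive times matter, which explains the indicator function in the measurability condition.
\<close>

definition parabolic_kernel :: "nat \<Rightarrow> (real \<Rightarrow> R3 \<Rightarrow> 'v::euclidean_space \<Rightarrow> 'w::euclidean_space) \<Rightarrow> bool"
  where "parabolic_kernel a N \<longleftrightarrow>
    (\<forall>\<tau>>0. \<forall>z. linear (N \<tau> z)) \<and>
    (\<exists>A. \<forall>\<tau>>0. \<forall>z v. norm (N \<tau> z v) \<le> A / pnorm \<tau> z ^ a * norm v) \<and>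
    (\<lambda>p. indicator {0<..} (fst p) *\<^sub>R N (fst p) (fst (snd p)) (snd (snd p))) \<in> borel_measurable borel"

definition duhamel :: "(real \<Rightarrow> R3 \<Rightarrow> 'v::euclidean_space \<Rightarrow> 'w::euclidean_space) \<Rightarrow> (real \<Rightarrow> R3 \<Rightarrow> 'v) \<Rightarrow> real \<Rightarrow> R3 \<Rightarrow> 'w"
  where "duhamel N F t x = (LINT s:{0<..<t}|lebesgue. LINT y|lebesgue. N (t - s) (x - y) (F s y))"

definition borel_positive_times :: "(real \<Rightarrow> R3 \<Rightarrow> 'v::euclidean_space) \<Rightarrow> bool"
  where "borel_positive_times F \<longleftrightarrow> (\<lambda>p. indicator {0<..} (fst p) *\<^sub>R F (fst p) (snd p)) \<in> borel_measurable borel"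

lemma duhamel_integrand_measurable:
  assumes N: "parabolic_kernel a N" and F: "borel_positive_times F"
    and [measurable]: "T \<in> borel_measurable M" "X \<in> borel_measurable M" "S \<in> borel_measurable M" "Y \<in> borel_measurable M"
  shows "(\<lambda>m. indicator {0<..<T m} (S m) *\<^sub>R N (T m - S m) (X m - Y m) (F (S m) (Y m))) \<in> borel_measurable M"
proof -
  let ?N = "\<lambda>p. indicator {0<..} (fst p) *\<^sub>R N (fst p) (fst (snd p)) (snd (snd p))"
  let ?F = "\<lambda>p. indicator {0<..} (fst p) *\<^sub>R F (fst p) (snd p)"
  have "?F \<in> borel_measurable borel" using F by (simp add: borel_positive_times_def)
  from measurable_compose[OF _ this, of "\<lambda>m. (S m, Y m)" M]
  have [measurable]: "(\<lambda>m. ?F (S m, Y m)) \<in> borel_measurable M" by simp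
  have "?N \<in> borel_measurable borel" using N by (simp add: parabolic_kernel_def)
  moreover have "(\<lambda>m. (T m - S m, X m - Y m, ?F (S m, Y m))) \<in> borel_measurable M" by measurable
  ultimately have [measurable]: "(\<lambda>m. ?N (T m - S m, X m - Y m, ?F (S m, Y m))) \<in> borel_measurable M"
    using measurable_compose by blast
  have "(\<lambda>m. indicator {0<..} (S m) *\<^sub>R ?N (T m - S m, X m - Y m, ?F (S m, Y m))) \<in> borel_measurable M"
    by measurable
  moreover have "indicator {0<..} (S m) *\<^sub>R ?N (T m - S m, X m - Y m, ?F (S m, Y m))
     = indicator {0<..<T m} (S m) *\<^sub>R N (T m - S m) (X m - Y m) (F (S m) (Y m))" for m
    by (auto simp: indicator_def)
  ultimately show ?thesis by (simp only:)
qed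

text \<open>
If \<open>F\<close> and \<open>F'\<close> agree almost everywhere in space-time, then for almost every \<open>s\<close> they agree for almost
every \<open>y\<close>; hence the iterated integral does not change.
\<close>

lemma duhamel_eq_borel:
  assumes N: "parabolic_kernel a N" and F': "borel_positive_times F'"
    and ae: "AE p in lborel. 0 < fst p \<longrightarrow> F (fst p) (snd p) = F' (fst p) (snd p)"
  shows "duhamel N F t x = (LINT s|lborel. LINT y|lborel. indicator {0<..<t} s *\<^sub>R N (t - s) (x - y) (F' s y))"
proof -
  let ?H = "\<lambda>p. indicator {0<..<t} (fst p) *\<^sub>R N (t - fst p) (x - snd p) (F' (fst p) (snd p))"
  have H: "?H \<in> borel_measurable (lborel \<Otimes>\<^sub>M lborel)"
    by (rule duhamel_integrand_measurable[OF N F']) auto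
  have ae2: "AE s in lborel. AE y in lborel. 0 < s \<longrightarrow> F s y = F' s y"
    using lborel_pair.AE_pair[OF ae[folded lborel_prod]] by simp
  have inner: "AE s in lborel. indicator {0<..<t} s *\<^sub>R (LINT y|lebesgue. N (t - s) (x - y) (F s y))
      = (LINT y|lborel. ?H (s, y))"
    using ae2
  proof eventually_elim
    case (elim s)
    show ?case
    proof (cases "s \<in> {0<..<t}")
      case True
      have "(LINT y|lebesgue. N (t - s) (x - y) (F s y)) = (LINT y|lborel. ?H (s, y))"
      proof (rule integral_lebesgue_AE_eq)
        show "(\<lambda>y. ?H (s, y)) \<in> borel_measurable borel"
          using measurable_compose[OF _ H, of "\<lambda>y. (s, y)" borel] by simp
        show "AE y in lborel. N (t - s) (x - y) (F s y) = ?H (s, y)"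
          using elim by eventually_elim (use True in auto)
      qed
      then show ?thesis using True by simp
    qed simp
  qed
  have "duhamel N F t x = (LINT s|lborel. LINT y|lborel. ?H (s, y))"
    unfolding duhamel_def set_lebesgue_integral_def
  proof (rule integral_lebesgue_AE_eq[OF _ inner])
    show "(\<lambda>s. LINT y|lborel. ?H (s, y)) \<in> borel_measurable borel"
      using lborel.borel_measurable_lebesgue_integral[of "\<lambda>s y. ?H (s, y)" lborel] H
      by (simp add: case_prod_unfold)
  qed
  then show ?thesis by simp
qed

text \<open>
Integrals depending on a parameter are Borel functions of the parameter, whether or not they converge.
\<close>

lemma borel_measurable_duhamel:
  assumes N: "parabolic_kernel a N" and F: "borel_positive_times F"
  shows "(\<lambda>p. duhamel N F (fst p) (snd p)) \<in> borel_measurable borel"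
proof -
  let ?H = "\<lambda>q::((real \<times> R3) \<times> real) \<times> R3. indicator {0<..<fst (fst (fst q))} (snd (fst q)) *\<^sub>R
     N (fst (fst (fst q)) - snd (fst q)) (snd (fst (fst q)) - snd q) (F (snd (fst q)) (snd q))"
  have H: "?H \<in> borel_measurable ((borel \<Otimes>\<^sub>M lborel) \<Otimes>\<^sub>M lborel)"
    by (rule duhamel_integrand_measurable[OF N F]) auto
  have "(\<lambda>r. LINT y|lborel. ?H (r, y)) \<in> borel_measurable (borel \<Otimes>\<^sub>M lborel)"
    using H by (intro lborel.borel_measurable_lebesgue_integral) (simp add: case_prod_unfold)
  then have "(\<lambda>p. LINT s|lborel. LINT y|lborel. ?H ((p, s), y)) \<in> borel_measurable borel"
    by (intro lborel.borel_measurable_lebesgue_integral) (simp add: case_prod_unfold)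
  moreover have "duhamel N F (fst p) (snd p) = (LINT s|lborel. LINT y|lborel. ?H ((p, s), y))" for p
    using duhamel_eq_borel[OF N F, of F "fst p" "snd p"] by simp
  ultimately show ?thesis by simp
qed

text \<open>
The constant must be independent of the field; it depends on the kernel and on \<open>b\<close> alone.
\<close>

lemma nn_integral_duhamel_integrand_le:
  assumes N: "parabolic_kernel a N" and ab: "a < 5" "b < 5" "5 < a + b"
  shows "\<exists>C>0. \<forall>F M. 0 \<le> M \<longrightarrow> (\<forall>s>0. \<forall>y. norm (F s y) \<le> M / pnorm s y ^ b) \<longrightarrow> (\<forall>t>0. \<forall>x.
     (\<integral>\<^sup>+s. \<integral>\<^sup>+y. indicator {0<..<t} s * ennreal (norm (N (t - s) (x - y) (F s y))) \<partial>lborel \<partial>lborel)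
     \<le> ennreal (C * M / pnorm t x ^ (a + b - 5)))"
proof -
  obtain A0 where A0: "\<forall>\<tau>>0. \<forall>z v. norm (N \<tau> z v) \<le> A0 / pnorm \<tau> z ^ a * norm v"
    using N by (auto simp: parabolic_kernel_def)
  define A where "A = \<bar>A0\<bar> + 1"
  have A: "0 < A" by (simp add: A_def)
  obtain C where C: "0 < C" "\<forall>t>0. \<forall>x. (\<integral>\<^sup>+s. \<integral>\<^sup>+y. indicator {0<..<t} s *
      ennreal (1 / (pnorm (t - s) (x - y) ^ a * pnorm s y ^ b)) \<partial>lborel \<partial>lborel)
    \<le> ennreal (C / pnorm t x ^ (a + b - 5))"
    using parabolic_convolution[OF ab] by blast
  show ?thesis
  proof (intro exI[of _ "A * C"] conjI allI impI)
    show "0 < A * C" using A C by simp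
    fix F :: "real \<Rightarrow> R3 \<Rightarrow> 'a" and M t :: real and x :: R3
    assume M: "0 \<le> M" and F: "\<forall>s>0. \<forall>y. norm (F s y) \<le> M / pnorm s y ^ b" and t: "0 < t"
    let ?w = "\<lambda>s y. indicator {0<..<t} s * ennreal (1 / (pnorm (t - s) (x - y) ^ a * pnorm s y ^ b))"
    have le: "indicator {0<..<t} s * ennreal (norm (N (t - s) (x - y) (F s y))) \<le> ennreal (A * M) * ?w s y" for s y
    proof (cases "s \<in> {0<..<t}")
      case True
      have p: "0 < pnorm (t - s) (x - y)" using True by (intro pnorm_pos) auto
      have "norm (N (t - s) (x - y) (F s y)) \<le> A0 / pnorm (t - s) (x - y) ^ a * norm (F s y)"
        using A0 True by auto
      also have "\<dots> \<le> A / pnorm (t - s) (x - y) ^ a * norm (F s y)"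
        using p by (intro mult_right_mono divide_right_mono) (auto simp: A_def)
      also have "\<dots> \<le> A / pnorm (t - s) (x - y) ^ a * (M / pnorm s y ^ b)"
        using F True p A by (intro mult_left_mono) auto
      also have "\<dots> = A * M * (1 / (pnorm (t - s) (x - y) ^ a * pnorm s y ^ b))" by simp
      finally show ?thesis using True A M by (simp add: ennreal_mult'[symmetric] ennreal_leI)
    qed simp
    have "(\<integral>\<^sup>+s. \<integral>\<^sup>+y. indicator {0<..<t} s * ennreal (norm (N (t - s) (x - y) (F s y))) \<partial>lborel \<partial>lborel)
      \<le> (\<integral>\<^sup>+s. \<integral>\<^sup>+y. ennreal (A * M) * ?w s y \<partial>lborel \<partial>lborel)"
      by (intro nn_integral_mono le)
    also have "\<dots> = (\<integral>\<^sup>+s. ennreal (A * M) * (\<integral>\<^sup>+y. ?w s y \<partial>lborel) \<partial>lborel)"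
      by (intro nn_integral_cong nn_integral_cmult) measurable
    also have "\<dots> = ennreal (A * M) * (\<integral>\<^sup>+s. \<integral>\<^sup>+y. ?w s y \<partial>lborel \<partial>lborel)"
      by (rule nn_integral_cmult) measurable
    also have "\<dots> \<le> ennreal (A * M) * ennreal (C / pnorm t x ^ (a + b - 5))"
      using C(2) t by (intro mult_left_mono) auto
    also have "\<dots> = ennreal (A * C * M / pnorm t x ^ (a + b - 5))"
      using A M by (subst ennreal_mult'[symmetric]) (auto simp: mult_ac)
    finally show "(\<integral>\<^sup>+s. \<integral>\<^sup>+y. indicator {0<..<t} s * ennreal (norm (N (t - s) (x - y) (F s y))) \<partial>lborel \<partial>lborel)
      \<le> ennreal (A * C * M / pnorm t x ^ (a + b - 5))" .
  qed
qed

lemma norm_duhamel_le: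
  assumes N: "parabolic_kernel a N" and ab: "a < 5" "b < 5" "5 < a + b"
  shows "\<exists>C>0. \<forall>F M. 0 \<le> M \<longrightarrow> (\<forall>s>0. \<forall>y. norm (F s y) \<le> M / pnorm s y ^ b) \<longrightarrow>
     (\<forall>t>0. \<forall>x. norm (duhamel N F t x) \<le> C * M / pnorm t x ^ (a + b - 5))"
proof -
  obtain C where C: "0 < C" "\<forall>F M. 0 \<le> M \<longrightarrow> (\<forall>s>0. \<forall>y. norm (F s y) \<le> M / pnorm s y ^ b) \<longrightarrow> (\<forall>t>0. \<forall>x.
     (\<integral>\<^sup>+s. \<integral>\<^sup>+y. indicator {0<..<t} s * ennreal (norm (N (t - s) (x - y) (F s y))) \<partial>lborel \<partial>lborel)
     \<le> ennreal (C * M / pnorm t x ^ (a + b - 5)))"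
    using nn_integral_duhamel_integrand_le[OF N ab] by blast
  show ?thesis
  proof (intro exI[of _ C] conjI allI impI C(1))
    fix F :: "real \<Rightarrow> R3 \<Rightarrow> 'a" and M t :: real and x :: R3
    assume M: "0 \<le> M" and F: "\<forall>s>0. \<forall>y. norm (F s y) \<le> M / pnorm s y ^ b" and t: "0 < t"
    have "ennreal (norm (duhamel N F t x))
      \<le> (\<integral>\<^sup>+s. ennreal (norm (indicator {0<..<t} s *\<^sub>R (LINT y|lebesgue. N (t - s) (x - y) (F s y)))) \<partial>lborel)"
      unfolding duhamel_def set_lebesgue_integral_def nn_integral_completion[of lborel, symmetric]
      by (rule norm_integral_le_nn_integral)
    also have "\<dots> \<le> (\<integral>\<^sup>+s. \<integral>\<^sup>+y. indicator {0<..<t} s * ennreal (norm (N (t - s) (x - y) (F s y))) \<partial>lborel \<partial>lborel)"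
    proof (rule nn_integral_mono)
      fix s :: real
      have "ennreal (norm (LINT y|lebesgue. N (t - s) (x - y) (F s y))) \<le> (\<integral>\<^sup>+y. ennreal (norm (N (t - s) (x - y) (F s y))) \<partial>lborel)"
        unfolding nn_integral_completion[of lborel, symmetric] by (rule norm_integral_le_nn_integral)
      then show "ennreal (norm (indicator {0<..<t} s *\<^sub>R (LINT y|lebesgue. N (t - s) (x - y) (F s y))))
        \<le> (\<integral>\<^sup>+y. indicator {0<..<t} s * ennreal (norm (N (t - s) (x - y) (F s y))) \<partial>lborel)"
        by (auto simp: indicator_def)
    qed
    also have "\<dots> \<le> ennreal (C * M / pnorm t x ^ (a + b - 5))" using C(2) M F t by blast
    finally show "norm (duhamel N F t x) \<le> C * M / pnorm t x ^ (a + b - 5)"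
      using C(1) M t by (subst (asm) ennreal_le_iff) (auto simp: pnorm_nonneg)
  qed
qed

text \<open>
For a Borel field the bound makes the integrand integrable over space-time; hence the iterated
integral is a single one, and linear in the field.
\<close>

lemma duhamel_integrable:
  assumes N: "parabolic_kernel a N" and ab: "a < 5" "b < 5" "5 < a + b"
    and F: "borel_positive_times F" "0 \<le> M" "\<forall>s>0. \<forall>y. norm (F s y) \<le> M / pnorm s y ^ b" and t: "0 < t"
  shows "integrable (lborel \<Otimes>\<^sub>M lborel) (\<lambda>p. indicator {0<..<t} (fst p) *\<^sub>R N (t - fst p) (x - snd p) (F (fst p) (snd p)))" (is "integrable _ ?H")
    and "duhamel N F t x = (LINT p|(lborel \<Otimes>\<^sub>M lborel). indicator {0<..<t} (fst p) *\<^sub>R N (t - fst p) (x - snd p) (F (fst p) (snd p)))"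
proof -
  have H[measurable]: "?H \<in> borel_measurable (lborel \<Otimes>\<^sub>M lborel)"
    by (rule duhamel_integrand_measurable[OF N F(1)]) auto
  show int: "integrable (lborel \<Otimes>\<^sub>M lborel) ?H"
  proof (rule integrableI_bounded[OF H])
    obtain C where C: "0 < C" "\<forall>F M. 0 \<le> M \<longrightarrow> (\<forall>s>0. \<forall>y. norm (F s y) \<le> M / pnorm s y ^ b) \<longrightarrow> (\<forall>t>0. \<forall>x.
     (\<integral>\<^sup>+s. \<integral>\<^sup>+y. indicator {0<..<t} s * ennreal (norm (N (t - s) (x - y) (F s y))) \<partial>lborel \<partial>lborel)
     \<le> ennreal (C * M / pnorm t x ^ (a + b - 5)))"
      using nn_integral_duhamel_integrand_le[OF N ab] by blast
    have "(\<integral>\<^sup>+p. ennreal (norm (?H p)) \<partial>(lborel \<Otimes>\<^sub>M lborel)) = (\<integral>\<^sup>+s. \<integral>\<^sup>+y. ennreal (norm (?H (s, y))) \<partial>lborel \<partial>lborel)"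
      by (rule lborel.nn_integral_fst[symmetric]) measurable
    also have "\<dots> = (\<integral>\<^sup>+s. \<integral>\<^sup>+y. indicator {0<..<t} s * ennreal (norm (N (t - s) (x - y) (F s y))) \<partial>lborel \<partial>lborel)"
      by (intro nn_integral_cong) (auto simp: indicator_def)
    also have "\<dots> \<le> ennreal (C * M / pnorm t x ^ (a + b - 5))" using C(2) F(2,3) t by blast
    also have "\<dots> < \<infinity>" by simp
    finally show "(\<integral>\<^sup>+p. ennreal (norm (?H p)) \<partial>(lborel \<Otimes>\<^sub>M lborel)) < \<infinity>" .
  qed
  have "duhamel N F t x = (LINT s|lborel. LINT y|lborel. ?H (s, y))"
    using duhamel_eq_borel[OF N F(1), of F t x] by simp
  also have "\<dots> = integral\<^sup>L (lborel \<Otimes>\<^sub>M lborel) ?H" by (rule lborel_pair.integral_fst'[OF int])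
  finally show "duhamel N F t x = integral\<^sup>L (lborel \<Otimes>\<^sub>M lborel) ?H" .
qed

lemma borel_positive_times_diff:
  assumes "borel_positive_times F" "borel_positive_times G"
  shows "borel_positive_times (\<lambda>s y. F s y - G s y)"
  using borel_measurable_diff[OF assms[unfolded borel_positive_times_def]]
  by (simp add: borel_positive_times_def scaleR_diff_right)

lemma duhamel_diff:
  assumes N: "parabolic_kernel a N" and ab: "a < 5" "b < 5" "5 < a + b"
    and F: "borel_positive_times F" "0 \<le> M" "\<forall>s>0. \<forall>y. norm (F s y) \<le> M / pnorm s y ^ b"
    and G: "borel_positive_times G" "\<forall>s>0. \<forall>y. norm (G s y) \<le> M / pnorm s y ^ b" and t: "0 < t"
  shows "duhamel N F t x - duhamel N G t x = duhamel N (\<lambda>s y. F s y - G s y) t x"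
proof -
  have FG: "\<forall>s>0. \<forall>y. norm (F s y - G s y) \<le> (2 * M) / pnorm s y ^ b"
  proof (intro allI impI)
    fix s y assume "(0::real) < s"
    then have "norm (F s y) + norm (G s y) \<le> M / pnorm s y ^ b + M / pnorm s y ^ b"
      using F G by (intro add_mono) auto
    then show "norm (F s y - G s y) \<le> (2 * M) / pnorm s y ^ b"
      using norm_triangle_ineq4[of "F s y" "G s y"] by linarith
  qed
  note I = duhamel_integrable[OF N ab F t, of x] duhamel_integrable[OF N ab G(1) F(2) G(2) t, of x]
    duhamel_integrable(2)[OF N ab borel_positive_times_diff[OF F(1) G(1)] _ FG t, of x]
  have lin: "indicator {0<..<t} s *\<^sub>R N (t - s) z v - indicator {0<..<t} s *\<^sub>R N (t - s) z w
     = indicator {0<..<t} s *\<^sub>R N (t - s) z (v - w)" for s z v w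
    using N linear_diff[of "N (t - s) z" v w] by (auto simp: parabolic_kernel_def indicator_def)
  have "duhamel N (\<lambda>s y. F s y - G s y) t x = (LINT p|(lborel \<Otimes>\<^sub>M lborel).
      indicator {0<..<t} (fst p) *\<^sub>R N (t - fst p) (x - snd p) (F (fst p) (snd p))
      - indicator {0<..<t} (fst p) *\<^sub>R N (t - fst p) (x - snd p) (G (fst p) (snd p)))"
    using I(5) F(2) unfolding lin by simp
  also have "\<dots> = duhamel N F t x - duhamel N G t x"
    unfolding I(2,4) by (rule Bochner_Integration.integral_diff[OF I(1,3)])
  finally show ?thesis by simp
qed

section \<open>The three kernels of the Boussinesq system\<close>

text \<open>
The kernel of \<open>e\<^sup>\<tau>\<^sup>\<Delta> P \<nabla>\<cdot>\<close> as an operator on matrices.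
\<close>

definition leray_div_kernel :: "real \<Rightarrow> R3 \<Rightarrow> real ^ 3 ^ 3 \<Rightarrow> R3"
  where "leray_div_kernel \<tau> z F = (\<chi> j. \<Sum>k\<in>UNIV. \<Sum>l\<in>UNIV.
     partial l (\<lambda>z. heat_leray_kernel \<tau> z $ j $ k) z * F $ k $ l)"

text \<open>
The factor \<open>t - s\<close> in front of the buoyancy term is counted as part of the kernel.
\<close>

definition timed_leray_div_kernel :: "real \<Rightarrow> R3 \<Rightarrow> real ^ 3 ^ 3 \<Rightarrow> R3"
  where "timed_leray_div_kernel \<tau> z F = \<tau> *\<^sub>R leray_div_kernel \<tau> z F"

definition div_kernel :: "real \<Rightarrow> R3 \<Rightarrow> R3 \<Rightarrow> real"
  where "div_kernel \<tau> z f = (\<Sum>l\<in>UNIV. partial l (heat_kernel \<tau>) z * f $ l)"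

lemma abs_entry_le: "\<bar>F $ k $ l\<bar> \<le> norm F" for F :: "real ^ 'n ^ 'm"
  using component_le_norm_cart[of "F $ k" l] Finite_Cartesian_Product.norm_nth_le[of F k] by linarith

lemma parabolic_kernel_leray_div: "parabolic_kernel 4 leray_div_kernel"
  unfolding parabolic_kernel_def
proof (intro conjI allI impI)
  show "linear (leray_div_kernel \<tau> z)" for \<tau> z
    by (rule linearI) (simp_all add: leray_div_kernel_def vec_eq_iff distrib_left sum.distrib sum_distrib_left mult_ac)
  have "\<forall>q. \<exists>C>0. \<forall>t>0. \<forall>x. \<bar>partial (fst q) (\<lambda>z. heat_leray_kernel t z $ fst (snd q) $ snd (snd q)) x\<bar> \<le> C / pnorm t x ^ 4"
    using heat_leray_kernel_partial_bound by blast
  then obtain C where C: "\<forall>q. 0 < C q \<and> (\<forall>t>0. \<forall>x. \<bar>partial (fst q) (\<lambda>z. heat_leray_kernel t z $ fst (snd q) $ snd (snd q)) x\<bar> \<le> C q / pnorm t x ^ 4)"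
    by (rule choice[THEN exE])
  show "\<exists>A. \<forall>\<tau>>0. \<forall>z v. norm (leray_div_kernel \<tau> z v) \<le> A / pnorm \<tau> z ^ 4 * norm v"
  proof (intro exI[of _ "\<Sum>j\<in>UNIV. \<Sum>k\<in>UNIV. \<Sum>l\<in>UNIV. C (l, j, k)"] allI impI)
    fix \<tau> z v assume \<tau>: "(0::real) < \<tau>"
    let ?P = "\<lambda>j k l. partial l (\<lambda>z. heat_leray_kernel \<tau> z $ j $ k) z"
    have P: "\<bar>?P j k l\<bar> \<le> C (l, j, k) / pnorm \<tau> z ^ 4" for j k l
      using C[THEN spec, of "(l, j, k)"] \<tau> by simp
    have "norm (leray_div_kernel \<tau> z v) \<le> (\<Sum>j\<in>UNIV. \<bar>\<Sum>k\<in>UNIV. \<Sum>l\<in>UNIV. ?P j k l * v $ k $ l\<bar>)"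
      using norm_le_l1_cart[of "leray_div_kernel \<tau> z v"] by (simp add: leray_div_kernel_def)
    also have "\<dots> \<le> (\<Sum>j\<in>UNIV. \<Sum>k\<in>UNIV. \<Sum>l\<in>UNIV. C (l, j, k) / pnorm \<tau> z ^ 4 * norm v)"
    proof (rule sum_mono)
      fix j :: 3
      have "\<bar>\<Sum>k\<in>UNIV. \<Sum>l\<in>UNIV. ?P j k l * v $ k $ l\<bar> \<le> (\<Sum>k\<in>UNIV. \<Sum>l\<in>UNIV. \<bar>?P j k l * v $ k $ l\<bar>)"
        by (rule order_trans[OF sum_abs sum_mono]) (rule sum_abs)
      also have "\<dots> \<le> (\<Sum>k\<in>UNIV. \<Sum>l\<in>UNIV. C (l, j, k) / pnorm \<tau> z ^ 4 * norm v)"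
        unfolding abs_mult using \<tau> C by (intro sum_mono mult_mono P abs_entry_le) (auto simp: pnorm_nonneg less_imp_le)
      finally show "\<bar>\<Sum>k\<in>UNIV. \<Sum>l\<in>UNIV. ?P j k l * v $ k $ l\<bar> \<le> (\<Sum>k\<in>UNIV. \<Sum>l\<in>UNIV. C (l, j, k) / pnorm \<tau> z ^ 4 * norm v)" .
    qed
    also have "\<dots> = (\<Sum>j\<in>UNIV. \<Sum>k\<in>UNIV. \<Sum>l\<in>UNIV. C (l, j, k)) / pnorm \<tau> z ^ 4 * norm v"
      by (simp add: sum_distrib_right sum_divide_distrib)
    finally show "norm (leray_div_kernel \<tau> z v) \<le> (\<Sum>j\<in>UNIV. \<Sum>k\<in>UNIV. \<Sum>l\<in>UNIV. C (l, j, k)) / pnorm \<tau> z ^ 4 * norm v" .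
  qed
  have P: "(\<lambda>p::real \<times> R3 \<times> (real ^ 3 ^ 3). indicator {0<..} (fst p) * partial l (\<lambda>z. heat_leray_kernel (fst p) z $ j $ k) (fst (snd p))) \<in> borel_measurable borel" for j k l
    using measurable_compose[OF _ heat_leray_kernel_partial_measurable[of l j k], of "\<lambda>p::real \<times> R3 \<times> (real ^ 3 ^ 3). (fst p, fst (snd p))" borel]
    by simp
  show "(\<lambda>p. indicator {0<..} (fst p) *\<^sub>R leray_div_kernel (fst p) (fst (snd p)) (snd (snd p))) \<in> borel_measurable borel"
  proof (rule borel_measurable_vecI)
    fix j
    have "(\<lambda>p::real \<times> R3 \<times> (real ^ 3 ^ 3). \<Sum>k\<in>UNIV. \<Sum>l\<in>UNIV. (indicator {0<..} (fst p) * partial l (\<lambda>z. heat_leray_kernel (fst p) z $ j $ k) (fst (snd p)))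
        * snd (snd p) $ k $ l) \<in> borel_measurable borel"
      by (intro borel_measurable_sum borel_measurable_times P) measurable
    then show "(\<lambda>p. (indicator {0<..} (fst p) *\<^sub>R leray_div_kernel (fst p) (fst (snd p)) (snd (snd p))) $ j) \<in> borel_measurable borel"
      by (simp add: leray_div_kernel_def sum_distrib_left mult.assoc)
  qed
qed

text \<open>
The factor \<open>\<tau> \<le> \<rho>\<^sup>2\<close> improves the exponent from 4 to 2.
\<close>

lemma parabolic_kernel_timed_leray_div: "parabolic_kernel 2 timed_leray_div_kernel"
  unfolding parabolic_kernel_def
proof (intro conjI allI impI)
  have K: "\<And>\<tau> z. 0 < \<tau> \<Longrightarrow> linear (leray_div_kernel \<tau> z)"
    "(\<lambda>p. indicator {0<..} (fst p) *\<^sub>R leray_div_kernel (fst p) (fst (snd p)) (snd (snd p))) \<in> borel_measurable borel"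
    using parabolic_kernel_leray_div by (auto simp: parabolic_kernel_def)
  show "linear (timed_leray_div_kernel \<tau> z)" if "0 < \<tau>" for \<tau> z
    using linear_compose_scale_right[OF K(1)[OF that, of z], of \<tau>] by (simp add: timed_leray_div_kernel_def[abs_def])
  obtain A where A: "\<forall>\<tau>>0. \<forall>z v. norm (leray_div_kernel \<tau> z v) \<le> A / pnorm \<tau> z ^ 4 * norm v"
    using parabolic_kernel_leray_div by (auto simp: parabolic_kernel_def)
  show "\<exists>A. \<forall>\<tau>>0. \<forall>z v. norm (timed_leray_div_kernel \<tau> z v) \<le> A / pnorm \<tau> z ^ 2 * norm v"
  proof (intro exI[of _ "\<bar>A\<bar>"] allI impI)
    fix \<tau> z v assume \<tau>: "(0::real) < \<tau>"
    have p: "0 < pnorm \<tau> z" using \<tau> by (rule pnorm_pos)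
    have "(sqrt \<tau>)\<^sup>2 \<le> (pnorm \<tau> z)\<^sup>2" using \<tau> by (intro power_mono) (auto simp: pnorm_def)
    then have "\<tau> \<le> (pnorm \<tau> z)\<^sup>2" using \<tau> by simp
    have "norm (timed_leray_div_kernel \<tau> z v) = \<tau> * norm (leray_div_kernel \<tau> z v)"
      using \<tau> by (simp add: timed_leray_div_kernel_def)
    also have "\<dots> \<le> (pnorm \<tau> z)\<^sup>2 * (\<bar>A\<bar> / pnorm \<tau> z ^ 4 * norm v)"
    proof (intro mult_mono)
      have "norm (leray_div_kernel \<tau> z v) \<le> A / pnorm \<tau> z ^ 4 * norm v" using A \<tau> by blast
      also have "\<dots> \<le> \<bar>A\<bar> / pnorm \<tau> z ^ 4 * norm v"
        using p by (intro mult_right_mono divide_right_mono) auto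
      finally show "norm (leray_div_kernel \<tau> z v) \<le> \<bar>A\<bar> / pnorm \<tau> z ^ 4 * norm v" .
    qed (use \<open>\<tau> \<le> (pnorm \<tau> z)\<^sup>2\<close> in auto)
    also have "\<dots> = \<bar>A\<bar> / pnorm \<tau> z ^ 2 * norm v"
      using p by (simp add: power4_eq_xxxx power2_eq_square)
    finally show "norm (timed_leray_div_kernel \<tau> z v) \<le> \<bar>A\<bar> / pnorm \<tau> z ^ 2 * norm v" .
  qed
  have "(\<lambda>p. fst p *\<^sub>R (indicator {0<..} (fst p) *\<^sub>R leray_div_kernel (fst p) (fst (snd p)) (snd (snd p)))) \<in> borel_measurable borel"
    by (intro borel_measurable_scaleR K(2)) measurable
  then show "(\<lambda>p. indicator {0<..} (fst p) *\<^sub>R timed_leray_div_kernel (fst p) (fst (snd p)) (snd (snd p))) \<in> borel_measurable borel"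
    by (simp add: timed_leray_div_kernel_def mult.commute)
qed

lemma parabolic_kernel_div: "parabolic_kernel 4 div_kernel"
  unfolding parabolic_kernel_def
proof (intro conjI allI impI)
  show "linear (div_kernel \<tau> z)" for \<tau> z
    by (rule linearI) (simp_all add: div_kernel_def distrib_left sum.distrib sum_distrib_left mult_ac)
  have hc: "heat_class (- int 4) (\<lambda>t. partial l (heat_kernel t))" for l
    using heat_class_partial[OF heat_class.kernel, of l] by simp
  have "\<forall>l. \<exists>C\<ge>0. \<forall>t>0. \<forall>z. \<bar>partial l (heat_kernel t) z\<bar> \<le> C / pnorm t z ^ 4"
    using heat_class_bound[OF hc refl] by blast
  then obtain C where C: "\<forall>l. 0 \<le> C l \<and> (\<forall>t>0. \<forall>z. \<bar>partial l (heat_kernel t) z\<bar> \<le> C l / pnorm t z ^ 4)"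
    by (rule choice[THEN exE])
  show "\<exists>A. \<forall>\<tau>>0. \<forall>z v. norm (div_kernel \<tau> z v) \<le> A / pnorm \<tau> z ^ 4 * norm v"
  proof (intro exI[of _ "\<Sum>l\<in>UNIV. C l"] allI impI)
    fix \<tau> z v assume \<tau>: "(0::real) < \<tau>"
    have "norm (div_kernel \<tau> z v) \<le> (\<Sum>l\<in>UNIV. \<bar>partial l (heat_kernel \<tau>) z * v $ l\<bar>)"
      unfolding div_kernel_def real_norm_def by (rule sum_abs)
    also have "\<dots> \<le> (\<Sum>l\<in>UNIV. C l / pnorm \<tau> z ^ 4 * norm v)"
      unfolding abs_mult using \<tau> C by (intro sum_mono mult_mono abs_component_le) (auto simp: pnorm_nonneg)
    also have "\<dots> = (\<Sum>l\<in>UNIV. C l) / pnorm \<tau> z ^ 4 * norm v"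
      by (simp add: sum_distrib_right sum_divide_distrib)
    finally show "norm (div_kernel \<tau> z v) \<le> (\<Sum>l\<in>UNIV. C l) / pnorm \<tau> z ^ 4 * norm v" .
  qed
  have "(\<lambda>p::real \<times> R3 \<times> R3. \<Sum>l\<in>UNIV. (indicator {0<..} (fst p) * partial l (heat_kernel (fst p)) (fst (snd p))) * snd (snd p) $ l) \<in> borel_measurable borel"
    by (intro borel_measurable_sum borel_measurable_times heat_class_measurable_comp[OF hc]) measurable
  then show "(\<lambda>p. indicator {0<..} (fst p) *\<^sub>R div_kernel (fst p) (fst (snd p)) (snd (snd p))) \<in> borel_measurable borel"
    by (simp add: div_kernel_def sum_distrib_left mult.assoc)
qed

lemma mild_solution_iff:
  "mild_solution u0 \<theta>0 u \<theta> \<longleftrightarrow> (\<forall>t>0. \<forall>x.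
    u t x = heat t u0 x + t *\<^sub>R heat_leray_distr t \<theta>0 x
      - duhamel leray_div_kernel (\<lambda>s y. outer (u s y) (u s y)) t x
      - duhamel timed_leray_div_kernel (\<lambda>s y. outer e3 (\<theta> s y *\<^sub>R u s y)) t x \<and>
    \<theta> t x = heat_distr t \<theta>0 x - duhamel div_kernel (\<lambda>s y. \<theta> s y *\<^sub>R u s y) t x)"
  unfolding mild_solution_def duhamel_def heat_leray_div_def heat_div_def
    leray_div_kernel_def timed_leray_div_kernel_def div_kernel_def integral_scaleR_right ..

section \<open>The quadratic terms\<close>

lemma norm_outer: "norm (outer a b) = norm a * norm b"
proof -
  have "outer a b $ k = a $ k *\<^sub>R b" for k by (simp add: outer_def vec_eq_iff)
  then have "norm (outer a b) = L2_set (\<lambda>k. \<bar>a $ k\<bar> * norm b) UNIV"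
    unfolding norm_vec_def[of "outer a b"] by simp
  also have "\<dots> = L2_set (\<lambda>k. \<bar>a $ k\<bar>) UNIV * norm b"
    by (rule L2_set_left_distrib[symmetric]) simp
  finally show ?thesis by (simp add: norm_vec_def[of a])
qed

lemma norm_e3: "norm e3 = 1"
  by (simp add: e3_def)

lemma outer_diff: "outer a b - outer a' b' = outer (a - a') b + outer a' (b - b')"
  by (simp add: outer_def vec_eq_iff algebra_simps)

lemma outer_e3_diff: "outer e3 v - outer e3 v' = outer e3 (v - v')"
  by (simp add: outer_def vec_eq_iff right_diff_distrib)

lemma norm_outer_diff_le: "norm (outer a b - outer a' b') \<le> norm (a - a') * norm b + norm a' * norm (b - b')"
  unfolding outer_diff using norm_triangle_ineq[of "outer (a - a') b" "outer a' (b - b')"] by (simp add: norm_outer)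

lemma norm_scaleR_diff_le:
  "norm (a *\<^sub>R v - a' *\<^sub>R v') \<le> \<bar>a - a'\<bar> * norm v + \<bar>a'\<bar> * norm (v - v')" for v :: "'a::real_normed_vector"
proof -
  have "a *\<^sub>R v - a' *\<^sub>R v' = (a - a') *\<^sub>R v + a' *\<^sub>R (v - v')" by (simp add: algebra_simps)
  then show ?thesis using norm_triangle_ineq[of "(a - a') *\<^sub>R v" "a' *\<^sub>R (v - v')"] by simp
qed

lemma borel_positive_times_scaleR:
  assumes "borel_positive_times \<theta>" "borel_positive_times u"
  shows "borel_positive_times (\<lambda>s y. \<theta> s y *\<^sub>R u s y)"
proof -
  have eq: "indicator {0<..} (fst p) *\<^sub>R (\<theta> (fst p) (snd p) *\<^sub>R u (fst p) (snd p))
     = (indicator {0<..} (fst p) *\<^sub>R \<theta> (fst p) (snd p)) *\<^sub>R (indicator {0<..} (fst p) *\<^sub>R u (fst p) (snd p))" for p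
    by (simp add: indicator_def)
  show ?thesis
    unfolding borel_positive_times_def eq by (rule borel_measurable_scaleR[OF assms[unfolded borel_positive_times_def]])
qed

lemma borel_positive_times_outer:
  assumes "borel_positive_times u" "borel_positive_times v"
  shows "borel_positive_times (\<lambda>s y. outer (u s y) (v s y))"
  unfolding borel_positive_times_def
proof (intro borel_measurable_vecI)
  fix k l
  have eq: "(indicator {0<..} (fst p) *\<^sub>R outer (u (fst p) (snd p)) (v (fst p) (snd p))) $ k $ l
     = (indicator {0<..} (fst p) *\<^sub>R u (fst p) (snd p)) $ k * (indicator {0<..} (fst p) *\<^sub>R v (fst p) (snd p)) $ l" for p
    by (simp add: indicator_def outer_def)
  show "(\<lambda>p. (indicator {0<..} (fst p) *\<^sub>R outer (u (fst p) (snd p)) (v (fst p) (snd p))) $ k $ l) \<in> borel_measurable borel"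
    unfolding eq using assms
    by (intro borel_measurable_times borel_measurable_vec_nth_comp) (simp_all only: borel_positive_times_def)
qed

lemma borel_positive_times_const: "borel_positive_times (\<lambda>s y. c)"
  unfolding borel_positive_times_def by measurable

lemma borel_positive_times_duhamel:
  assumes "parabolic_kernel a N" "borel_positive_times F"
  shows "borel_positive_times (duhamel N F)"
  unfolding borel_positive_times_def
  by (intro borel_measurable_scaleR borel_measurable_duhamel[OF assms]) measurable

text \<open>
The right-hand sides of the integral equations, as functions of \<open>(u, \<theta>)\<close>; \<open>A\<close> and \<open>B\<close> are the terms
that come from the initial data.
\<close>

definition velocity_map where
  "velocity_map A u \<theta> t x = A t x - duhamel leray_div_kernel (\<lambda>s y. outer (u s y) (u s y)) t x
      - duhamel timed_leray_div_kernel (\<lambda>s y. outer e3 (\<theta> s y *\<^sub>R u s y)) t x"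

definition temperature_map where
  "temperature_map B u \<theta> t x = B t x - duhamel div_kernel (\<lambda>s y. \<theta> s y *\<^sub>R u s y) t x"

text \<open>
The ball of radius \<open>r\<close> in \<open>X \<times> Y\<close>, restricted to Borel functions.
\<close>

definition in_XY_ball :: "real \<Rightarrow> (real \<Rightarrow> R3 \<Rightarrow> R3) \<Rightarrow> (real \<Rightarrow> R3 \<Rightarrow> real) \<Rightarrow> bool"
  where "in_XY_ball r u \<theta> \<longleftrightarrow> borel_positive_times u \<and> borel_positive_times \<theta> \<and>
    (\<forall>t>0. \<forall>x. norm (u t x) \<le> r / pnorm t x \<and> \<bar>\<theta> t x\<bar> \<le> r / pnorm t x ^ 3)"

definition XY_close :: "real \<Rightarrow> (real \<Rightarrow> R3 \<Rightarrow> R3) \<Rightarrow> (real \<Rightarrow> R3 \<Rightarrow> real) \<Rightarrow> (real \<Rightarrow> R3 \<Rightarrow> R3) \<Rightarrow> (real \<Rightarrow> R3 \<Rightarrow> real) \<Rightarrow> bool"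
  where "XY_close d u \<theta> u' \<theta>' \<longleftrightarrow>
    (\<forall>t>0. \<forall>x. norm (u t x - u' t x) \<le> d / pnorm t x \<and> \<bar>\<theta> t x - \<theta>' t x\<bar> \<le> d / pnorm t x ^ 3)"

lemma quadratic_terms_bounds:
  assumes w: "in_XY_ball r u \<theta>" and r: "0 \<le> r"
  shows "\<forall>s>0. \<forall>y. norm (outer (u s y) (u s y)) \<le> r\<^sup>2 / pnorm s y ^ 2" (is ?uu)
    and "\<forall>s>0. \<forall>y. norm (outer e3 (\<theta> s y *\<^sub>R u s y)) \<le> r\<^sup>2 / pnorm s y ^ 4" (is ?eu)
    and "\<forall>s>0. \<forall>y. norm (\<theta> s y *\<^sub>R u s y) \<le> r\<^sup>2 / pnorm s y ^ 4" (is ?tu)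
proof -
  have u: "norm (u s y) \<le> r / pnorm s y" and \<theta>: "\<bar>\<theta> s y\<bar> \<le> r / pnorm s y ^ 3" if "0 < s" for s y
    using w that by (auto simp: in_XY_ball_def)
  have uu: "norm (u s y) * norm (u s y) \<le> r\<^sup>2 / pnorm s y ^ 2" if "0 < s" for s y
    using mult_mono[OF u u, of s s y y] that r by (simp add: power2_eq_square pnorm_nonneg)
  have \<theta>u: "\<bar>\<theta> s y\<bar> * norm (u s y) \<le> r\<^sup>2 / pnorm s y ^ 4" if "0 < s" for s y
  proof -
    have "\<bar>\<theta> s y\<bar> * norm (u s y) \<le> r / pnorm s y ^ 3 * (r / pnorm s y)"
      using that r by (intro mult_mono u \<theta>) (auto simp: pnorm_nonneg)
    also have "\<dots> = r\<^sup>2 / pnorm s y ^ 4"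
      by (simp add: power2_eq_square power4_eq_xxxx power3_eq_cube)
    finally show ?thesis .
  qed
  show ?uu ?eu ?tu using uu \<theta>u by (auto simp: norm_outer norm_e3)
qed

lemma quadratic_terms_diff_bounds:
  assumes w: "in_XY_ball r u \<theta>" "in_XY_ball r u' \<theta>'" and d: "XY_close d u \<theta> u' \<theta>'" and r: "0 \<le> r" "0 \<le> d"
  shows "\<forall>s>0. \<forall>y. norm (outer (u s y) (u s y) - outer (u' s y) (u' s y)) \<le> 2 * r * d / pnorm s y ^ 2" (is ?uu)
    and "\<forall>s>0. \<forall>y. norm (outer e3 (\<theta> s y *\<^sub>R u s y) - outer e3 (\<theta>' s y *\<^sub>R u' s y)) \<le> 2 * r * d / pnorm s y ^ 4" (is ?eu)
    and "\<forall>s>0. \<forall>y. norm (\<theta> s y *\<^sub>R u s y - \<theta>' s y *\<^sub>R u' s y) \<le> 2 * r * d / pnorm s y ^ 4" (is ?tu)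
proof -
  have b: "norm (u s y) \<le> r / pnorm s y" "\<bar>\<theta> s y\<bar> \<le> r / pnorm s y ^ 3"
    "norm (u' s y) \<le> r / pnorm s y" "\<bar>\<theta>' s y\<bar> \<le> r / pnorm s y ^ 3"
    "norm (u s y - u' s y) \<le> d / pnorm s y" "\<bar>\<theta> s y - \<theta>' s y\<bar> \<le> d / pnorm s y ^ 3" if "0 < s" for s y
    using w d that by (auto simp: in_XY_ball_def XY_close_def)
  have uu: "norm (outer (u s y) (u s y) - outer (u' s y) (u' s y)) \<le> 2 * r * d / pnorm s y ^ 2" if "0 < s" for s y
  proof -
    have "norm (outer (u s y) (u s y) - outer (u' s y) (u' s y))
       \<le> norm (u s y - u' s y) * norm (u s y) + norm (u' s y) * norm (u s y - u' s y)"
      by (rule norm_outer_diff_le)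
    also have "\<dots> \<le> d / pnorm s y * (r / pnorm s y) + r / pnorm s y * (d / pnorm s y)"
      using that r by (intro add_mono mult_mono b) (auto simp: pnorm_nonneg)
    also have "\<dots> = 2 * r * d / pnorm s y ^ 2" by (simp add: power2_eq_square)
    finally show ?thesis .
  qed
  have \<theta>u: "norm (\<theta> s y *\<^sub>R u s y - \<theta>' s y *\<^sub>R u' s y) \<le> 2 * r * d / pnorm s y ^ 4" if "0 < s" for s y
  proof -
    have "norm (\<theta> s y *\<^sub>R u s y - \<theta>' s y *\<^sub>R u' s y)
       \<le> \<bar>\<theta> s y - \<theta>' s y\<bar> * norm (u s y) + \<bar>\<theta>' s y\<bar> * norm (u s y - u' s y)"
      by (rule norm_scaleR_diff_le)
    also have "\<dots> \<le> d / pnorm s y ^ 3 * (r / pnorm s y) + r / pnorm s y ^ 3 * (d / pnorm s y)"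
      using that r by (intro add_mono mult_mono b) (auto simp: pnorm_nonneg)
    also have "\<dots> = 2 * r * d / pnorm s y ^ 4" by (simp add: power4_eq_xxxx power3_eq_cube mult_ac)
    finally show ?thesis .
  qed
  show ?uu ?eu ?tu using uu \<theta>u by (auto simp: outer_e3_diff norm_outer norm_e3)
qed

text \<open>
All three Duhamel terms are quadratic with a common constant \<open>K\<close>.  If \<open>4 K r \<le> 1\<close>, then they contribute
at most \<open>K r\<^sup>2 \<le> r / 4\<close> to the size of the image and \<open>2 K r d \<le> d / 2\<close> to the distance of two images.
\<close>

lemma duhamel_map_estimates:
  "\<exists>K>0. \<forall>r A B. 0 \<le> r \<longrightarrow> 4 * K * r \<le> 1 \<longrightarrow> in_XY_ball (r / 2) A B \<longrightarrow>
    (\<forall>u \<theta>. in_XY_ball r u \<theta> \<longrightarrow> in_XY_ball r (velocity_map A u \<theta>) (temperature_map B u \<theta>)) \<and>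
    (\<forall>u \<theta> u' \<theta>' d. in_XY_ball r u \<theta> \<longrightarrow> in_XY_ball r u' \<theta>' \<longrightarrow> 0 \<le> d \<longrightarrow> XY_close d u \<theta> u' \<theta>' \<longrightarrow>
       XY_close (d / 2) (velocity_map A u \<theta>) (temperature_map B u \<theta>) (velocity_map A u' \<theta>') (temperature_map B u' \<theta>'))"
proof -
  obtain C1 where C1: "0 < C1" "\<And>F M t x. 0 \<le> M \<Longrightarrow> (\<forall>s>0. \<forall>y. norm (F s y) \<le> M / pnorm s y ^ 2) \<Longrightarrow> 0 < t \<Longrightarrow>
     norm (duhamel leray_div_kernel F t x) \<le> C1 * M / pnorm t x ^ (4 + 2 - 5)"
    using norm_duhamel_le[OF parabolic_kernel_leray_div, of 2] by auto
  obtain C2 where C2: "0 < C2" "\<And>F M t x. 0 \<le> M \<Longrightarrow> (\<forall>s>0. \<forall>y. norm (F s y) \<le> M / pnorm s y ^ 4) \<Longrightarrow> 0 < t \<Longrightarrow>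
     norm (duhamel timed_leray_div_kernel F t x) \<le> C2 * M / pnorm t x ^ (2 + 4 - 5)"
    using norm_duhamel_le[OF parabolic_kernel_timed_leray_div, of 4] by auto
  obtain C3 where C3: "0 < C3" "\<And>F M t x. 0 \<le> M \<Longrightarrow> (\<forall>s>0. \<forall>y. norm (F s y) \<le> M / pnorm s y ^ 4) \<Longrightarrow> 0 < t \<Longrightarrow>
     norm (duhamel div_kernel F t x) \<le> C3 * M / pnorm t x ^ (4 + 4 - 5)"
    using norm_duhamel_le[OF parabolic_kernel_div, of 4] by auto
  define K where "K = C1 + C2 + C3"
  have K: "0 < K" "C1 + C2 \<le> K" "C3 \<le> K" using C1(1) C2(1) C3(1) by (auto simp: K_def)
  show ?thesis
  proof (intro exI[of _ K] conjI K(1) allI impI)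
    fix r A B u \<theta>
    assume r: "0 \<le> r" "4 * K * r \<le> 1" and AB: "in_XY_ball (r / 2) A B" and w: "in_XY_ball r u \<theta>"
    have m: "borel_positive_times u" "borel_positive_times \<theta>" "borel_positive_times A" "borel_positive_times B"
      using w AB by (auto simp: in_XY_ball_def)
    have Kr: "K * r\<^sup>2 \<le> r / 2" using mult_right_mono[OF r(2) r(1)] r(1) by (simp add: power2_eq_square)
    note q = quadratic_terms_bounds[OF w r(1)]
    show "in_XY_ball r (velocity_map A u \<theta>) (temperature_map B u \<theta>)"
      unfolding in_XY_ball_def
    proof (intro conjI allI impI)
      show "borel_positive_times (velocity_map A u \<theta>)"
        unfolding velocity_map_def[abs_def]
        by (intro borel_positive_times_diff m borel_positive_times_duhamel[OF parabolic_kernel_leray_div]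
            borel_positive_times_duhamel[OF parabolic_kernel_timed_leray_div] borel_positive_times_outer
            borel_positive_times_scaleR borel_positive_times_const)
      show "borel_positive_times (temperature_map B u \<theta>)"
        unfolding temperature_map_def[abs_def]
        by (intro borel_positive_times_diff m borel_positive_times_duhamel[OF parabolic_kernel_div] borel_positive_times_scaleR)
      fix t :: real and x :: R3 assume t: "0 < t"
      have p: "0 < pnorm t x" using t by (rule pnorm_pos)
      let ?D1 = "duhamel leray_div_kernel (\<lambda>s y. outer (u s y) (u s y)) t x"
      let ?D2 = "duhamel timed_leray_div_kernel (\<lambda>s y. outer e3 (\<theta> s y *\<^sub>R u s y)) t x"
      let ?D3 = "duhamel div_kernel (\<lambda>s y. \<theta> s y *\<^sub>R u s y) t x"
      have D: "norm ?D1 \<le> C1 * r\<^sup>2 / pnorm t x" "norm ?D2 \<le> C2 * r\<^sup>2 / pnorm t x" "\<bar>?D3\<bar> \<le> C3 * r\<^sup>2 / pnorm t x ^ 3"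
        using C1(2)[OF _ q(1) t, of x] C2(2)[OF _ q(2) t, of x] C3(2)[OF _ q(3) t, of x] by auto
      have AB': "norm (A t x) \<le> (r / 2) / pnorm t x" "\<bar>B t x\<bar> \<le> (r / 2) / pnorm t x ^ 3"
        using AB t by (auto simp: in_XY_ball_def)
      have "norm (velocity_map A u \<theta> t x) \<le> norm (A t x) + norm ?D1 + norm ?D2"
        unfolding velocity_map_def
        using norm_triangle_ineq4[of "A t x - ?D1" ?D2] norm_triangle_ineq4[of "A t x" ?D1] by linarith
      also have "\<dots> \<le> (r / 2) / pnorm t x + C1 * r\<^sup>2 / pnorm t x + C2 * r\<^sup>2 / pnorm t x"
        by (intro add_mono D AB')
      also have "\<dots> = (r / 2 + (C1 + C2) * r\<^sup>2) / pnorm t x"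
        by (simp add: add_divide_distrib distrib_right)
      also have "\<dots> \<le> r / pnorm t x"
        using Kr mult_right_mono[OF K(2), of "r\<^sup>2"] p by (intro divide_right_mono) auto
      finally show "norm (velocity_map A u \<theta> t x) \<le> r / pnorm t x" .
      have "\<bar>temperature_map B u \<theta> t x\<bar> \<le> \<bar>B t x\<bar> + \<bar>?D3\<bar>"
        unfolding temperature_map_def by (rule abs_triangle_ineq4)
      also have "\<dots> \<le> (r / 2) / pnorm t x ^ 3 + C3 * r\<^sup>2 / pnorm t x ^ 3"
        by (intro add_mono D AB')
      also have "\<dots> = (r / 2 + C3 * r\<^sup>2) / pnorm t x ^ 3" by (simp add: add_divide_distrib)
      also have "\<dots> \<le> r / pnorm t x ^ 3"
        using Kr mult_right_mono[OF K(3), of "r\<^sup>2"] p by (intro divide_right_mono) auto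
      finally show "\<bar>temperature_map B u \<theta> t x\<bar> \<le> r / pnorm t x ^ 3" .
    qed
  next
    fix r A B u \<theta> u' \<theta>' d
    assume r: "0 \<le> r" "4 * K * r \<le> 1" and w: "in_XY_ball r u \<theta>" "in_XY_ball r u' \<theta>'" and d: "0 \<le> d" "XY_close d u \<theta> u' \<theta>'"
    have m: "borel_positive_times u" "borel_positive_times \<theta>" "borel_positive_times u'" "borel_positive_times \<theta>'"
      using w by (auto simp: in_XY_ball_def)
    note m1 = borel_positive_times_outer[OF m(1) m(1)] borel_positive_times_outer[OF m(3) m(3)]
    note m3 = borel_positive_times_scaleR[OF m(2) m(1)] borel_positive_times_scaleR[OF m(4) m(3)]
    note m2 = borel_positive_times_outer[OF borel_positive_times_const[of e3] m3(1)] borel_positive_times_outer[OF borel_positive_times_const[of e3] m3(2)]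
    note q = quadratic_terms_bounds[OF w(1) r(1)] and q' = quadratic_terms_bounds[OF w(2) r(1)]
    note qd = quadratic_terms_diff_bounds[OF w d(2) r(1) d(1)]
    have Krd: "K * (2 * r * d) \<le> d / 2" using mult_right_mono[OF r(2) d(1)] by simp
    have rd: "0 \<le> 2 * r * d" using r d by simp
    show "XY_close (d / 2) (velocity_map A u \<theta>) (temperature_map B u \<theta>) (velocity_map A u' \<theta>') (temperature_map B u' \<theta>')"
      unfolding XY_close_def
    proof (intro allI impI conjI)
      fix t :: real and x :: R3 assume t: "0 < t"
      have p: "0 < pnorm t x" using t by (rule pnorm_pos)
      let ?D1 = "\<lambda>u. duhamel leray_div_kernel (\<lambda>s y. outer (u s y) (u s y)) t x"
      let ?D2 = "\<lambda>\<theta> u. duhamel timed_leray_div_kernel (\<lambda>s y. outer e3 (\<theta> s y *\<^sub>R u s y)) t x"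
      let ?D3 = "\<lambda>\<theta> u. duhamel div_kernel (\<lambda>s y. \<theta> s y *\<^sub>R u s y) t x"
      have D1: "norm (?D1 u - ?D1 u') \<le> C1 * (2 * r * d) / pnorm t x"
        using C1(2)[OF rd qd(1) t, of x] duhamel_diff[OF parabolic_kernel_leray_div _ _ _ m1(1) _ q(1) m1(2) q'(1) t, of x] by simp
      have D2: "norm (?D2 \<theta> u - ?D2 \<theta>' u') \<le> C2 * (2 * r * d) / pnorm t x"
        using C2(2)[OF rd qd(2) t, of x] duhamel_diff[OF parabolic_kernel_timed_leray_div _ _ _ m2(1) _ q(2) m2(2) q'(2) t, of x] by simp
      have D3: "\<bar>?D3 \<theta> u - ?D3 \<theta>' u'\<bar> \<le> C3 * (2 * r * d) / pnorm t x ^ 3"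
        using C3(2)[OF rd qd(3) t, of x] duhamel_diff[OF parabolic_kernel_div _ _ _ m3(1) _ q(3) m3(2) q'(3) t, of x] by simp
      have "norm (velocity_map A u \<theta> t x - velocity_map A u' \<theta>' t x)
         = norm ((?D1 u - ?D1 u') + (?D2 \<theta> u - ?D2 \<theta>' u'))"
        unfolding velocity_map_def by (subst norm_minus_commute) (simp add: algebra_simps)
      also have "\<dots> \<le> C1 * (2 * r * d) / pnorm t x + C2 * (2 * r * d) / pnorm t x"
        by (rule order_trans[OF norm_triangle_ineq add_mono[OF D1 D2]])
      also have "\<dots> = (C1 + C2) * (2 * r * d) / pnorm t x" by (simp add: add_divide_distrib distrib_right)
      also have "\<dots> \<le> d / 2 / pnorm t x"
        using Krd mult_right_mono[OF K(2) rd] p by (intro divide_right_mono) auto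
      finally show "norm (velocity_map A u \<theta> t x - velocity_map A u' \<theta>' t x) \<le> d / 2 / pnorm t x" .
      have "\<bar>temperature_map B u \<theta> t x - temperature_map B u' \<theta>' t x\<bar> = \<bar>?D3 \<theta> u - ?D3 \<theta>' u'\<bar>"
        unfolding temperature_map_def by simp
      also note D3
      also have "C3 * (2 * r * d) / pnorm t x ^ 3 \<le> d / 2 / pnorm t x ^ 3"
        using Krd mult_right_mono[OF K(3) rd] p by (intro divide_right_mono) auto
      finally show "\<bar>temperature_map B u \<theta> t x - temperature_map B u' \<theta>' t x\<bar> \<le> d / 2 / pnorm t x ^ 3" .
    qed
  qed
qed

section \<open>Fixed points\<close>

lemma geometric_steps_converge:
  fixes s :: "nat \<Rightarrow> 'b::banach"
  assumes step: "\<And>n. norm (s (Suc n) - s n) \<le> c / 2 ^ n"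
  shows "\<exists>l. s \<longlonglongrightarrow> l \<and> (\<forall>n. norm (l - s n) \<le> 2 * c / 2 ^ n)"
proof -
  have c: "0 \<le> c" using order_trans[OF norm_ge_zero step[of 0]] by simp
  have g: "summable (\<lambda>n. c * (1 / 2) ^ n)" by (intro summable_mult summable_geometric) simp
  have "summable (\<lambda>n. s (Suc n) - s n)"
    by (rule summable_comparison_test'[OF g, of 0]) (use step in \<open>simp add: power_divide\<close>)
  then have "(\<lambda>n. \<Sum>k<n. s (Suc k) - s k) \<longlonglongrightarrow> (\<Sum>n. s (Suc n) - s n)" by (rule summable_LIMSEQ)
  then have "(\<lambda>n. s n - s 0) \<longlonglongrightarrow> (\<Sum>n. s (Suc n) - s n)" by (simp add: sum_lessThan_telescope)
  from tendsto_add[OF this tendsto_const[of "s 0"]]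
  obtain l where l: "s \<longlonglongrightarrow> l" by auto
  have tel: "norm (s (n + k) - s n) \<le> 2 * c / 2 ^ n - 2 * c / 2 ^ (n + k)" for n k
  proof (induction k)
    case (Suc k)
    have "norm (s (n + Suc k) - s n) \<le> norm (s (Suc (n + k)) - s (n + k)) + norm (s (n + k) - s n)"
      using norm_triangle_ineq[of "s (Suc (n + k)) - s (n + k)" "s (n + k) - s n"] by simp
    also have "\<dots> \<le> c / 2 ^ (n + k) + (2 * c / 2 ^ n - 2 * c / 2 ^ (n + k))"
      by (intro add_mono step Suc)
    finally show ?case by simp
  qed simp
  have "norm (l - s n) \<le> 2 * c / 2 ^ n" for n
  proof (rule LIMSEQ_le_const2)
    show "(\<lambda>k. norm (s (k + n) - s n)) \<longlonglongrightarrow> norm (l - s n)"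
      by (intro tendsto_intros LIMSEQ_ignore_initial_segment l)
    have "norm (s (k + n) - s n) \<le> 2 * c / 2 ^ n" for k
    proof -
      have "0 \<le> 2 * c / 2 ^ (n + k)" using c by simp
      then show ?thesis using tel[of n k] by (simp add: add.commute[of n k])
    qed
    then show "\<exists>N. \<forall>k\<ge>N. norm (s (k + n) - s n) \<le> 2 * c / 2 ^ n" by blast
  qed
  with l show ?thesis by blast
qed

lemma borel_positive_times_LIMSEQ:
  assumes "\<And>n. borel_positive_times (F n)" and "\<And>t x. 0 < t \<Longrightarrow> (\<lambda>n. F n t x) \<longlonglongrightarrow> G t x"
  shows "borel_positive_times G"
  unfolding borel_positive_times_def
proof (rule borel_measurable_LIMSEQ_metric)
  show "(\<lambda>p. indicator {0<..} (fst p) *\<^sub>R F n (fst p) (snd p)) \<in> borel_measurable borel" for n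
    using assms(1) by (simp add: borel_positive_times_def)
  show "(\<lambda>n. indicator {0<..} (fst p) *\<^sub>R F n (fst p) (snd p)) \<longlonglongrightarrow> indicator {0<..} (fst p) *\<^sub>R G (fst p) (snd p)" for p
    using assms(2)[of "fst p" "snd p"] by (cases "0 < fst p") auto
qed

lemma eq_if_XY_close_geometrically:
  assumes "\<And>n. XY_close (c / 2 ^ n) u \<theta> u' \<theta>'" "0 < t"
  shows "u t x = u' t x" "\<theta> t x = \<theta>' t x"
proof -
  have lim: "(\<lambda>n. c / 2 ^ n / q) \<longlonglongrightarrow> 0" for q :: real
  proof -
    have "(\<lambda>n. c / q * (1 / 2) ^ n) \<longlonglongrightarrow> c / q * 0"
      by (intro tendsto_mult tendsto_const LIMSEQ_power_zero) simp
    then show ?thesis by (simp add: power_divide mult.commute)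
  qed
  have "norm (u t x - u' t x) \<le> 0"
    by (rule LIMSEQ_le_const[OF lim[of "pnorm t x"]]) (use assms in \<open>auto simp: XY_close_def\<close>)
  then show "u t x = u' t x" by simp
  have "\<bar>\<theta> t x - \<theta>' t x\<bar> \<le> 0"
    by (rule LIMSEQ_le_const[OF lim[of "pnorm t x ^ 3"]]) (use assms in \<open>auto simp: XY_close_def\<close>)
  then show "\<theta> t x = \<theta>' t x" by simp
qed

lemma XY_close_triangle:
  assumes "XY_close d u \<theta> v \<eta>" "XY_close e v \<eta> w \<zeta>"
  shows "XY_close (d + e) u \<theta> w \<zeta>"
  unfolding XY_close_def
proof (intro allI impI conjI)
  fix t :: real and x :: R3 assume t: "0 < t"
  show "norm (u t x - w t x) \<le> (d + e) / pnorm t x"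
    using assms t norm_triangle_ineq[of "u t x - v t x" "v t x - w t x"]
    by (simp add: XY_close_def add_divide_distrib) (meson add_mono order_trans)
  show "\<bar>\<theta> t x - \<zeta> t x\<bar> \<le> (d + e) / pnorm t x ^ 3"
    using assms t abs_triangle_ineq[of "\<theta> t x - \<eta> t x" "\<eta> t x - \<zeta> t x"]
    by (simp add: XY_close_def add_divide_distrib) (meson add_mono order_trans)
qed

lemma XY_close_sym: "XY_close d u \<theta> v \<eta> \<Longrightarrow> XY_close d v \<eta> u \<theta>"
  by (simp add: XY_close_def norm_minus_commute abs_minus_commute)

lemma in_XY_ball_imp_close:
  assumes "in_XY_ball r u \<theta>" "in_XY_ball r v \<eta>"
  shows "XY_close (2 * r) u \<theta> v \<eta>"
  unfolding XY_close_def
proof (intro allI impI conjI)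
  fix t :: real and x :: R3 assume t: "0 < t"
  have b: "norm (u t x) \<le> r / pnorm t x" "norm (v t x) \<le> r / pnorm t x"
    "\<bar>\<theta> t x\<bar> \<le> r / pnorm t x ^ 3" "\<bar>\<eta> t x\<bar> \<le> r / pnorm t x ^ 3"
    using assms t by (auto simp: in_XY_ball_def)
  show "norm (u t x - v t x) \<le> 2 * r / pnorm t x"
    using norm_triangle_ineq4[of "u t x" "v t x"] b(1,2) by simp
  show "\<bar>\<theta> t x - \<eta> t x\<bar> \<le> 2 * r / pnorm t x ^ 3"
    using abs_triangle_ineq4[of "\<theta> t x" "\<eta> t x"] b(3,4) by simp
qed

text \<open>
The iterates of 0 converge pointwise at positive times, and the bounds and Borel measurability pass
to pointwise limits.  The limit is within \<open>4 r / 2\<^sup>n\<close> of its image for every \<open>n\<close>.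
\<close>

lemma fixed_point:
  assumes r: "0 \<le> r"
    and self: "\<And>u \<theta>. in_XY_ball r u \<theta> \<Longrightarrow> in_XY_ball r (\<Phi> u \<theta>) (\<Psi> u \<theta>)"
    and contr: "\<And>u \<theta> u' \<theta>' d. in_XY_ball r u \<theta> \<Longrightarrow> in_XY_ball r u' \<theta>' \<Longrightarrow> 0 \<le> d \<Longrightarrow> XY_close d u \<theta> u' \<theta>' \<Longrightarrow>
       XY_close (d / 2) (\<Phi> u \<theta>) (\<Psi> u \<theta>) (\<Phi> u' \<theta>') (\<Psi> u' \<theta>')"
  shows "\<exists>u \<theta>. in_XY_ball r u \<theta> \<and> (\<forall>t>0. \<forall>x. u t x = \<Phi> u \<theta> t x \<and> \<theta> t x = \<Psi> u \<theta> t x)"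
proof -
  define w where "w = rec_nat (\<lambda>t x. 0, \<lambda>t x. 0) (\<lambda>n w. (\<Phi> (fst w) (snd w), \<Psi> (fst w) (snd w)))"
  define U where "U n = fst (w n)" for n :: nat
  define \<Theta> where "\<Theta> n = snd (w n)" for n :: nat
  have iter: "U (Suc n) = \<Phi> (U n) (\<Theta> n)" "\<Theta> (Suc n) = \<Psi> (U n) (\<Theta> n)" for n
    by (simp_all add: U_def \<Theta>_def w_def)
  have ball: "in_XY_ball r (U n) (\<Theta> n)" for n
  proof (induction n)
    case 0
    have "U 0 = (\<lambda>t x. 0)" "\<Theta> 0 = (\<lambda>t x. 0)" by (simp_all add: U_def \<Theta>_def w_def)
    then show ?case using r by (simp add: in_XY_ball_def borel_positive_times_const pnorm_nonneg)
  next
    case (Suc n)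
    then show ?case unfolding iter by (rule self)
  qed
  have step: "XY_close (2 * r / 2 ^ n) (U (Suc n)) (\<Theta> (Suc n)) (U n) (\<Theta> n)" for n
  proof (induction n)
    case 0
    then show ?case using in_XY_ball_imp_close[OF ball[of 1] ball[of 0]] by simp
  next
    case (Suc n)
    from contr[OF ball ball _ Suc] r show ?case by (simp add: iter mult.commute)
  qed
  have "\<exists>l. (\<lambda>n. U n t x) \<longlonglongrightarrow> l \<and> (\<forall>n. norm (l - U n t x) \<le> 2 * (2 * r / pnorm t x) / 2 ^ n)" if "0 < t" for t x
    by (rule geometric_steps_converge) (use step that in \<open>auto simp: XY_close_def mult_ac\<close>)
  then obtain u where u: "\<And>t x. 0 < t \<Longrightarrow> (\<lambda>n. U n t x) \<longlonglongrightarrow> u t x"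
    "\<And>t x n. 0 < t \<Longrightarrow> norm (u t x - U n t x) \<le> 2 * (2 * r / pnorm t x) / 2 ^ n" by metis
  have "\<exists>l. (\<lambda>n. \<Theta> n t x) \<longlonglongrightarrow> l \<and> (\<forall>n. norm (l - \<Theta> n t x) \<le> 2 * (2 * r / pnorm t x ^ 3) / 2 ^ n)" if "0 < t" for t x
    by (rule geometric_steps_converge) (use step that in \<open>auto simp: XY_close_def mult_ac\<close>)
  then obtain \<theta> where \<theta>: "\<And>t x. 0 < t \<Longrightarrow> (\<lambda>n. \<Theta> n t x) \<longlonglongrightarrow> \<theta> t x"
    "\<And>t x n. 0 < t \<Longrightarrow> norm (\<theta> t x - \<Theta> n t x) \<le> 2 * (2 * r / pnorm t x ^ 3) / 2 ^ n" by metis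
  have cl: "XY_close (4 * r / 2 ^ n) u \<theta> (U n) (\<Theta> n)" for n
    using u(2)[of _ _ n] \<theta>(2)[of _ _ n] by (simp add: XY_close_def mult_ac)
  have lim: "in_XY_ball r u \<theta>"
    unfolding in_XY_ball_def
  proof (intro conjI allI impI)
    show "borel_positive_times u" "borel_positive_times \<theta>"
      using ball by (auto intro!: borel_positive_times_LIMSEQ[OF _ u(1)] borel_positive_times_LIMSEQ[OF _ \<theta>(1)] simp: in_XY_ball_def)
    fix t :: real and x :: R3 assume t: "0 < t"
    show "norm (u t x) \<le> r / pnorm t x"
      by (rule LIMSEQ_le_const2[OF tendsto_norm[OF u(1)[OF t]]]) (use ball t in \<open>auto simp: in_XY_ball_def\<close>)
    show "\<bar>\<theta> t x\<bar> \<le> r / pnorm t x ^ 3"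
      by (rule LIMSEQ_le_const2[OF tendsto_rabs[OF \<theta>(1)[OF t]]]) (use ball t in \<open>auto simp: in_XY_ball_def\<close>)
  qed
  have "XY_close (4 * r / 2 ^ n) u \<theta> (\<Phi> u \<theta>) (\<Psi> u \<theta>)" for n
  proof -
    have "XY_close (4 * r / 2 ^ Suc n) u \<theta> (U (Suc n)) (\<Theta> (Suc n))" by (rule cl)
    moreover have "XY_close (4 * r / 2 ^ n / 2) (U (Suc n)) (\<Theta> (Suc n)) (\<Phi> u \<theta>) (\<Psi> u \<theta>)"
      unfolding iter by (rule contr[OF ball lim _ XY_close_sym[OF cl]]) (use r in simp)
    ultimately have "XY_close (4 * r / 2 ^ Suc n + 4 * r / 2 ^ n / 2) u \<theta> (\<Phi> u \<theta>) (\<Psi> u \<theta>)"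
      by (rule XY_close_triangle)
    then show ?thesis by (simp add: field_simps)
  qed
  from eq_if_XY_close_geometrically[OF this] lim show ?thesis by blast
qed

lemma fixed_point_unique:
  assumes r: "0 \<le> r"
    and contr: "\<And>u \<theta> u' \<theta>' d. in_XY_ball r u \<theta> \<Longrightarrow> in_XY_ball r u' \<theta>' \<Longrightarrow> 0 \<le> d \<Longrightarrow> XY_close d u \<theta> u' \<theta>' \<Longrightarrow>
       XY_close (d / 2) (\<Phi> u \<theta>) (\<Psi> u \<theta>) (\<Phi> u' \<theta>') (\<Psi> u' \<theta>')"
    and u: "in_XY_ball r u \<theta>" "\<forall>t>0. \<forall>x. u t x = \<Phi> u \<theta> t x \<and> \<theta> t x = \<Psi> u \<theta> t x"
    and u': "in_XY_ball r u' \<theta>'" "\<forall>t>0. \<forall>x. u' t x = \<Phi> u' \<theta>' t x \<and> \<theta>' t x = \<Psi> u' \<theta>' t x"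
    and t: "0 < t"
  shows "u t x = u' t x" "\<theta> t x = \<theta>' t x"
proof -
  have "XY_close (2 * r / 2 ^ n) u \<theta> u' \<theta>'" for n
  proof (induction n)
    case 0
    show ?case using in_XY_ball_imp_close[OF u(1) u'(1)] by simp
  next
    case (Suc n)
    have "XY_close (2 * r / 2 ^ n / 2) (\<Phi> u \<theta>) (\<Psi> u \<theta>) (\<Phi> u' \<theta>') (\<Psi> u' \<theta>')"
      by (rule contr[OF u(1) u'(1) _ Suc]) (use r in simp)
    then show ?case using u(2) u'(2) by (simp add: XY_close_def mult.commute)
  qed
  from eq_if_XY_close_geometrically[OF this t] show "u t x = u' t x" "\<theta> t x = \<theta>' t x" .
qed

section \<open>Mild solutions\<close>

lemma normX_le_iff: "normX u \<le> ereal r \<longleftrightarrow> (\<forall>t>0. \<forall>x. norm (u t x) \<le> r / pnorm t x)"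
  using pnorm_pos by (auto simp: normX_def SUP_le_iff pnorm_def[symmetric] pos_le_divide_eq mult.commute)

lemma normY_le_iff: "normY \<theta> \<le> ereal r \<longleftrightarrow> (\<forall>t>0. \<forall>x. \<bar>\<theta> t x\<bar> \<le> r / pnorm t x ^ 3)"
  using pnorm_pos by (auto simp: normY_def SUP_le_iff pnorm_def[symmetric] pos_le_divide_eq mult.commute)

lemma positive_times_sets: "{0<..} \<times> UNIV \<in> sets (lebesgue :: (real \<times> R3) measure)"
proof -
  have "{0<..} \<times> UNIV \<in> sets (borel :: (real \<times> R3) measure)"
    by (intro borel_open open_Times open_greaterThan open_UNIV)
  then show ?thesis by simp
qed

lemma borel_positive_times_lebesgue_on:
  assumes "borel_positive_times F"
  shows "(\<lambda>(t, x). F t x) \<in> borel_measurable (lebesgue_on ({0<..} \<times> UNIV))"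
proof (rule borel_measurable_if_D)
  have "(\<lambda>p. indicator {0<..} (fst p) *\<^sub>R F (fst p) (snd p)) \<in> borel_measurable lebesgue"
    using assms unfolding borel_positive_times_def by (intro measurable_completion) simp
  moreover have "(\<lambda>p. indicator {0<..} (fst p) *\<^sub>R F (fst p) (snd p))
     = (\<lambda>p. if p \<in> {0<..} \<times> UNIV then (case p of (t, x) \<Rightarrow> F t x) else 0)"
    by (auto simp: fun_eq_iff indicator_def)
  ultimately show "(\<lambda>p. if p \<in> {0<..} \<times> UNIV then (case p of (t, x) \<Rightarrow> F t x) else 0) \<in> borel_measurable lebesgue"
    by simp
qed

lemma lebesgue_on_positive_times_AE_borel:
  assumes "(\<lambda>(t, x). F t x) \<in> borel_measurable (lebesgue_on ({0<..} \<times> UNIV))"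
  shows "\<exists>G. borel_positive_times G \<and> (AE p in lborel. 0 < fst p \<longrightarrow> F (fst p) (snd p) = G (fst p) (snd p))"
proof -
  obtain g where g: "g \<in> borel_measurable borel"
    "AE p in lborel. (if p \<in> {0<..} \<times> UNIV then (case p of (t, x) \<Rightarrow> F t x) else 0) = g p"
    using lebesgue_measurable_AE_eq_borel[OF borel_measurable_if_I[OF assms positive_times_sets]] by blast
  have "AE p in lborel. 0 < fst p \<longrightarrow> F (fst p) (snd p) = g (fst p, snd p)"
    using g(2) by eventually_elim (auto simp: case_prod_unfold)
  moreover have "borel_positive_times (\<lambda>t x. g (t, x))"
    unfolding borel_positive_times_def using g(1) by (intro borel_measurable_scaleR) (auto intro!: borel_measurable_indicator')
  ultimately show ?thesis by blast
qed

lemma borel_positive_times_cong: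
  "borel_positive_times F \<Longrightarrow> (\<And>t x. 0 < t \<Longrightarrow> G t x = F t x) \<Longrightarrow> borel_positive_times G"
  unfolding borel_positive_times_def
  by (erule measurable_cong[THEN iffD1, rotated]) (auto simp: indicator_def)

lemma mild_solution_iff_maps:
  "mild_solution u0 \<theta>0 u \<theta> \<longleftrightarrow> (\<forall>t>0. \<forall>x.
     u t x = velocity_map (\<lambda>t x. heat t u0 x + t *\<^sub>R heat_leray_distr t \<theta>0 x) u \<theta> t x \<and>
     \<theta> t x = temperature_map (\<lambda>t x. heat_distr t \<theta>0 x) u \<theta> t x)"
  by (simp add: mild_solution_iff velocity_map_def temperature_map_def)

text \<open>
The Duhamel terms may be computed from Borel versions of \<open>u\<close> and \<open>\<theta>\<close>, and are then Borel functions;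
hence so are \<open>u\<close> and \<open>\<theta>\<close>, which the equations express through them at every point.
\<close>

lemma fixed_point_borel:
  assumes A: "borel_positive_times A" and B: "borel_positive_times B"
    and u: "(\<lambda>(t, x). u t x) \<in> borel_measurable (lebesgue_on ({0<..} \<times> UNIV))"
    and \<theta>: "(\<lambda>(t, x). \<theta> t x) \<in> borel_measurable (lebesgue_on ({0<..} \<times> UNIV))"
    and fp: "\<forall>t>0. \<forall>x. u t x = velocity_map A u \<theta> t x \<and> \<theta> t x = temperature_map B u \<theta> t x"
  shows "borel_positive_times u" "borel_positive_times \<theta>"
proof -
  obtain v where v: "borel_positive_times v" "AE p in lborel. 0 < fst p \<longrightarrow> u (fst p) (snd p) = v (fst p) (snd p)"
    using lebesgue_on_positive_times_AE_borel[OF u] by blast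
  obtain \<eta> where \<eta>: "borel_positive_times \<eta>" "AE p in lborel. 0 < fst p \<longrightarrow> \<theta> (fst p) (snd p) = \<eta> (fst p) (snd p)"
    using lebesgue_on_positive_times_AE_borel[OF \<theta>] by blast
  have m: "borel_positive_times (\<lambda>s y. outer (v s y) (v s y))"
    "borel_positive_times (\<lambda>s y. outer e3 (\<eta> s y *\<^sub>R v s y))" "borel_positive_times (\<lambda>s y. \<eta> s y *\<^sub>R v s y)"
    by (intro borel_positive_times_outer borel_positive_times_scaleR borel_positive_times_const v \<eta>)+
  have eq: "duhamel N F = duhamel N G"
    if "parabolic_kernel a N" "borel_positive_times G"
      "AE p in lborel. 0 < fst p \<longrightarrow> F (fst p) (snd p) = G (fst p) (snd p)" for a N F G
    using duhamel_eq_borel[OF that] duhamel_eq_borel[OF that(1,2), of G] by (auto simp: fun_eq_iff)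
  have 1: "duhamel leray_div_kernel (\<lambda>s y. outer (u s y) (u s y)) = duhamel leray_div_kernel (\<lambda>s y. outer (v s y) (v s y))"
    by (rule eq[OF parabolic_kernel_leray_div m(1)]) (use v(2) in \<open>eventually_elim, simp\<close>)
  have 2: "duhamel timed_leray_div_kernel (\<lambda>s y. outer e3 (\<theta> s y *\<^sub>R u s y)) = duhamel timed_leray_div_kernel (\<lambda>s y. outer e3 (\<eta> s y *\<^sub>R v s y))"
    by (rule eq[OF parabolic_kernel_timed_leray_div m(2)]) (use v(2) \<eta>(2) in \<open>eventually_elim, simp\<close>)
  have 3: "duhamel div_kernel (\<lambda>s y. \<theta> s y *\<^sub>R u s y) = duhamel div_kernel (\<lambda>s y. \<eta> s y *\<^sub>R v s y)"
    by (rule eq[OF parabolic_kernel_div m(3)]) (use v(2) \<eta>(2) in \<open>eventually_elim, simp\<close>)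
  have "borel_positive_times (\<lambda>t x. A t x - duhamel leray_div_kernel (\<lambda>s y. outer (v s y) (v s y)) t x
     - duhamel timed_leray_div_kernel (\<lambda>s y. outer e3 (\<eta> s y *\<^sub>R v s y)) t x)"
    by (intro borel_positive_times_diff A borel_positive_times_duhamel[OF parabolic_kernel_leray_div]
            borel_positive_times_duhamel[OF parabolic_kernel_timed_leray_div] m)
  then show "borel_positive_times u"
    by (rule borel_positive_times_cong) (use fp in \<open>simp add: velocity_map_def 1 2\<close>)
  have "borel_positive_times (\<lambda>t x. B t x - duhamel div_kernel (\<lambda>s y. \<eta> s y *\<^sub>R v s y) t x)"
    by (intro borel_positive_times_diff B borel_positive_times_duhamel[OF parabolic_kernel_div] m)
  then show "borel_positive_times \<theta>"
    by (rule borel_positive_times_cong) (use fp in \<open>simp add: temperature_map_def 3\<close>)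
qed

theorem theorem3p1:
  "\<exists>\<epsilon> C :: real. 0 < \<epsilon> \<and> 0 < C \<and>
    (\<forall>(u0 :: R3 \<Rightarrow> R3) (\<theta>0 :: (R3 \<Rightarrow> real) \<Rightarrow> real).
      u0 \<in> borel_measurable lebesgue \<longrightarrow> divergence_free u0 \<longrightarrow> tempered_distribution \<theta>0 \<longrightarrow>
      (SUP x. ereal (norm x * norm (u0 x))) < ereal \<epsilon> \<longrightarrow>
      normX (\<lambda>t x. t *\<^sub>R heat_leray_distr t \<theta>0 x) < ereal \<epsilon> \<longrightarrow>
      normY (\<lambda>t x. heat_distr t \<theta>0 x) < ereal \<epsilon> \<longrightarrow>
      (\<exists>u\<in>spaceX. \<exists>\<theta>\<in>spaceY.
        mild_solution u0 \<theta>0 u \<theta> \<and> normX u \<le> ereal (C * \<epsilon>) \<and> normY \<theta> \<le> ereal (C * \<epsilon>) \<and>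
        (\<forall>u'\<in>spaceX. \<forall>\<theta>'\<in>spaceY.
          mild_solution u0 \<theta>0 u' \<theta>' \<longrightarrow> normX u' \<le> ereal (C * \<epsilon>) \<longrightarrow> normY \<theta>' \<le> ereal (C * \<epsilon>) \<longrightarrow>
          (\<forall>t>0. \<forall>x. u' t x = u t x \<and> \<theta>' t x = \<theta> t x))))"
proof -
  obtain H where H: "0 < H" "\<forall>f r. 0 \<le> r \<longrightarrow> (\<forall>x. norm x * norm (f x) \<le> r) \<longrightarrow>
     (\<forall>t>0. \<forall>x. norm (heat t f x) \<le> H * r / pnorm t x)"
    using norm_heat_le by blast
  obtain K where K: "0 < K" and maps: "\<forall>r A B. 0 \<le> r \<longrightarrow> 4 * K * r \<le> 1 \<longrightarrow> in_XY_ball (r / 2) A B \<longrightarrow>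
    (\<forall>u \<theta>. in_XY_ball r u \<theta> \<longrightarrow> in_XY_ball r (velocity_map A u \<theta>) (temperature_map B u \<theta>)) \<and>
    (\<forall>u \<theta> u' \<theta>' d. in_XY_ball r u \<theta> \<longrightarrow> in_XY_ball r u' \<theta>' \<longrightarrow> 0 \<le> d \<longrightarrow> XY_close d u \<theta> u' \<theta>' \<longrightarrow>
       XY_close (d / 2) (velocity_map A u \<theta>) (temperature_map B u \<theta>) (velocity_map A u' \<theta>') (temperature_map B u' \<theta>'))"
    using duhamel_map_estimates by blast
  \<comment> \<open>the data terms are bounded by \<open>(H + 1) \<epsilon> = r / 2\<close>, and \<open>\<epsilon>\<close> is chosen such that \<open>4 K r = 1\<close>\<close>
  define C where "C = 2 * (H + 1)"
  define \<epsilon> where "\<epsilon> = 1 / (4 * K * C)"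
  define r where "r = C * \<epsilon>"
  have C: "0 < C" and \<epsilon>: "0 < \<epsilon>" using H(1) K by (auto simp: C_def \<epsilon>_def)
  have r: "0 \<le> r" "4 * K * r \<le> 1" "(H + 1) * \<epsilon> = r / 2" "\<epsilon> \<le> r / 2"
    using C \<epsilon> K H(1) by (auto simp: r_def) (auto simp: \<epsilon>_def C_def field_simps)
  show ?thesis
  proof (rule exI[of _ \<epsilon>], rule exI[of _ C], intro conjI allI impI C \<epsilon>)
    fix u0 :: "R3 \<Rightarrow> R3" and \<theta>0 :: "(R3 \<Rightarrow> real) \<Rightarrow> real"
    assume u0: "u0 \<in> borel_measurable lebesgue" and T: "tempered_distribution \<theta>0"
      and s1: "(SUP x. ereal (norm x * norm (u0 x))) < ereal \<epsilon>"
      and s2: "normX (\<lambda>t x. t *\<^sub>R heat_leray_distr t \<theta>0 x) < ereal \<epsilon>"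
      and s3: "normY (\<lambda>t x. heat_distr t \<theta>0 x) < ereal \<epsilon>"
    define A where "A = (\<lambda>t x. heat t u0 x + t *\<^sub>R heat_leray_distr t \<theta>0 x)"
    define B where "B = (\<lambda>t x. heat_distr t \<theta>0 x)"
    have "norm x * norm (u0 x) \<le> \<epsilon>" for x
      using less_imp_le[OF s1] by (simp add: SUP_le_iff)
    then have b1: "norm (heat t u0 x) \<le> H * \<epsilon> / pnorm t x" if "0 < t" for t x
      using H(2) \<epsilon> that by (meson less_imp_le)
    have b2: "norm (t *\<^sub>R heat_leray_distr t \<theta>0 x) \<le> \<epsilon> / pnorm t x" if "0 < t" for t x
      using less_imp_le[OF s2] that unfolding normX_le_iff by blast
    have b3: "\<bar>heat_distr t \<theta>0 x\<bar> \<le> \<epsilon> / pnorm t x ^ 3" if "0 < t" for t x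
      using less_imp_le[OF s3] that unfolding normY_le_iff by blast
    have mA: "borel_positive_times A"
    proof -
      have "(\<lambda>p. indicator {0<..} (fst p) *\<^sub>R heat (fst p) u0 (snd p)
         + fst p *\<^sub>R (indicator {0<..} (fst p) *\<^sub>R heat_leray_distr (fst p) \<theta>0 (snd p))) \<in> borel_measurable borel"
        by (intro borel_measurable_add borel_measurable_scaleR borel_measurable_heat[OF u0] borel_measurable_heat_leray_distr[OF T])
           measurable
      then show ?thesis by (simp add: borel_positive_times_def A_def scaleR_add_right mult.commute)
    qed
    have mB: "borel_positive_times B"
      using borel_measurable_heat_distr[OF T] by (simp add: borel_positive_times_def B_def)
    have AB: "in_XY_ball (r / 2) A B"
      unfolding in_XY_ball_def
    proof (intro conjI allI impI mA mB)
      fix t :: real and x :: R3 assume t: "0 < t"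
      have "norm (A t x) \<le> H * \<epsilon> / pnorm t x + \<epsilon> / pnorm t x"
        unfolding A_def by (rule order_trans[OF norm_triangle_ineq add_mono[OF b1[OF t] b2[OF t]]])
      also have "\<dots> = (H + 1) * \<epsilon> / pnorm t x" by (simp add: distrib_right add_divide_distrib)
      finally show "norm (A t x) \<le> r / 2 / pnorm t x" by (simp only: r(3))
      have "\<bar>B t x\<bar> \<le> \<epsilon> / pnorm t x ^ 3" unfolding B_def by (rule b3[OF t])
      also have "\<dots> \<le> r / 2 / pnorm t x ^ 3" using r(4) t by (intro divide_right_mono) (auto simp: pnorm_nonneg)
      finally show "\<bar>B t x\<bar> \<le> r / 2 / pnorm t x ^ 3" .
    qed
    note self = maps[rule_format, OF r(1,2) AB, THEN conjunct1, rule_format]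
    note contr = maps[rule_format, OF r(1,2) AB, THEN conjunct2, rule_format]
    obtain u \<theta> where w: "in_XY_ball r u \<theta>"
      and fp: "\<forall>t>0. \<forall>x. u t x = velocity_map A u \<theta> t x \<and> \<theta> t x = temperature_map B u \<theta> t x"
      using fixed_point[of r "velocity_map A" "temperature_map B", OF r(1) self contr] by blast
    have nX: "normX u \<le> ereal r" and nY: "normY \<theta> \<le> ereal r"
      using w by (auto simp: in_XY_ball_def normX_le_iff normY_le_iff)
    have sp: "u \<in> spaceX" "\<theta> \<in> spaceY"
      using w nX nY borel_positive_times_lebesgue_on
      by (auto simp: spaceX_def spaceY_def in_XY_ball_def intro: le_less_trans)
    have mild: "mild_solution u0 \<theta>0 u \<theta>"
      using fp by (simp add: mild_solution_iff_maps A_def B_def)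
    have uniq: "u' t x = u t x \<and> \<theta>' t x = \<theta> t x"
      if u': "u' \<in> spaceX" "\<theta>' \<in> spaceY" "mild_solution u0 \<theta>0 u' \<theta>'" "normX u' \<le> ereal r" "normY \<theta>' \<le> ereal r"
        and t: "0 < t" for u' \<theta>' t x
    proof -
      have fp': "\<forall>t>0. \<forall>x. u' t x = velocity_map A u' \<theta>' t x \<and> \<theta>' t x = temperature_map B u' \<theta>' t x"
        using u'(3) by (simp add: mild_solution_iff_maps A_def B_def)
      have "borel_positive_times u'" "borel_positive_times \<theta>'"
        using u'(1,2) fixed_point_borel[OF mA mB _ _ fp'] by (auto simp: spaceX_def spaceY_def)
      then have w': "in_XY_ball r u' \<theta>'"
        using u'(4,5) by (simp add: in_XY_ball_def normX_le_iff normY_le_iff)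
      show ?thesis
        using fixed_point_unique[of r "velocity_map A" "temperature_map B", OF r(1) contr w' fp' w fp t] by auto
    qed
    show "\<exists>u\<in>spaceX. \<exists>\<theta>\<in>spaceY.
        mild_solution u0 \<theta>0 u \<theta> \<and> normX u \<le> ereal (C * \<epsilon>) \<and> normY \<theta> \<le> ereal (C * \<epsilon>) \<and>
        (\<forall>u'\<in>spaceX. \<forall>\<theta>'\<in>spaceY.
          mild_solution u0 \<theta>0 u' \<theta>' \<longrightarrow> normX u' \<le> ereal (C * \<epsilon>) \<longrightarrow> normY \<theta>' \<le> ereal (C * \<epsilon>) \<longrightarrow>
          (\<forall>t>0. \<forall>x. u' t x = u t x \<and> \<theta>' t x = \<theta> t x))"
      unfolding r_def[symmetric] using sp mild nX nY uniq by blast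
  qed
qed

end
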